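(* Let $n\ge2$ and let $0=\alpha_0<\alpha_1<\cdots<\alpha_{2n-1}<2\pi$ be distinct real numbers; put $\alpha_{2n}:=2\pi$. Let $f$ be the Kobayashi surface of principal type with angular data $(\alpha_0,\dots,\alpha_{2n-1})$, i.e. the maxface associated to $$g=z^{n-1},\qquad \omega=\frac{\mathrm{i}\Lambda\,dz}{\prod_{j=0}^{2n-1}(z-e^{\mathrm{i}\alpha_j})},\qquad \Lambda=\exp\left(\mathrm{i}\,\frac{\alpha_0+\cdots+\alpha_{2n-1}}2\right).$$ Suppose that $$|\alpha_j-\alpha_{j+1}|\le\frac{\pi}{n-1}\qquad(j=0,\dots,2n-1).$$ Let $\tilde f=(\tilde x_0,\tilde x_1,\tilde x_2):\Omega_{\alpha_0,\dots,\alpha_{2n-1}}\to\mathbb{R}^3_1$ be its analytic extension. Then the map $(\tilde x_1,\tilde x_2):\Omega_{\alpha_0,\dots,\alpha_{2n-1}}\to\mathbb{R}^2$ is a diffeomorphism. In particular, the image of $\tilde f$ is a zero mean curvature entire graph of mixed type.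
   Context: $\mathbb{R}^3_1$ is Lorentz–Minkowski 3-space with signature $(-,+,+)$ and coordinates $(t,x,y)=(x_0,x_1,x_2)$; $S^2=\mathbb{C}\cup\{\infty\}$; $\mathrm{i}=\sqrt{-1}$. The maxface associated to $(g,\omega)$ is $f=\mathrm{Re}\int(-2g,1+g^2,\mathrm{i}(1-g^2))\omega$, which here is single-valued on $S^2\setminus\{e^{\mathrm{i}\alpha_0},\dots,e^{\mathrm{i}\alpha_{2n-1}}\}$ and satisfies $f(1/\bar z)=f(z)$. Domain of the analytic extension: $$\Omega_{\alpha_0,\dots,\alpha_{2n-1}}=\left\{(u,\theta)\in\mathbb{R}\times\mathbb{R}/2\pi\mathbb{Z}: u>\max_{j}\cos(\theta-\alpha_j)\right\}\cup\{p_\infty\},$$ a real analytic 2-manifold with coordinates $(u,\theta)$ away from $p_\infty$ and, near $p_\infty$, with coordinate $z=re^{\mathrm{i}\theta}$ in a disk about $0$, where $r=u-\sqrt{u^2-1}$ and $p_\infty$ corresponds to $z=0$. Let $\iota(re^{\mathrm{i}\theta})=\left(\frac{r+r^{-1}}2,\theta\right)$ for $0<r\le1$ and $\iota(0)=p_\infty$. The analytic extension $\tilde f$ of $f$ is the (unique) real analytic map on $\Omega_{\alpha_0,\dots,\alpha_{2n-1}}$ with $\tilde f\circ\iota=f$ on $\{|z|\le1\}\setminus\{e^{\mathrm{i}\alpha_j}\}$. An entire graph is a set $\{(\lambda(x,y),x,y):(x,y)\in\mathbb{R}^2\}$ with $\lambda:\mathbb{R}^2\to\mathbb{R}$ smooth;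 it has zero mean curvature if $(1-\lambda_y^2)\lambda_{xx}+2\lambda_x\lambda_y\lambda_{xy}+(1-\lambda_x^2)\lambda_{yy}=0$; it is of mixed type if it has both space-like points ($\lambda_x^2+\lambda_y^2<1$) and time-like points ($\lambda_x^2+\lambda_y^2>1$). *)

theory Defs
  imports "HOL-Complex_Analysis.Complex_Analysis"
begin

section \<open>Smooth and real analytic functions\<close>

text \<open>These notions are meant for open sets \<open>S\<close>.\<close>

fun Ck_on :: "nat \<Rightarrow> ('a::real_normed_vector \<Rightarrow> 'b::real_normed_vector) \<Rightarrow> 'a set \<Rightarrow> bool" where
  "Ck_on 0 f S \<longleftrightarrow> continuous_on S f"
| "Ck_on (Suc k) f S \<longleftrightarrow>
     (\<forall>x\<in>S. f differentiable (at x)) \<and> (\<forall>v. Ck_on k (\<lambda>x. frechet_derivative f (at x) v) S)"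

definition smooth_on :: "('a::real_normed_vector \<Rightarrow> 'b::real_normed_vector) \<Rightarrow> 'a set \<Rightarrow> bool" where
  "smooth_on f S \<longleftrightarrow> (\<forall>k. Ck_on k f S)"

definition real_analytic_on :: "(real \<times> real \<Rightarrow> 'b::real_normed_vector) \<Rightarrow> (real \<times> real) set \<Rightarrow> bool" where
  "real_analytic_on f S \<longleftrightarrow>
     (\<forall>(a, b)\<in>S. \<exists>e>0. \<exists>c :: nat \<Rightarrow> nat \<Rightarrow> 'b. \<forall>(x, y)\<in>ball (a, b) e.
        ((\<lambda>(i, j). ((x - a) ^ i * (y - b) ^ j) *\<^sub>R c i j) has_sum f (x, y)) UNIV)"

section \<open>Maxfaces\<close>

text \<open>
  Points of Lorentz--Minkowski 3-space are triples \<open>(t, x, y) = (x\<^sub>0, x\<^sub>1, x\<^sub>2)\<close>, so \<open>snd\<close> is the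
  projection \<open>(x\<^sub>1, x\<^sub>2)\<close>. The one-form is \<open>\<omega> = h dz\<close>. The predicate says that the real parts of
  the integrals are path-independent in \<open>S\<close> and that \<open>f\<close> is, up to a translation, their value.
\<close>

definition maxface_on ::
  "complex set \<Rightarrow> (complex \<Rightarrow> complex) \<Rightarrow> (complex \<Rightarrow> complex) \<Rightarrow> (complex \<Rightarrow> real \<times> real \<times> real) \<Rightarrow> bool"
  where
  "maxface_on S g h f \<longleftrightarrow>
     (\<forall>\<gamma>. valid_path \<gamma> \<and> path_image \<gamma> \<subseteq> S \<longrightarrow>
        f (pathfinish \<gamma>) - f (pathstart \<gamma>) =
          (Re (contour_integral \<gamma> (\<lambda>z. - 2 * g z * h z)),
           Re (contour_integral \<gamma> (\<lambda>z. (1 + (g z)\<^sup>2) * h z)),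
           Re (contour_integral \<gamma> (\<lambda>z. \<i> * (1 - (g z)\<^sup>2) * h z))))"

definition nodes :: "nat \<Rightarrow> (nat \<Rightarrow> real) \<Rightarrow> complex set" where
  "nodes n \<alpha> = (\<lambda>j. cis (\<alpha> j)) ` {..<2 * n}"

definition kobayashi_g :: "nat \<Rightarrow> complex \<Rightarrow> complex" where
  "kobayashi_g n z = z ^ (n - 1)"

definition kobayashi_\<Lambda> :: "nat \<Rightarrow> (nat \<Rightarrow> real) \<Rightarrow> complex" where
  "kobayashi_\<Lambda> n \<alpha> = exp (\<i> * of_real ((\<Sum>j<2 * n. \<alpha> j) / 2))"

definition kobayashi_h :: "nat \<Rightarrow> (nat \<Rightarrow> real) \<Rightarrow> complex \<Rightarrow> complex" where
  "kobayashi_h n \<alpha> z = \<i> * kobayashi_\<Lambda> n \<alpha> / (\<Prod>j<2 * n. z - cis (\<alpha> j))"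

text \<open>
  The sphere \<open>\<complex> \<union> {\<infinity>}\<close> is \<open>complex option\<close>, with \<open>None\<close> as \<open>\<infinity>\<close>. The three one-forms are
  holomorphic at \<open>\<infinity>\<close>, so the value there is the limit of the values at finite points.
\<close>

definition kobayashi_surface ::
  "nat \<Rightarrow> (nat \<Rightarrow> real) \<Rightarrow> (complex option \<Rightarrow> real \<times> real \<times> real) \<Rightarrow> bool" where
  "kobayashi_surface n \<alpha> f \<longleftrightarrow>
     maxface_on (- nodes n \<alpha>) (kobayashi_g n) (kobayashi_h n \<alpha>) (\<lambda>z. f (Some z)) \<and>
     ((\<lambda>z. f (Some z)) \<longlongrightarrow> f None) at_infinity"

section \<open>The domain of the analytic extension\<close>

text \<open>
  The circle \<open>\<real>/2\<pi>\<int>\<close> is identified with the unit circle via \<open>\<theta> \<mapsto> cis \<theta>\<close>: the point \<open>(u, \<theta>)\<close> is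
  \<open>Pt u (cis \<theta>)\<close>.
\<close>

datatype ext_point = Pt real complex | P_inf

definition polar_dom :: "nat \<Rightarrow> (nat \<Rightarrow> real) \<Rightarrow> (real \<times> real) set" where
  "polar_dom n \<alpha> = {(u, \<theta>). u > Max ((\<lambda>j. cos (\<theta> - \<alpha> j)) ` {..<2 * n})}"

definition polar_pt :: "real \<times> real \<Rightarrow> ext_point" where
  "polar_pt = (\<lambda>(u, \<theta>). Pt u (cis \<theta>))"

definition Omega :: "nat \<Rightarrow> (nat \<Rightarrow> real) \<Rightarrow> ext_point set" where
  "Omega n \<alpha> = polar_pt ` polar_dom n \<alpha> \<union> {P_inf}"

definition iota :: "complex \<Rightarrow> ext_point" where
  "iota z = (if z = 0 then P_inf else Pt ((norm z + inverse (norm z)) / 2) (sgn z))"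

text \<open>
  The manifold structure of \<open>Omega n \<alpha>\<close> is given by two local parametrizations \<open>(V, \<phi>)\<close>, which are
  inverses of coordinate systems: \<open>(u, \<theta>)\<close> away from \<open>P_inf\<close> (with \<open>\<theta>\<close> lifted to \<open>\<real>\<close>, so that
  \<open>polar_pt\<close> is only locally injective) and \<open>z\<close> in the unit disk around \<open>P_inf\<close>. On \<open>0 < r < 1\<close> the
  relation \<open>r = u - sqrt (u\<^sup>2 - 1)\<close> amounts to \<open>u = (r + 1/r) / 2\<close> with \<open>u > 1\<close>, so the latter
  parametrization is \<open>iota\<close>.
\<close>

definition Omega_atlas :: "nat \<Rightarrow> (nat \<Rightarrow> real) \<Rightarrow> ((real \<times> real) set \<times> (real \<times> real \<Rightarrow> ext_point)) set" where
  "Omega_atlas n \<alpha> = {(polar_dom n \<alpha>, polar_pt), (ball (0, 0) 1, \<lambda>(x, y). iota (Complex x y))}"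

definition Omega_analytic :: "nat \<Rightarrow> (nat \<Rightarrow> real) \<Rightarrow> (ext_point \<Rightarrow> 'b::real_normed_vector) \<Rightarrow> bool" where
  "Omega_analytic n \<alpha> F \<longleftrightarrow> (\<forall>(V, \<phi>)\<in>Omega_atlas n \<alpha>. real_analytic_on (F \<circ> \<phi>) V)"

definition Omega_smooth :: "nat \<Rightarrow> (nat \<Rightarrow> real) \<Rightarrow> (ext_point \<Rightarrow> 'b::real_normed_vector) \<Rightarrow> bool" where
  "Omega_smooth n \<alpha> F \<longleftrightarrow> (\<forall>(V, \<phi>)\<in>Omega_atlas n \<alpha>. smooth_on (F \<circ> \<phi>) V)"

text \<open>A map into \<open>Omega n \<alpha>\<close> is smooth if it locally lifts to a smooth map through a parametrization.\<close>

definition smooth_into_Omega :: "nat \<Rightarrow> (nat \<Rightarrow> real) \<Rightarrow> ('a::real_normed_vector \<Rightarrow> ext_point) \<Rightarrow> bool" where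
  "smooth_into_Omega n \<alpha> H \<longleftrightarrow>
     (\<forall>p. \<exists>(V, \<phi>)\<in>Omega_atlas n \<alpha>. \<exists>U h. open U \<and> p \<in> U \<and> smooth_on h U \<and> h ` U \<subseteq> V \<and>
        (\<forall>q\<in>U. H q = \<phi> (h q)))"

definition Omega_diffeomorphism :: "nat \<Rightarrow> (nat \<Rightarrow> real) \<Rightarrow> (ext_point \<Rightarrow> real \<times> real) \<Rightarrow> bool" where
  "Omega_diffeomorphism n \<alpha> G \<longleftrightarrow>
     bij_betw G (Omega n \<alpha>) UNIV \<and> Omega_smooth n \<alpha> G \<and>
     smooth_into_Omega n \<alpha> (inv_into (Omega n \<alpha>) G)"

definition analytic_extension ::
  "nat \<Rightarrow> (nat \<Rightarrow> real) \<Rightarrow> (complex option \<Rightarrow> real \<times> real \<times> real) \<Rightarrow> (ext_point \<Rightarrow> real \<times> real \<times> real) \<Rightarrow> bool"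
  where
  "analytic_extension n \<alpha> f F \<longleftrightarrow>
     Omega_analytic n \<alpha> F \<and> (\<forall>z\<in>cball 0 1 - nodes n \<alpha>. F (iota z) = f (Some z))"

section \<open>Zero mean curvature entire graphs of mixed type\<close>

definition dx :: "(real \<times> real \<Rightarrow> real) \<Rightarrow> real \<times> real \<Rightarrow> real" where
  "dx l = (\<lambda>(x, y). deriv (\<lambda>s. l (s, y)) x)"

definition dy :: "(real \<times> real \<Rightarrow> real) \<Rightarrow> real \<times> real \<Rightarrow> real" where
  "dy l = (\<lambda>(x, y). deriv (\<lambda>s. l (x, s)) y)"

definition entire_graph_of :: "(real \<times> real \<Rightarrow> real) \<Rightarrow> (real \<times> real \<times> real) set \<Rightarrow> bool" where
  "entire_graph_of l A \<longleftrightarrow> smooth_on l UNIV \<and> A = {(l (x, y), x, y) | x y. True}"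

definition zero_mean_curvature :: "(real \<times> real \<Rightarrow> real) \<Rightarrow> bool" where
  "zero_mean_curvature l \<longleftrightarrow>
     (\<forall>p. (1 - (dy l p)\<^sup>2) * dx (dx l) p + 2 * dx l p * dy l p * dy (dx l) p
          + (1 - (dx l p)\<^sup>2) * dy (dy l) p = 0)"

definition mixed_type :: "(real \<times> real \<Rightarrow> real) \<Rightarrow> bool" where
  "mixed_type l \<longleftrightarrow>
     (\<exists>p. (dx l p)\<^sup>2 + (dy l p)\<^sup>2 < 1) \<and> (\<exists>p. (dx l p)\<^sup>2 + (dy l p)\<^sup>2 > 1)"

definition zmc_entire_graph_of_mixed_type :: "(real \<times> real \<times> real) set \<Rightarrow> bool" where
  "zmc_entire_graph_of_mixed_type A \<longleftrightarrow>
     (\<exists>l. entire_graph_of l A \<and> zero_mean_curvature l \<and> mixed_type l)"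

end

theory Submission
  imports Defs
begin

text \<open>
  The point \<open>w = cis \<theta> / u\<close> identifies the domain of the extension with the interior \<open>P\<close> of the
  polygon cut out by the tangents of the unit circle at the nodes (the unit disk with \<open>r = |z|\<close> becomes
  the Klein disk \<open>w = 2 z / (1 + |z|\<^sup>2)\<close>). Since the residues \<open>v\<^sub>j\<close> are real and sum to zero, the
  extension is \<open>\<Sum>j. v\<^sub>j ln (1 - \<langle>w, cis \<alpha>\<^sub>j\<rangle>)\<close> up to a constant, first on the disk by integration and then on
  each ray \<open>\<theta> = const\<close> by uniqueness of analytic continuation.

  The derivatives of this sum are values of a sequence satisfying the Chebyshev recurrence with
  parameter \<open>u\<close>. Vajda's identity turns the first fundamental form into a multiple of
  \<open>(1 - q\<^sup>2) dp\<^sup>2 + 2 p q dp dq + (1 - p\<^sup>2) dq\<^sup>2\<close> and the Jacobian of the projection into a nonzero multiple of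
  a Chebyshev polynomial of the second kind, which is positive because the gap condition gives
  \<open>u > cos (pi / (2 (n - 1)))\<close>. The gap condition also makes the projection proper, so it is a covering
  of the plane by a connected set, hence a bijection. The zero mean curvature equation follows
  from the wave equation satisfied by each logarithm.
\<close>

section \<open>Calculus of smooth maps\<close>

text \<open>The recurrence has a finite source. The Lagrange sums of
  \<open>\<zeta> j ^ k / \<zeta>_prod j\<close> vanish for \<open>k \<le> 2 * n - 2\<close>, and
  differentiating the logarithms brings in the denominator \<open>- 2 * \<zeta> j * D j w\<close>,
  which is a quadratic in \<open>\<zeta> j\<close>. Read as a shift in \<open>k\<close>, this
  quadratic clears the denominator, so the three-term recurrence reaches exactly the indices 0 to
  \<open>2 * n\<close> that the metric needs. The obstacle is the region outside the unit circle,
  where \<open>u < 1\<close> and Chebyshev polynomials may vanish. The Jacobian involves the one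
  whose largest zero is cos (pi / (2 (n - 1))), and half an admissible gap is pi / (2 (n - 1)): the
  two constants match. A nonzero Jacobian does not give injectivity, so the boundary has to be
  controlled. There neighbouring residues have opposite signs, and their phases differ by n - 1
  times a gap, an amount in (0, pi]. Hence the two diverging coefficient vectors are never opposite
  and cannot cancel. The centre w = 0 corresponds to infinite \<open>u\<close> and needs its own
  computation.\<close>

lemma frechet_derivative_cong_open:
  assumes "open S" "x \<in> S" "\<And>y. y \<in> S \<Longrightarrow> f y = g y"
  shows "frechet_derivative f (at x) = frechet_derivative g (at x)"
proof -
  have "(f has_derivative D) (at x) \<longleftrightarrow> (g has_derivative D) (at x)" for D
    using assms has_derivative_transform_within_open[of f D x UNIV S g]
      has_derivative_transform_within_open[of g D x UNIV S f] by auto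
  then show ?thesis
    by (simp add: frechet_derivative_def)
qed

lemma Ck_on_cong:
  assumes "open S" "\<And>x. x \<in> S \<Longrightarrow> f x = g x" "Ck_on k f S"
  shows "Ck_on k g S"
  using assms(2,3)
proof (induction k arbitrary: f g)
  case 0
  then show ?case
    by (metis Ck_on.simps(1) continuous_on_cong)
next
  case (Suc k)
  have "frechet_derivative f (at x) = frechet_derivative g (at x)" if "x \<in> S" for x
    by (rule frechet_derivative_cong_open[OF assms(1) that]) (use Suc.prems in auto)
  moreover have "g differentiable (at x)" if "x \<in> S" for x
    using Suc.prems that assms(1) has_derivative_transform_within_open[of f _ x UNIV S g]
    by (auto simp: differentiable_def) metis
  ultimately show ?case
    using Suc.prems Suc.IH[of "\<lambda>x. frechet_derivative f (at x) _" "\<lambda>x. frechet_derivative g (at x) _"]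
    by auto
qed

text \<open>Lets the later inductions exhibit an explicit derivative instead of the chosen
  \<open>frechet_derivative\<close>.\<close>

lemma Ck_on_SucI:
  assumes "open S" "\<And>x. x \<in> S \<Longrightarrow> (f has_derivative f' x) (at x)" "\<And>v. Ck_on k (\<lambda>x. f' x v) S"
  shows "Ck_on (Suc k) f S"
proof -
  have "Ck_on k (\<lambda>x. frechet_derivative f (at x) v) S" for v
    by (rule Ck_on_cong[OF assms(1) _ assms(3)[of v]]) (metis assms(2) frechet_derivative_at)
  then show ?thesis
    using assms(2) by (auto simp: differentiable_def)
qed

lemma Ck_on_SucD: "Ck_on (Suc k) f S \<Longrightarrow> Ck_on k f S"
proof (induction k arbitrary: f)
  case 0
  then show ?case
    by (auto intro: differentiable_imp_continuous_on simp: differentiable_on_def differentiable_at_withinI)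
next
  case (Suc k)
  then show ?case
    by (meson Ck_on.simps(2))
qed

lemma Ck_on_has_derivative:
  assumes "Ck_on (Suc k) f S" "x \<in> S"
  shows "(f has_derivative frechet_derivative f (at x)) (at x)"
  using assms by (simp add: frechet_derivative_works)

lemma Ck_on_subset: "Ck_on k f S \<Longrightarrow> T \<subseteq> S \<Longrightarrow> Ck_on k f T"
  by (induction k arbitrary: f) (auto intro: continuous_on_subset)

lemma Ck_on_local:
  assumes "\<And>x. x \<in> S \<Longrightarrow> \<exists>U. open U \<and> x \<in> U \<and> Ck_on k f U"
  shows "Ck_on k f S"
  using assms
proof (induction k arbitrary: f)
  case 0
  then show ?case
    by (auto intro!: continuous_at_imp_continuous_on) (metis continuous_on_eq_continuous_at)
next
  case (Suc k)
  then show ?case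
    by simp meson
qed

lemma Ck_on_const: "open S \<Longrightarrow> Ck_on k (\<lambda>x. c) S"
proof (induction k arbitrary: c)
  case (Suc k)
  then show ?case
    by (intro Ck_on_SucI[where f' = "\<lambda>x v. 0"]) auto
qed auto

lemma Ck_on_bounded_linear:
  assumes "bounded_linear f" "open S"
  shows "Ck_on k f S"
proof (cases k)
  case 0
  then show ?thesis
    using assms linear_continuous_on by auto
next
  case (Suc k')
  then show ?thesis
    unfolding Suc using assms
    by (intro Ck_on_SucI[where f' = "\<lambda>x. f"] Ck_on_const bounded_linear_imp_has_derivative)
qed

lemma Ck_on_add:
  assumes "open S" "Ck_on k f S" "Ck_on k g S"
  shows "Ck_on k (\<lambda>x. f x + g x) S"
  using assms(2,3)
proof (induction k arbitrary: f g)
  case (Suc k)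
  show ?case
    by (rule Ck_on_SucI[OF assms(1) has_derivative_add[OF Suc.prems[THEN Ck_on_has_derivative]]])
      (use Suc in auto)
qed (auto intro: continuous_on_add)

lemma Ck_on_bilinear:
  assumes "open S" "bounded_bilinear b" "Ck_on k f S" "Ck_on k g S"
  shows "Ck_on k (\<lambda>x. b (f x) (g x)) S"
  using assms(3,4)
proof (induction k arbitrary: f g)
  case 0
  then show ?case
    using bounded_bilinear.continuous_on[OF assms(2)] by auto
next
  case (Suc k)
  have "Ck_on k f S" "Ck_on k g S"
    using Suc.prems by (auto intro: Ck_on_SucD simp del: Ck_on.simps)
  moreover have "Ck_on k (\<lambda>x. frechet_derivative f (at x) v) S" "Ck_on k (\<lambda>x. frechet_derivative g (at x) v) S" for v
    using Suc.prems by auto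
  ultimately show ?case
    by (intro Ck_on_SucI[OF assms(1)
            bounded_bilinear.FDERIV[OF assms(2) Suc.prems[THEN Ck_on_has_derivative]]]
          Ck_on_add[OF assms(1)] Suc.IH Suc.prems)
qed

lemma Ck_on_sum:
  assumes "open S" "\<And>i. i \<in> I \<Longrightarrow> Ck_on k (f i) S"
  shows "Ck_on k (\<lambda>x. \<Sum>i\<in>I. f i x) S"
  using assms(2)
  by (induction I rule: infinite_finite_induct) (auto intro: Ck_on_const Ck_on_add assms(1))

text \<open>\<open>Ck_on\<close> controls derivatives in fixed directions only, whereas the chain
  rule differentiates \<open>f\<close> in a direction that moves with the point. Expanding that
  direction in \<open>Basis\<close> is why the middle space is Euclidean.\<close>

lemma Ck_on_compose:
  fixes f :: "'b::euclidean_space \<Rightarrow> 'c::real_normed_vector"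
  assumes "open S" "Ck_on k f T" "Ck_on k g S" "g ` S \<subseteq> T"
  shows "Ck_on k (\<lambda>x. f (g x)) S"
  using assms(2,3)
proof (induction k arbitrary: f)
  case 0
  then show ?case
    using assms(4) continuous_on_compose2 by auto
next
  case (Suc k)
  have D: "((\<lambda>x. f (g x)) has_derivative
      (\<lambda>v. \<Sum>i\<in>Basis. (frechet_derivative g (at x) v \<bullet> i) *\<^sub>R frechet_derivative f (at (g x)) i)) (at x)"
    if "x \<in> S" for x
  proof -
    have df: "(f has_derivative frechet_derivative f (at (g x))) (at (g x))"
      using Suc.prems(1) assms(4) that by (intro Ck_on_has_derivative) auto
    have dg: "(g has_derivative frechet_derivative g (at x)) (at x)"
      using Suc.prems(2) that by (rule Ck_on_has_derivative)
    interpret bounded_linear "frechet_derivative f (at (g x))"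
      using df by (rule has_derivative_bounded_linear)
    have rep: "frechet_derivative f (at (g x)) w =
        (\<Sum>i\<in>Basis. (w \<bullet> i) *\<^sub>R frechet_derivative f (at (g x)) i)" for w
      by (subst euclidean_representation[of w, symmetric]) (simp only: sum scaleR)
    show ?thesis
      by (rule has_derivative_eq_rhs[OF has_derivative_compose[OF dg df]]) (rule ext, rule rep)
  qed
  show ?case
  proof (rule Ck_on_SucI[OF assms(1) D])
    fix v
    show "Ck_on k (\<lambda>x. \<Sum>i\<in>Basis. (frechet_derivative g (at x) v \<bullet> i) *\<^sub>R frechet_derivative f (at (g x)) i) S"
    proof (rule Ck_on_sum[OF assms(1)])
      fix i :: 'b
      have "Ck_on k (\<lambda>y. frechet_derivative f (at y) i) T" "Ck_on k (\<lambda>x. frechet_derivative g (at x) v) S"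
        using Suc.prems by auto
      then show "Ck_on k (\<lambda>x. (frechet_derivative g (at x) v \<bullet> i) *\<^sub>R frechet_derivative f (at (g x)) i) S"
        using Suc.IH[of "\<lambda>y. frechet_derivative f (at y) i"] Suc.prems(2)[THEN Ck_on_SucD]
        by (intro Ck_on_bilinear[OF assms(1) bounded_bilinear_scaleR]
            Ck_on_bilinear[OF assms(1) bounded_bilinear_inner] Ck_on_const assms(1))
    qed
  qed
qed

lemma Ck_on_Pair:
  assumes "open S" "Ck_on k f S" "Ck_on k g S"
  shows "Ck_on k (\<lambda>x. (f x, g x)) S"
  using assms(2,3)
proof (induction k arbitrary: f g)
  case (Suc k)
  show ?case
    by (rule Ck_on_SucI[OF assms(1) has_derivative_Pair[OF Suc.prems[THEN Ck_on_has_derivative]]])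
      (use Suc in auto)
qed (auto intro: continuous_on_Pair)

lemma Ck_on_Suc_real:
  fixes f :: "real \<Rightarrow> real"
  assumes "open S" "\<And>x. x \<in> S \<Longrightarrow> (f has_real_derivative f' x) (at x)" "Ck_on k f' S"
  shows "Ck_on (Suc k) f S"
  by (rule Ck_on_SucI[OF assms(1) assms(2)[unfolded has_field_derivative_def]])
    (use assms in \<open>auto intro!: Ck_on_bilinear[OF _ bounded_bilinear_mult] Ck_on_const\<close>)

lemma smooth_on_inverse: "smooth_on inverse (- {0::real})"
proof -
  have "Ck_on k inverse (- {0::real})" for k
  proof (induction k)
    case (Suc k)
    have "((\<lambda>x. inverse x) has_real_derivative (-1) * (inverse x * inverse x)) (at x)" if "x \<in> -{0}" for x :: real
      using that by (auto intro!: derivative_eq_intros)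
    moreover have "Ck_on k (\<lambda>x. (-1) * (inverse x * inverse x)) (- {0::real})"
      by (intro Ck_on_bilinear[OF _ bounded_bilinear_mult] Ck_on_const Suc.IH) auto
    ultimately show ?case
      by (intro Ck_on_Suc_real[where f' = "\<lambda>x. (-1) * (inverse x * inverse x)"]) auto
  qed (auto intro!: continuous_intros)
  then show ?thesis
    by (auto simp: smooth_on_def)
qed

lemma smooth_on_ln: "smooth_on ln {0::real<..}"
  unfolding smooth_on_def
proof
  fix k
  show "Ck_on k ln {0::real<..}"
  proof (cases k)
    case (Suc k')
    have "Ck_on k' inverse {0::real<..}"
      using smooth_on_inverse by (auto simp: smooth_on_def intro: Ck_on_subset[of _ _ "-{0}"])
    moreover have "(ln has_real_derivative inverse x) (at x)" if "x \<in> {0<..}" for x :: real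
      using that by (auto intro: DERIV_ln)
    ultimately show ?thesis unfolding Suc
      by (intro Ck_on_Suc_real[where f' = inverse]) auto
  qed (auto intro!: continuous_intros)
qed

lemma smooth_on_sin_cos: "smooth_on sin (UNIV :: real set)" "smooth_on cos (UNIV :: real set)"
proof -
  have "Ck_on k sin (UNIV :: real set) \<and> Ck_on k cos (UNIV :: real set)" for k
  proof (induction k)
    case (Suc k)
    have "Ck_on k (\<lambda>x. (-1) * sin x) (UNIV :: real set)"
      using Suc by (intro Ck_on_bilinear[OF _ bounded_bilinear_mult] Ck_on_const) auto
    moreover have "(cos has_real_derivative (-1) * sin x) (at x)" for x :: real
      using DERIV_cos[of x] by simp
    ultimately show ?case
      using Suc by (intro conjI Ck_on_Suc_real[where f' = cos]
          Ck_on_Suc_real[where f = cos and f' = "\<lambda>x. (-1) * sin x"] DERIV_sin open_UNIV) blast+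
  qed (auto intro!: continuous_intros)
  then show "smooth_on sin (UNIV :: real set)" "smooth_on cos (UNIV :: real set)"
    by (auto simp: smooth_on_def)
qed

section \<open>Closure properties of smooth maps and partial derivatives\<close>

lemma smooth_on_cong: "open S \<Longrightarrow> (\<And>x. x \<in> S \<Longrightarrow> f x = g x) \<Longrightarrow> smooth_on f S \<Longrightarrow> smooth_on g S"
  using Ck_on_cong by (metis smooth_on_def)

lemma smooth_on_subset: "smooth_on f S \<Longrightarrow> T \<subseteq> S \<Longrightarrow> smooth_on f T"
  unfolding smooth_on_def by (metis Ck_on_subset)

lemma smooth_on_local:
  "(\<And>x. x \<in> S \<Longrightarrow> \<exists>U. open U \<and> x \<in> U \<and> smooth_on f U) \<Longrightarrow> smooth_on f S"
  using Ck_on_local by (metis smooth_on_def)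

lemma smooth_on_const: "open S \<Longrightarrow> smooth_on (\<lambda>x. c) S"
  by (simp add: smooth_on_def Ck_on_const)

lemma smooth_on_bounded_linear: "bounded_linear f \<Longrightarrow> open S \<Longrightarrow> smooth_on f S"
  by (simp add: smooth_on_def Ck_on_bounded_linear)

lemma smooth_on_fst: "open S \<Longrightarrow> smooth_on fst S" and smooth_on_snd: "open S \<Longrightarrow> smooth_on snd S"
  by (auto intro: smooth_on_bounded_linear bounded_linear_fst bounded_linear_snd)

lemma smooth_on_add: "open S \<Longrightarrow> smooth_on f S \<Longrightarrow> smooth_on g S \<Longrightarrow> smooth_on (\<lambda>x. f x + g x) S"
  by (simp add: smooth_on_def Ck_on_add)

lemma smooth_on_mult:
  fixes f g :: "_ \<Rightarrow> real"
  shows "open S \<Longrightarrow> smooth_on f S \<Longrightarrow> smooth_on g S \<Longrightarrow> smooth_on (\<lambda>x. f x * g x) S"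
  by (simp add: smooth_on_def Ck_on_bilinear[OF _ bounded_bilinear_mult])

lemma smooth_on_diff:
  fixes f g :: "_ \<Rightarrow> real"
  shows "open S \<Longrightarrow> smooth_on f S \<Longrightarrow> smooth_on g S \<Longrightarrow> smooth_on (\<lambda>x. f x - g x) S"
  using smooth_on_add[of S f "\<lambda>x. (-1) * g x"] smooth_on_mult[of S "\<lambda>x. -1" g] smooth_on_const[of S "-1"]
  by auto

lemma smooth_on_sum: "open S \<Longrightarrow> (\<And>i. i \<in> I \<Longrightarrow> smooth_on (f i) S) \<Longrightarrow> smooth_on (\<lambda>x. \<Sum>i\<in>I. f i x) S"
  by (simp add: smooth_on_def Ck_on_sum)

lemma smooth_on_Pair: "open S \<Longrightarrow> smooth_on f S \<Longrightarrow> smooth_on g S \<Longrightarrow> smooth_on (\<lambda>x. (f x, g x)) S"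
  by (simp add: smooth_on_def Ck_on_Pair)

lemma smooth_on_compose:
  fixes f :: "'b::euclidean_space \<Rightarrow> 'c::real_normed_vector"
  shows "open S \<Longrightarrow> smooth_on f T \<Longrightarrow> smooth_on g S \<Longrightarrow> g ` S \<subseteq> T \<Longrightarrow> smooth_on (\<lambda>x. f (g x)) S"
  unfolding smooth_on_def using Ck_on_compose[of S _ f T g] by blast

lemma smooth_on_divide:
  fixes f g :: "_ \<Rightarrow> real"
  assumes "open S" "smooth_on f S" "smooth_on g S" "\<And>x. x \<in> S \<Longrightarrow> g x \<noteq> 0"
  shows "smooth_on (\<lambda>x. f x / g x) S"
  unfolding divide_inverse
  using assms by (intro smooth_on_mult smooth_on_compose[OF _ smooth_on_inverse]) auto

lemma smooth_on_has_derivative: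
  "smooth_on f S \<Longrightarrow> x \<in> S \<Longrightarrow> (f has_derivative frechet_derivative f (at x)) (at x)"
  unfolding smooth_on_def by (blast intro: Ck_on_has_derivative)

lemma smooth_on_frechet_derivative:
  "smooth_on f S \<Longrightarrow> smooth_on (\<lambda>x. frechet_derivative f (at x) v) S"
  unfolding smooth_on_def by (metis Ck_on.simps(2))

lemma smooth_on_imp_continuous_on: "smooth_on f S \<Longrightarrow> continuous_on S f"
  unfolding smooth_on_def by (metis Ck_on.simps(1))

lemma smooth_on_dx:
  assumes "smooth_on l S" "p \<in> S"
  shows "dx l p = frechet_derivative l (at p) (1, 0)" "dy l p = frechet_derivative l (at p) (0, 1)"
proof -
  obtain x y where p: "p = (x, y)" by force
  have D: "(l has_derivative frechet_derivative l (at (x, y))) (at (x, y))"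
    using smooth_on_has_derivative[OF assms] p by simp
  interpret bounded_linear "frechet_derivative l (at (x, y))"
    using D by (rule has_derivative_bounded_linear)
  have "((\<lambda>s. l (s, y)) has_real_derivative frechet_derivative l (at (x, y)) (1, 0)) (at x)"
    unfolding has_field_derivative_def
  proof (rule has_derivative_eq_rhs[OF has_derivative_compose[of "\<lambda>s. (s, y)" "\<lambda>h. (h, 0)" _ _ l, OF _ D]])
    show "((\<lambda>s. (s, y)) has_derivative (\<lambda>h. (h, 0))) (at x)"
      by (auto intro!: derivative_eq_intros)
    show "(\<lambda>h. frechet_derivative l (at (x, y)) (h, 0)) = (*) (frechet_derivative l (at (x, y)) (1, 0))"
    proof
      fix h
      show "frechet_derivative l (at (x, y)) (h, 0) = frechet_derivative l (at (x, y)) (1, 0) * h"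
        using scaleR[of h "(1, 0)"] by simp
    qed
  qed
  then show "dx l p = frechet_derivative l (at p) (1, 0)"
    unfolding p dx_def by (simp add: DERIV_imp_deriv)
  have "((\<lambda>s. l (x, s)) has_real_derivative frechet_derivative l (at (x, y)) (0, 1)) (at y)"
    unfolding has_field_derivative_def
  proof (rule has_derivative_eq_rhs[OF has_derivative_compose[of "\<lambda>s. (x, s)" "\<lambda>h. (0, h)" _ _ l, OF _ D]])
    show "((\<lambda>s. (x, s)) has_derivative (\<lambda>h. (0, h))) (at y)"
      by (auto intro!: derivative_eq_intros)
    show "(\<lambda>h. frechet_derivative l (at (x, y)) (0, h)) = (*) (frechet_derivative l (at (x, y)) (0, 1))"
    proof
      fix h
      show "frechet_derivative l (at (x, y)) (0, h) = frechet_derivative l (at (x, y)) (0, 1) * h"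
        using scaleR[of h "(0, 1)"] by simp
    qed
  qed
  then show "dy l p = frechet_derivative l (at p) (0, 1)"
    unfolding p dy_def by (simp add: DERIV_imp_deriv)
qed

lemma smooth_on_dx_dy:
  assumes "open S" "smooth_on l S"
  shows "smooth_on (dx l) S" "smooth_on (dy l) S"
  using smooth_on_dx[OF assms(2)] smooth_on_frechet_derivative[OF assms(2)]
  by (auto intro: smooth_on_cong[OF assms(1)])

lemma smooth_on_has_derivative_dx_dy:
  assumes "smooth_on l S" "p \<in> S"
  shows "(l has_derivative (\<lambda>(s, t). s * dx l p + t * dy l p)) (at p)"
proof -
  have D: "(l has_derivative frechet_derivative l (at p)) (at p)"
    using smooth_on_has_derivative[OF assms] .
  interpret bounded_linear "frechet_derivative l (at p)"
    using D by (rule has_derivative_bounded_linear)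
  have "frechet_derivative l (at p) (s, t) = s * dx l p + t * dy l p" for s t
  proof -
    have "(s, t) = s *\<^sub>R (1, 0) + t *\<^sub>R (0, 1)" by simp
    then show ?thesis
      by (simp only: add scaleR smooth_on_dx[OF assms] real_scaleR_def)
  qed
  then have "frechet_derivative l (at p) = (\<lambda>(s, t). s * dx l p + t * dy l p)"
    by auto
  with D show ?thesis by simp
qed

section \<open>Smooth local inverses in the plane\<close>

definition planar_jacobian :: "(real \<times> real \<Rightarrow> real \<times> real) \<Rightarrow> real \<times> real \<Rightarrow> real" where
  "planar_jacobian f x =
     fst (frechet_derivative f (at x) (1, 0)) * snd (frechet_derivative f (at x) (0, 1)) -
     fst (frechet_derivative f (at x) (0, 1)) * snd (frechet_derivative f (at x) (1, 0))"

lemma jacobianI: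
  assumes "(f has_derivative D) (at x)"
  shows "planar_jacobian f x = fst (D (1, 0)) * snd (D (0, 1)) - fst (D (0, 1)) * snd (D (1, 0))"
  using frechet_derivative_at[OF assms] by (simp add: planar_jacobian_def)

text \<open>Bootstrapping: the derivative of \<open>g\<close> is the inverse matrix of the
  derivative of \<open>f\<close> at \<open>g y\<close>, hence C^k as soon as \<open>g\<close> is,
  which makes \<open>g\<close> C^(k+1).\<close>

lemma Ck_on_right_inverse:
  fixes f :: "real \<times> real \<Rightarrow> real \<times> real"
  assumes "smooth_on f V" "open U" "g ` U \<subseteq> V"
    and fg: "\<And>y. y \<in> U \<Longrightarrow> f (g y) = y" and dg: "\<And>y. y \<in> U \<Longrightarrow> g differentiable (at y)"
    and J: "\<And>x. x \<in> V \<Longrightarrow> planar_jacobian f x \<noteq> 0"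
  shows "Ck_on k g U"
proof (induction k)
  case 0
  then show ?case
    using dg by (simp add: differentiable_imp_continuous_on differentiable_on_def differentiable_at_withinI)
next
  case (Suc k)
  define A where "A v x = frechet_derivative f (at x) v" for v x
  define a b c d where "a y = fst (A (1, 0) (g y))" "b y = fst (A (0, 1) (g y))"
    "c y = snd (A (1, 0) (g y))" "d y = snd (A (0, 1) (g y))" for y
  note abcd = this
  \<comment> \<open>Candidate derivative by Cramer's rule, for the matrix with rows (a, b) and (c,
    d).\<close>
  define G' where "G' y = (\<lambda>v. ((d y * fst v - b y * snd v) / (a y * d y - b y * c y),
      (a y * snd v - c y * fst v) / (a y * d y - b y * c y)))" for y
  have J0: "a y * d y - b y * c y \<noteq> 0" if "y \<in> U" for y
    using J[of "g y"] that assms(3) by (auto simp: planar_jacobian_def abcd A_def)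
  have CA: "Ck_on k (\<lambda>y. A v (g y)) U" for v
    using smooth_on_frechet_derivative[OF assms(1), of v] assms(3) unfolding A_def smooth_on_def
    by (intro Ck_on_compose[OF assms(2) _ Suc]) auto
  have C: "Ck_on k a U" "Ck_on k b U" "Ck_on k c U" "Ck_on k d U"
    unfolding abcd[abs_def]
    by (rule Ck_on_compose[OF assms(2) Ck_on_bounded_linear CA, where T = UNIV];
        simp add: bounded_linear_fst bounded_linear_snd)+
  have D: "(g has_derivative G' y) (at y)" if "y \<in> U" for y
  proof -
    have "g differentiable (at y)"
      using that by (rule dg)
    then obtain g' where g': "(g has_derivative g') (at y)"
      by (auto simp: differentiable_def)
    have Df: "(f has_derivative frechet_derivative f (at (g y))) (at (g y))"
      using that assms(3) by (intro smooth_on_has_derivative[OF assms(1)]) auto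
    interpret bounded_linear "frechet_derivative f (at (g y))"
      using Df by (rule has_derivative_bounded_linear)
    have "((\<lambda>y. y) has_derivative (\<lambda>v. frechet_derivative f (at (g y)) (g' v))) (at y)"
      by (rule has_derivative_transform_within_open[OF has_derivative_compose[OF g' Df] assms(2) that]) (simp add: fg)
    then have "(\<lambda>v. v) = (\<lambda>v. frechet_derivative f (at (g y)) (g' v))"
      using has_derivative_unique has_derivative_ident by blast
    then have v: "v = frechet_derivative f (at (g y)) (g' v)" for v
      by meson
    have e: "v = fst (g' v) *\<^sub>R A (1, 0) (g y) + snd (g' v) *\<^sub>R A (0, 1) (g y)" for v
    proof -
      have "g' v = fst (g' v) *\<^sub>R (1, 0) + snd (g' v) *\<^sub>R (0, 1)" by (simp add: prod_eq_iff)
      then show ?thesis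
        using v[of v] by (metis A_def add scaleR)
    qed
    have "G' y v = g' v" for v
    proof -
      have "fst v = fst (g' v) * a y + snd (g' v) * b y" "snd v = fst (g' v) * c y + snd (g' v) * d y"
        using arg_cong[OF e[of v], of fst] arg_cong[OF e[of v], of snd] by (simp_all add: abcd)
      then show ?thesis
        unfolding G'_def using J0[OF that]
        by (simp add: prod_eq_iff divide_simps) (simp add: algebra_simps)
    qed
    then have "G' y = g'" by (rule ext)
    with g' show ?thesis by simp
  qed
  note mult = Ck_on_bilinear[OF assms(2) bounded_bilinear_mult]
  have "Ck_on k (\<lambda>y. a y * d y + (-1) * (b y * c y)) U"
    by (intro Ck_on_add[OF assms(2)] mult C Ck_on_const[OF assms(2)])
  with _ have Cinv: "Ck_on k (\<lambda>y. inverse (a y * d y + (-1) * (b y * c y))) U"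
  proof (rule Ck_on_compose[OF assms(2), where T = "-{0}"])
    show "Ck_on k inverse (- {0::real})"
      using smooth_on_inverse by (simp add: smooth_on_def)
  qed (use J0 in auto)
  show ?case
  proof (rule Ck_on_SucI[OF assms(2) D])
    fix v
    have "Ck_on k (\<lambda>y. ((d y * fst v + (-1) * (b y * snd v)) * inverse (a y * d y + (-1) * (b y * c y)),
      (a y * snd v + (-1) * (c y * fst v)) * inverse (a y * d y + (-1) * (b y * c y)))) U"
      by (intro Ck_on_Pair[OF assms(2)] Cinv Ck_on_add[OF assms(2)] mult C Ck_on_const[OF assms(2)])
    then show "Ck_on k (\<lambda>y. G' y v) U"
      by (simp add: G'_def divide_inverse)
  qed
qed

text \<open>The inverse function theorem gives a differentiable local inverse, which
  \<open>Ck_on_right_inverse\<close> upgrades to a smooth one.\<close>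

lemma local_homeomorphism_smooth_inverse:
  fixes f :: "real \<times> real \<Rightarrow> real \<times> real"
  assumes "open V" "smooth_on f V" "\<And>x. x \<in> V \<Longrightarrow> planar_jacobian f x \<noteq> 0" "x0 \<in> V"
  obtains U W g where "open U" "U \<subseteq> V" "x0 \<in> U" "open W" "homeomorphism U W f g" "smooth_on g W"
proof -

  have bl: "bounded_linear (frechet_derivative f (at x))" if "x \<in> V" for x
    using smooth_on_has_derivative[OF assms(2) that] by (rule has_derivative_bounded_linear)
  have D: "(f has_derivative blinfun_apply (Blinfun (frechet_derivative f (at x)))) (at x)" if "x \<in> V" for x
    using smooth_on_has_derivative[OF assms(2) that] bounded_linear_Blinfun_apply[OF bl[OF that]] by simp
  have "continuous_on V (\<lambda>x. Blinfun (frechet_derivative f (at x)))"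
  proof (rule continuous_on_blinfun_componentwise)
    fix i :: "real \<times> real"
    show "continuous_on V (\<lambda>x. blinfun_apply (Blinfun (frechet_derivative f (at x))) i)"
      using smooth_on_imp_continuous_on[OF smooth_on_frechet_derivative[OF assms(2), of i]]
      by (rule continuous_on_eq) (simp add: bl bounded_linear_Blinfun_apply)
  qed
  moreover
  define L where "L = frechet_derivative f (at x0)"
  define a b c d where "a = fst (L (1, 0))" "b = fst (L (0, 1))" "c = snd (L (1, 0))" "d = snd (L (0, 1))"
  note abcd = this
  interpret L: bounded_linear L
    unfolding L_def by (rule bl[OF assms(4)])
  have J: "a * d - b * c \<noteq> 0"
    using assms(3)[OF assms(4)] by (simp add: planar_jacobian_def abcd L_def)
  \<comment> \<open>Cramer's rule again: the left inverse of the derivative at \<open>x0\<close>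
    that the inverse function theorem asks for.\<close>
  define M where "M = (\<lambda>v. ((d * fst v - b * snd v) / (a * d - b * c), (a * snd v - c * fst v) / (a * d - b * c)))"
  have M: "bounded_linear M"
    unfolding M_def divide_inverse
    by (intro bounded_linear_Pair bounded_linear_mult_const bounded_linear_sub bounded_linear_const_mult
        bounded_linear_fst bounded_linear_snd)
  have MLv: "M (L v) = v" for v
  proof -
    have v: "v = fst v *\<^sub>R (1, 0) + snd v *\<^sub>R (0, 1)" by (simp add: prod_eq_iff)
    have "L v = fst v *\<^sub>R L (1, 0) + snd v *\<^sub>R L (0, 1)"
      by (subst v) (simp only: L.add L.scaleR)
    then have "fst (L v) = fst v * a + snd v * b" "snd (L v) = fst v * c + snd v * d"
      by (simp_all add: abcd)
    then show ?thesis
      using J by (simp add: M_def prod_eq_iff divide_simps) (simp add: algebra_simps)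
  qed
  have "Blinfun M o\<^sub>L Blinfun (frechet_derivative f (at x0)) = id_blinfun"
    using M bl[OF assms(4)] MLv
    by (intro blinfun_eqI) (simp add: bounded_linear_Blinfun_apply L_def)
  ultimately obtain U W g g' where U: "open U" "U \<subseteq> V" "x0 \<in> U" "open W" "homeomorphism U W f g"
    "\<And>y. y \<in> W \<Longrightarrow> (g has_derivative g' y) (at y)"
    using inverse_function_theorem[OF assms(1) D _ assms(4)] by metis
  have "Ck_on k g W" for k
  proof (rule Ck_on_right_inverse[OF assms(2) U(4)])
    show "g ` W \<subseteq> V" using U(2,5) by (auto simp: homeomorphism_def)
    show "f (g y) = y" if "y \<in> W" for y using U(5) that by (auto simp: homeomorphism_def)
    show "g differentiable (at y)" if "y \<in> W" for y using U(6)[OF that] by (auto simp: differentiable_def)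
  qed (use assms in auto)
  then show ?thesis
    using that[OF U(1,2,3,4,5)] unfolding smooth_on_def by blast
qed

section \<open>Proper local homeomorphisms\<close>

text \<open>A convergent sequence together with its limit is compact, so by properness its preimages
  have a subsequence converging inside \<open>S\<close>.\<close>

lemma proper_imp_closed_image:
  fixes f :: "'a::metric_space \<Rightarrow> 'b::heine_borel"
  assumes "continuous_on S f" and proper: "\<And>K. compact K \<Longrightarrow> compact (S \<inter> f -` K)" and "closed C"
  shows "closed (f ` (S \<inter> C))"
  unfolding closed_sequential_limits
proof (intro allI impI, elim conjE)
  fix y l assume y: "\<forall>n. y n \<in> f ` (S \<inter> C)" and lim: "y \<longlonglongrightarrow> l"
  from y have "\<forall>n. \<exists>x. x \<in> S \<inter> C \<and> f x = y n"
    by (metis imageE)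
  then obtain x where x: "\<And>n. x n \<in> S \<inter> C" "\<And>n. f (x n) = y n"
    by metis
  have "compact (S \<inter> f -` insert l (range y))"
    by (intro proper compact_sequence_with_limit lim)
  moreover have "\<forall>n. x n \<in> S \<inter> f -` insert l (range y)"
    using x by auto
  ultimately obtain p r where p: "p \<in> S \<inter> f -` insert l (range y)" "strict_mono r" "(x \<circ> r) \<longlonglongrightarrow> p"
    unfolding compact_def by metis
  have "p \<in> C"
    using closed_sequentially[OF \<open>closed C\<close> _ p(3)] x(1) by auto
  have "(\<lambda>n. f ((x \<circ> r) n)) \<longlonglongrightarrow> f p"
    using x(1) p by (intro continuous_on_tendsto_compose[OF assms(1) p(3)]) auto
  moreover have "(\<lambda>n. f ((x \<circ> r) n)) \<longlonglongrightarrow> l"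
    using LIMSEQ_subseq_LIMSEQ[OF lim p(2)] by (simp add: o_def x(2))
  ultimately have "f p = l"
    using LIMSEQ_unique by blast
  then show "l \<in> f ` (S \<inter> C)"
    using p \<open>p \<in> C\<close> by auto
qed

text \<open>Hadamard's global inversion argument: such a map is a covering, and a connected covering
  of a simply connected space has one sheet.\<close>

lemma proper_local_homeomorphism_bij:
  fixes f :: "'a::{real_normed_vector, heine_borel} \<Rightarrow> 'b::{real_normed_vector, heine_borel}"
  assumes "open S" "connected S" "S \<noteq> {}" and cont: "continuous_on S f"
    and loc: "\<And>x. x \<in> S \<Longrightarrow> \<exists>U V g. open U \<and> U \<subseteq> S \<and> x \<in> U \<and> open V \<and> homeomorphism U V f g"
    and proper: "\<And>K. compact K \<Longrightarrow> compact (S \<inter> f -` K)"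
  shows "bij_betw f S UNIV"
proof -
  obtain U V g where UVg: "\<And>x. x \<in> S \<Longrightarrow> open (U x) \<and> U x \<subseteq> S \<and> x \<in> U x \<and> open (V x) \<and> homeomorphism (U x) (V x) f (g x)"
    using loc by metis
  have open_sub: "open (f ` A)" if "open A" "x \<in> S" "A \<subseteq> U x" for A x
  proof -
    have "openin (top_of_set (V x)) (f ` A)"
      using homeomorphism_imp_open_map[of "U x" "V x" f "g x" A] UVg[OF that(2)] that
      by (simp add: openin_open_eq)
    then show ?thesis
      using UVg[OF that(2)] openin_open_trans by blast
  qed
  have "f ` S = (\<Union>x\<in>S. f ` U x)"
    using UVg by blast
  moreover have "open (\<Union>x\<in>S. f ` U x)"
    using UVg open_sub by (intro open_UN) blast
  ultimately have "open (f ` S)" by simp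
  moreover have "closed (f ` S)"
    using proper_imp_closed_image[OF cont proper, of UNIV] by simp
  ultimately have surj: "f ` S = UNIV"
    using connected_UNIV \<open>S \<noteq> {}\<close> by (metis clopen image_is_empty)
  have cov: "covering_space S f UNIV"
  proof (rule covering_spaceI[OF cont surj])
    fix y :: 'b
    define X where "X = S \<inter> f -` {y}"
    have "compact X" unfolding X_def by (rule proper) simp
    \<comment> \<open>\<open>f\<close> is injective on each \<open>U x\<close>, so the fibre is
      discrete; being compact, it is finite.\<close>
    have X1: "x' = x" if "x \<in> X" "x' \<in> X" "x' \<in> U x" for x x'
      using UVg[of x] that by (auto simp: X_def) (metis homeomorphism_apply1)
    have "X \<subseteq> (\<Union>c\<in>X. U c)" "\<And>c. c \<in> X \<Longrightarrow> open (U c)"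
      using UVg by (auto simp: X_def)
    then obtain C where C: "C \<subseteq> X" "finite C" "X \<subseteq> (\<Union>c\<in>C. U c)"
      using compactE_image[OF \<open>compact X\<close>] by metis
    have "X \<subseteq> C"
      using C X1 by blast
    with C have "finite X" by (auto intro: finite_subset)
    have "X \<noteq> {}"
    proof -
      have "y \<in> f ` S" by (simp add: surj)
      then show ?thesis by (auto simp: X_def)
    qed
    have "\<forall>x. \<exists>\<delta>>0. \<forall>x'\<in>X. x' \<noteq> x \<longrightarrow> \<delta> \<le> dist x x'"
      using finite_set_avoid[OF \<open>finite X\<close>] by blast
    then obtain \<delta> where \<delta>: "\<And>x. \<delta> x > 0" "\<And>x x'. x' \<in> X \<Longrightarrow> x' \<noteq> x \<Longrightarrow> \<delta> x \<le> dist x x'"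
      by metis
    \<comment> \<open>Half of a lower bound for the distances within the fibre, so that the balls of
      this radius are disjoint.\<close>
    define r where "r = Min (\<delta> ` X) / 2"
    have "r > 0"
      unfolding r_def using \<open>finite X\<close> \<open>X \<noteq> {}\<close> \<delta>(1) by simp
    have r: "2 * r \<le> dist x x'" if "x \<in> X" "x' \<in> X" "x' \<noteq> x" for x x'
    proof -
      have "2 * r \<le> \<delta> x" unfolding r_def using \<open>finite X\<close> that by simp
      then show ?thesis using \<delta>(2)[OF that(2,3)] by simp
    qed
    define U' where "U' x = U x \<inter> ball x r" for x
    have U'S: "U' x \<subseteq> S" if "x \<in> X" for x
      using that UVg by (auto simp: U'_def X_def)
    have openU': "open (U' x)" if "x \<in> X" for x
      using that UVg by (auto simp: U'_def X_def)
    have disj: "U' x \<inter> U' x' = {}" if "x \<in> X" "x' \<in> X" "x' \<noteq> x" for x x'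
    proof -
      have False if "p \<in> ball x r" "p \<in> ball x' r" for p
        using that r[OF \<open>x \<in> X\<close> \<open>x' \<in> X\<close> \<open>x' \<noteq> x\<close>] dist_triangle2[of x x' p] by (auto simp: dist_commute)
      then show ?thesis by (auto simp: U'_def)
    qed
    \<comment> \<open>Removing the image of the rest of \<open>S\<close>, closed by properness,
      excludes further preimages: everything over \<open>T\<close> lies in the sheets
      \<open>U' x\<close>.\<close>
    define T where "T = (\<Inter>x\<in>X. f ` U' x) - f ` (S \<inter> - (\<Union>x\<in>X. U' x))"
    have "open (\<Inter>x\<in>X. f ` U' x)"
      using \<open>finite X\<close> openU' by (intro open_INT ballI open_sub) (auto simp: U'_def X_def)
    moreover have "closed (f ` (S \<inter> - (\<Union>x\<in>X. U' x)))"
      using openU' by (intro proper_imp_closed_image[OF cont proper]) auto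
    ultimately have "open T" by (auto simp: T_def)
    have xU': "x \<in> U' x" if "x \<in> X" for x
      using that UVg \<open>r > 0\<close> by (auto simp: U'_def X_def)
    have "y \<in> T"
      unfolding T_def using xU' by (auto simp: X_def)
    define v where "v = (\<lambda>x. U' x \<inter> f -` T) ` X"
    have "\<Union>v = S \<inter> f -` T"
      using U'S by (auto simp: v_def T_def)
    moreover have "\<forall>u\<in>v. openin (top_of_set S) u"
    proof
      fix u assume "u \<in> v"
      then obtain x where x: "x \<in> X" "u = U' x \<inter> f -` T" by (auto simp: v_def)
      have "open (U' x \<inter> f -` T)"
        using continuous_on_open_vimage[OF openU'[OF x(1)], of f] continuous_on_subset[OF cont U'S[OF x(1)]] \<open>open T\<close>
        by (auto simp: Int_commute)
      then show "openin (top_of_set S) u"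
        using x U'S \<open>open S\<close> by (auto simp: openin_open_eq)
    qed
    moreover have "pairwise disjnt v"
      unfolding v_def pairwise_image using disj by (auto simp: pairwise_def disjnt_def)
    moreover have "\<forall>u\<in>v. \<exists>q. homeomorphism u T f q"
    proof
      fix u assume "u \<in> v"
      then obtain x where x: "x \<in> X" "u = U' x \<inter> f -` T" by (auto simp: v_def)
      have hom: "homeomorphism (U x) (V x) f (g x)"
        using UVg x by (auto simp: X_def)
      have "T \<subseteq> f ` U' x"
        using x by (auto simp: T_def)
      then have "f ` u = T"
        using x by auto
      moreover have "u \<subseteq> U x" using x by (auto simp: U'_def)
      ultimately have "homeomorphism u T f (g x)"
        using hom by (intro homeomorphism_of_subsets[OF hom, of _ "V x"]) auto
      then show "\<exists>q. homeomorphism u T f q" by blast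
    qed
    ultimately show "\<exists>T. y \<in> T \<and> openin (top_of_set UNIV) T \<and>
        (\<exists>v. \<Union>v = S \<inter> f -` T \<and> (\<forall>u\<in>v. openin (top_of_set S) u) \<and> pairwise disjnt v \<and>
          (\<forall>u\<in>v. \<exists>q. homeomorphism u T f q))"
      using \<open>y \<in> T\<close> \<open>open T\<close> by (intro exI[of _ T] conjI exI[of _ v]) auto
  qed
  have "inj_on f S"
  proof (rule inj_onI)
    fix a b assume ab: "a \<in> S" "b \<in> S" "f a = f b"
    \<comment> \<open>A section \<open>h\<close> through \<open>a\<close>. Both
      \<open>h (f x)\<close> and \<open>x\<close> lift \<open>f\<close> and they agree at
      \<open>a\<close>, hence also at \<open>b\<close>.\<close>
    obtain h where h: "continuous_on UNIV h" "h \<in> UNIV \<rightarrow> S" "h (f a) = a" "\<And>y. f (h y) = y"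
      by (rule covering_space_lift_strong[OF cov ab(1) UNIV_I convex_imp_simply_connected[OF convex_UNIV]
            convex_imp_locally_path_connected[OF convex_UNIV], of "\<lambda>x. x" "f a"]) auto
    have hf: "continuous_on S (\<lambda>x. h (f x))"
      using continuous_on_compose2[OF h(1) cont] by auto
    have "h (f b) = b"
      by (rule covering_space_lift_unique[OF cov, where ?g1.0 = "\<lambda>x. h (f x)" and ?g2.0 = "\<lambda>x. x", OF h(3) cont _ hf
            _ _ continuous_on_id _ _ \<open>connected S\<close> ab(1,2)])
        (use h(2) in \<open>simp_all add: h(4) Pi_iff\<close>)
    with ab(3) h(3) show "a = b" by metis
  qed
  with surj show ?thesis by (simp add: bij_betw_def)
qed

section \<open>Partial fractions\<close>

text \<open>The Lagrange interpolant of \<open>p\<close> at the nodes is \<open>p\<close> itself, by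
  the degree bound; then divide by the node polynomial.\<close>

lemma lagrange_partial_fractions:
  fixes x :: "'i \<Rightarrow> 'a::field" and p :: "'a poly"
  assumes "finite I" "inj_on x I" "degree p < card I" "z \<notin> x ` I"
  shows "(\<Sum>i\<in>I. poly p (x i) / (\<Prod>j\<in>I - {i}. x i - x j) / (z - x i)) = poly p z / (\<Prod>i\<in>I. z - x i)"
proof -
  define w where "w i = (\<Prod>j\<in>I - {i}. x i - x j)" for i
  define q where "q = (\<Sum>i\<in>I. smult (poly p (x i) / w i) (\<Prod>j\<in>I - {i}. [:- x j, 1:]))"
  have "degree (smult (poly p (x i) / w i) (\<Prod>j\<in>I - {i}. [:- x j, 1:])) \<le> card I - 1" if "i \<in> I" for i
  proof -
    have "degree (\<Prod>j\<in>I - {i}. [:- x j, 1:]) \<le> sum (degree \<circ> (\<lambda>j. [:- x j, 1:])) (I - {i})"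
      using assms(1) by (intro degree_prod_sum_le) auto
    also have "\<dots> = card I - 1"
      using assms(1) that by simp
    finally show ?thesis
      using degree_smult_le le_trans by blast
  qed
  then have "degree q \<le> card I - 1"
    unfolding q_def using assms(1) by (intro degree_sum_le) auto
  then have "degree q < card I"
    using assms(3) by linarith
  have "poly q (x k) = poly p (x k)" if "k \<in> I" for k
  proof -
    have "poly q (x k) = (\<Sum>i\<in>I. poly p (x i) / w i * (\<Prod>j\<in>I - {i}. x k - x j))"
      by (simp add: q_def poly_sum poly_prod)
    also have "\<dots> = (\<Sum>i\<in>I. if i = k then poly p (x k) else 0)"
    proof (intro sum.cong refl)
      fix i assume "i \<in> I"
      have "w k \<noteq> 0"
        unfolding w_def using assms(1,2) that by (auto simp: inj_on_def)
      moreover have "(\<Prod>j\<in>I - {i}. x k - x j) = 0" if "i \<noteq> k"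
        using assms(1) \<open>k \<in> I\<close> that by (intro prod_zero) auto
      ultimately show "poly p (x i) / w i * (\<Prod>j\<in>I - {i}. x k - x j) = (if i = k then poly p (x k) else 0)"
        by (auto simp: w_def)
    qed
    finally show ?thesis
      using assms(1) that by simp
  qed
  then have "q = p"
    using \<open>degree q < card I\<close> assms(2,3) by (intro poly_eqI_degree[of "x ` I"]) (auto simp: card_image)
  moreover have "poly q z = (\<Sum>i\<in>I. poly p (x i) / w i * (\<Prod>j\<in>I - {i}. z - x j))"
    by (simp add: q_def poly_sum poly_prod)
  ultimately have "poly p z / (\<Prod>i\<in>I. z - x i)
      = (\<Sum>i\<in>I. poly p (x i) / w i * (\<Prod>j\<in>I - {i}. z - x j)) / (\<Prod>i\<in>I. z - x i)"
    by simp
  also have "\<dots> = (\<Sum>i\<in>I. poly p (x i) / w i / (z - x i))"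
    unfolding sum_divide_distrib
  proof (intro sum.cong refl)
    fix i assume i: "i \<in> I"
    have "z - x i \<noteq> 0" "(\<Prod>j\<in>I - {i}. z - x j) \<noteq> 0"
      using assms(1,4) i by auto
    then show "poly p (x i) / w i * (\<Prod>j\<in>I - {i}. z - x j) / (\<Prod>i\<in>I. z - x i) = poly p (x i) / w i / (z - x i)"
      using assms(1) i by (simp add: prod.remove[of I i])
  qed
  finally show ?thesis
    by (simp add: w_def)
qed

lemma lagrange_power:
  fixes x :: "'i \<Rightarrow> 'a::field"
  assumes "finite I" "inj_on x I" "k < card I" "z \<notin> x ` I"
  shows "(\<Sum>i\<in>I. x i ^ k / (\<Prod>j\<in>I - {i}. x i - x j) / (z - x i)) = z ^ k / (\<Prod>i\<in>I. z - x i)"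
  using lagrange_partial_fractions[of I x "monom 1 k" z] assms
  by (simp add: poly_monom degree_monom_eq)

text \<open>Partial fractions for the exponent \<open>Suc k\<close>, evaluated at 0: each
  denominator \<open>0 - x i\<close> cancels one factor \<open>x i\<close>.\<close>

lemma lagrange_power_sum:
  fixes x :: "'i \<Rightarrow> 'a::field"
  assumes "finite I" "inj_on x I" "Suc k < card I" "0 \<notin> x ` I"
  shows "(\<Sum>i\<in>I. x i ^ k / (\<Prod>j\<in>I - {i}. x i - x j)) = 0"
proof -
  have "(\<Sum>i\<in>I. x i ^ Suc k / (\<Prod>j\<in>I - {i}. x i - x j) / (0 - x i)) = 0"
    using lagrange_power[of I x "Suc k" 0] assms by simp
  also have "(\<Sum>i\<in>I. x i ^ Suc k / (\<Prod>j\<in>I - {i}. x i - x j) / (0 - x i)) =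
      (\<Sum>i\<in>I. - (x i ^ k / (\<Prod>j\<in>I - {i}. x i - x j)))"
    using assms(4) by (intro sum.cong refl) (auto simp: field_simps image_iff)
  finally show ?thesis
    by (simp add: sum_negf)
qed

section \<open>Chebyshev recurrences\<close>

text \<open>The Chebyshev polynomial of the second kind U_(k-1), with the index shifted so that
  \<open>cheb u k\<close> belongs to sin (k t).\<close>

fun cheb :: "real \<Rightarrow> nat \<Rightarrow> real" where
  "cheb u 0 = 0"
| "cheb u (Suc 0) = 1"
| "cheb u (Suc (Suc k)) = 2 * u * cheb u (Suc k) - cheb u k"

lemma cheb_cos: "sin t * cheb (cos t) k = sin (real k * t)"
proof (induction k rule: induct_nat_012)
  case (ge2 k)
  have "sin t * cheb (cos t) (Suc (Suc k)) = 2 * cos t * sin (real (Suc k) * t) - sin (real k * t)"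
    using ge2 by (simp add: algebra_simps)
  also have "\<dots> = sin (real (Suc (Suc k)) * t)"
    using sin_plus_sin[of "real (Suc (Suc k)) * t" "real k * t"]
    by (simp add: algebra_simps add_divide_distrib)
  finally show ?case .
qed auto

lemma cheb_ge_1:
  assumes "u \<ge> 1"
  shows "cheb u k \<ge> 0 \<and> cheb u (Suc k) \<ge> cheb u k + 1"
proof (induction k)
  case (Suc k)
  have "cheb u (Suc (Suc k)) - cheb u (Suc k) = 2 * (u - 1) * cheb u (Suc k) + (cheb u (Suc k) - cheb u k)"
    by (simp add: algebra_simps)
  moreover have "2 * (u - 1) * cheb u (Suc k) \<ge> 0"
    using assms Suc by simp
  ultimately show ?case
    using Suc by linarith
qed auto

text \<open>cos (pi / m) is the largest zero of U_(m-1). Below 1, put u = cos t with 0 < t < pi / m;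
  from 1 on, the values increase with the index.\<close>

lemma cheb_pos:
  assumes "m \<ge> 1" "u > cos (pi / real m)"
  shows "cheb u m > 0"
proof (cases "u \<ge> 1")
  case True
  then show ?thesis
    using cheb_ge_1[of u "m - 1"] assms(1) by simp
next
  case False
  define t where "t = arccos u"
  have u: "-1 \<le> u" "u < 1"
    using assms(2) False cos_ge_minus_one[of "pi / real m"] by linarith+
  have t: "cos t = u" "0 \<le> t" "t \<le> pi"
    using u by (auto simp: t_def arccos_lbound arccos_ubound)
  have "t \<noteq> 0" using t u by auto
  have m: "pi / real m \<le> pi"
    using assms(1) by (simp add: divide_le_eq)
  have "t < pi / real m"
  proof (rule ccontr)
    assume "\<not> t < pi / real m"
    then have "cos t \<le> cos (pi / real m)"
      using t by (intro cos_monotone_0_pi_le) auto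
    with assms(2) t show False by simp
  qed
  moreover have "t < pi"
    using m calculation by linarith
  ultimately have "real m * t < pi" "0 < real m * t" "0 < sin t"
    using assms(1) t \<open>t \<noteq> 0\<close> by (auto simp: field_simps intro!: sin_gt_zero)
  then have "sin t * cheb (cos t) m > 0"
    by (simp add: cheb_cos sin_gt_zero)
  with \<open>0 < sin t\<close> t show ?thesis
    by (simp add: zero_less_mult_iff)
qed

text \<open>\<open>cheb u\<close> solves the recurrence with initial values 0 and 1, so every
  solution is a combination of two of its shifts. The index bound records that the recurrence
  reaches only up to \<open>s (M + 2)\<close>.\<close>

lemma cheb_recurrence_shift:
  fixes s :: "nat \<Rightarrow> 'a::{real_algebra_1, comm_ring_1}"
  assumes "\<And>k. k \<le> M \<Longrightarrow> s (k + 2) = of_real (2 * u) * s (k + 1) - s k"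
  shows "k + Suc a \<le> M + 2 \<Longrightarrow> s (k + Suc a) = of_real (cheb u (Suc a)) * s (k + 1) - of_real (cheb u a) * s k"
proof (induction a arbitrary: k)
  case (Suc a)
  have "s (k + Suc (Suc a)) = of_real (cheb u (Suc a)) * s (k + 2) - of_real (cheb u a) * s (k + 1)"
    using Suc.IH[of "k + 1"] Suc.prems by simp
  also have "s (k + 2) = of_real (2 * u) * s (k + 1) - s k"
    using Suc.prems by (intro assms) simp
  finally show ?case
    by (simp add: algebra_simps)
qed auto

text \<open>This is the Casoratian (discrete Wronskian); it is constant because one step of the
  recurrence has determinant 1.\<close>

lemma cheb_recurrence_det:
  fixes s :: "nat \<Rightarrow> 'a::{real_algebra_1, comm_ring_1}"
  assumes rec: "\<And>k. k \<le> M \<Longrightarrow> s (k + 2) = of_real (2 * u) * s (k + 1) - s k"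
  shows "k \<le> M \<Longrightarrow> s (k + 1) * s (k + 1) - s k * s (k + 2) = s 1 * s 1 - s 0 * s 2"
proof (induction k)
  case (Suc k)
  have r: "s (Suc k + 2) = of_real (2 * u) * s (k + 2) - s (k + 1)" "s (k + 2) = of_real (2 * u) * s (k + 1) - s k"
    using rec[of "Suc k"] rec[of k] Suc.prems by simp_all
  have "s (Suc k + 1) * s (Suc k + 1) - s (Suc k) * s (Suc k + 2)
      = s (k + 2) * (s (k + 2) - of_real (2 * u) * s (k + 1)) + s (k + 1) * s (k + 1)"
    unfolding r(1) by (simp add: algebra_simps)
  also have "s (k + 2) - of_real (2 * u) * s (k + 1) = - s k"
    unfolding r(2) by simp
  also have "s (k + 2) * - s k + s (k + 1) * s (k + 1) = s (k + 1) * s (k + 1) - s k * s (k + 2)"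
    by (simp add: algebra_simps)
  finally show ?case
    using Suc by simp
qed (simp add: numeral_2_eq_2)

text \<open>Expanding the shift by \<open>a\<close>, then the shift by \<open>b\<close>, extracts
  one Chebyshev factor each time and leaves the Casoratian.\<close>

lemma cheb_recurrence_vajda:
  fixes s :: "nat \<Rightarrow> 'a::{real_algebra_1, comm_ring_1}"
  assumes rec: "\<And>k. k \<le> M \<Longrightarrow> s (k + 2) = of_real (2 * u) * s (k + 1) - s k"
    and "i + a + b \<le> M + 2"
  shows "s (i + a) * s (i + b) - s i * s (i + a + b)
    = of_real (cheb u a * cheb u b) * (s 1 * s 1 - s 0 * s 2)"
proof (cases a; cases b)
  fix a' b' assume ab: "a = Suc a'" "b = Suc b'"
  note sh = cheb_recurrence_shift[of M s u, OF rec]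
  have 1: "s (i + a) = of_real (cheb u a) * s (i + 1) - of_real (cheb u a') * s i"
    "s (i + b + a) = of_real (cheb u a) * s (i + b + 1) - of_real (cheb u a') * s (i + b)"
    "s (i + b) = of_real (cheb u b) * s (i + 1) - of_real (cheb u b') * s i"
    "s (i + b + 1) = of_real (cheb u b) * s (i + 2) - of_real (cheb u b') * s (i + 1)"
    using sh[of i a'] sh[of "i + b" a'] sh[of i b'] sh[of "i + 1" b'] assms(2) ab
    by simp_all
  have iab: "i + a + b = i + b + a"
    by simp
  have "s (i + a) * s (i + b) - s i * s (i + a + b)
      = of_real (cheb u a) * (s (i + 1) * s (i + b) - s i * s (i + b + 1))"
    unfolding iab 1(1,2) by (simp add: algebra_simps)
  also have "s (i + 1) * s (i + b) - s i * s (i + b + 1)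
      = of_real (cheb u b) * (s (i + 1) * s (i + 1) - s i * s (i + 2))"
    unfolding 1(3,4) by (simp only: algebra_simps)
  also have "s (i + 1) * s (i + 1) - s i * s (i + 2) = s 1 * s 1 - s 0 * s 2"
    using assms(2) ab by (intro cheb_recurrence_det[of M s u, OF rec]) auto
  finally show ?thesis
    by (simp add: mult.assoc)
qed (auto simp: algebra_simps)

text \<open>Duplication formula of the sine; the second factor is twice the Chebyshev polynomial of
  the first kind. It shows that \<open>cheb u k\<close> is nonzero whenever
  \<open>cheb u (2 * k)\<close> is.\<close>

lemma cheb_double: "cheb u (2 * k) = cheb u k * (2 * cheb u (k + 1) - 2 * u * cheb u k)"
proof (cases k)
  case (Suc a)
  have "cheb u (k + Suc a) = cheb u (Suc a) * cheb u (k + 1) - cheb u a * cheb u k"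
    using cheb_recurrence_shift[of "k + a" "cheb u" u k a] by simp
  then have "cheb u (2 * k) = cheb u k * cheb u (k + 1) - cheb u a * cheb u k"
    unfolding Suc[symmetric] mult_2 .
  moreover have "cheb u a = 2 * u * cheb u k - cheb u (k + 1)"
    by (simp add: Suc)
  ultimately show ?thesis
    by (simp only: algebra_simps)
qed auto

section \<open>The residues of the Weierstrass data\<close>

locale kobayashi =
  fixes n :: nat and \<alpha> :: "nat \<Rightarrow> real"
  assumes n_ge_2: "n \<ge> 2"
    and \<alpha>_0: "\<alpha> 0 = 0"
    and \<alpha>_less_Suc: "\<And>j. j < 2 * n \<Longrightarrow> \<alpha> j < \<alpha> (j + 1)"
    and \<alpha>_2n: "\<alpha> (2 * n) = 2 * pi"
    and \<alpha>_gap: "\<And>j. j < 2 * n \<Longrightarrow> \<bar>\<alpha> j - \<alpha> (j + 1)\<bar> \<le> pi / (real n - 1)"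
begin

lemma \<alpha>_less: "i < j \<Longrightarrow> j \<le> 2 * n \<Longrightarrow> \<alpha> i < \<alpha> j"
proof (induction j)
  case (Suc j)
  then show ?case
    using \<alpha>_less_Suc[of j] by (cases "i = j") (auto intro: less_trans)
qed auto

lemma \<alpha>_nonneg: "j \<le> 2 * n \<Longrightarrow> 0 \<le> \<alpha> j"
  using \<alpha>_less[of 0 j] \<alpha>_0 by (cases j) auto

lemma \<alpha>_less_2pi: "j < 2 * n \<Longrightarrow> \<alpha> j < 2 * pi"
  using \<alpha>_less[of j "2 * n"] \<alpha>_2n by auto

lemma \<alpha>_sector:
  assumes "0 \<le> t" "t < 2 * pi"
  obtains j where "j < 2 * n" "\<alpha> j \<le> t" "t < \<alpha> (j + 1)"
proof -
  have "\<exists>j<2 * n. \<alpha> j \<le> t \<and> t < \<alpha> (j + 1)"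
  proof (rule ccontr)
    assume *: "\<not> ?thesis"
    have "j \<le> 2 * n \<Longrightarrow> \<alpha> j \<le> t" for j
      by (induction j) (use * assms \<alpha>_0 in \<open>auto simp: not_less\<close>)
    then show False using \<alpha>_2n assms by force
  qed
  then show thesis using that by auto
qed

definition \<zeta> :: "nat \<Rightarrow> complex" where "\<zeta> j = cis (\<alpha> j)"

definition \<zeta>_prod :: "nat \<Rightarrow> complex" where "\<zeta>_prod j = (\<Prod>k\<in>{..<2 * n} - {j}. \<zeta> j - \<zeta> k)"

definition sin_prod :: "nat \<Rightarrow> real" where
  "sin_prod j = (\<Prod>k\<in>{..<2 * n} - {j}. sin ((\<alpha> j - \<alpha> k) / 2))"

text \<open>The residue of g h at \<open>\<zeta> j\<close> (see \<open>of_real_c\<close>), in a form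
  that displays its being real and its sign.\<close>

definition c :: "nat \<Rightarrow> real" where "c j = (-1) ^ (n - 1) / (2 ^ (2 * n - 1) * sin_prod j)"

definition K :: complex where "K = \<i> * kobayashi_\<Lambda> n \<alpha>"

lemma norm_\<zeta> [simp]: "norm (\<zeta> j) = 1" and \<zeta>_nonzero [simp]: "\<zeta> j \<noteq> 0"
  by (auto simp: \<zeta>_def)

lemma cis_diff: "cis a - cis b = 2 * \<i> * of_real (sin ((a - b) / 2)) * cis ((a + b) / 2)"
proof -
  have "sin ((b - a) / 2) = - sin ((a - b) / 2)"
    using sin_minus[of "(a - b) / 2"] by (simp add: minus_divide_left)
  then show ?thesis
    using cos_diff_cos[of a b] sin_diff_sin[of a b] by (simp add: complex_eq_iff ac_simps)
qed

lemma sin_half_diff: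
  assumes "k < j" "j < 2 * n"
  shows "sin ((\<alpha> j - \<alpha> k) / 2) > 0"
  using \<alpha>_less[of k j] \<alpha>_less_2pi[of j] \<alpha>_nonneg[of k] assms by (intro sin_gt_zero) auto

lemma sin_half_diff_nonzero:
  assumes "k < 2 * n" "j < 2 * n" "k \<noteq> j"
  shows "sin ((\<alpha> j - \<alpha> k) / 2) \<noteq> 0"
proof (cases "k < j")
  case False
  then have "sin ((\<alpha> k - \<alpha> j) / 2) > 0"
    using assms by (intro sin_half_diff) auto
  then show ?thesis
    using sin_minus[of "(\<alpha> k - \<alpha> j) / 2"] by (simp add: minus_divide_left)
qed (use sin_half_diff[of k j] assms in auto)

lemma inj_on_\<zeta>: "inj_on \<zeta> {..<2 * n}"
proof (rule inj_onI)
  fix j k assume jk: "j \<in> {..<2 * n}" "k \<in> {..<2 * n}" "\<zeta> j = \<zeta> k"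
  then have "sin ((\<alpha> j - \<alpha> k) / 2) = 0"
    using cis_diff[of "\<alpha> j" "\<alpha> k"] by (simp add: \<zeta>_def)
  then show "j = k"
    using sin_half_diff_nonzero[of k j] jk by auto
qed

lemma \<zeta>_prod_nonzero: "j < 2 * n \<Longrightarrow> \<zeta>_prod j \<noteq> 0"
  using inj_on_\<zeta> by (auto simp: \<zeta>_prod_def inj_on_def)

lemma prod_cis: "(\<Prod>i\<in>A. cis (g i)) = cis (\<Sum>i\<in>A. g i)"
  by (induction A rule: infinite_finite_induct) (auto simp: cis_mult)

text \<open>Each factor \<open>\<zeta> j - \<zeta> k\<close> is 2 i times a sine times a half-angle
  phase. The phases multiply to \<open>\<zeta> j ^ (n - 1)\<close> times
  \<open>kobayashi_\<Lambda> n \<alpha>\<close>, so the normalisation by \<Lambda> is exactly what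
  makes the residue real.\<close>

lemma of_real_c:
  assumes "j < 2 * n"
  shows "of_real (c j) = K * \<zeta> j ^ (n - 1) / \<zeta>_prod j"
proof -
  define A where "A = (\<Sum>k<2 * n. \<alpha> k)"
  have card: "card ({..<2 * n} - {j}) = 2 * n - 1"
    using assms by simp
  have "\<zeta>_prod j = (\<Prod>k\<in>{..<2 * n} - {j}. (2 * \<i>) * of_real (sin ((\<alpha> j - \<alpha> k) / 2)) * cis ((\<alpha> j + \<alpha> k) / 2))"
    by (simp add: \<zeta>_prod_def \<zeta>_def cis_diff)
  also have "\<dots> = (2 * \<i>) ^ (2 * n - 1) * of_real (sin_prod j) * cis (\<Sum>k\<in>{..<2 * n} - {j}. (\<alpha> j + \<alpha> k) / 2)"
    by (simp only: prod.distrib prod_constant card prod_cis sin_prod_def of_real_prod power_mult_distrib)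
  also have "(\<Sum>k\<in>{..<2 * n} - {j}. (\<alpha> j + \<alpha> k) / 2) = ((2 * real n - 1) * \<alpha> j + (A - \<alpha> j)) / 2"
  proof -
    have "(\<Sum>k\<in>{..<2 * n} - {j}. \<alpha> k) = A - \<alpha> j"
      using assms by (simp add: A_def sum_diff1)
    moreover have "(\<Sum>k\<in>{..<2 * n} - {j}. \<alpha> j) = (2 * real n - 1) * \<alpha> j"
      using assms n_ge_2 by (simp add: of_nat_diff)
    ultimately show ?thesis
      by (simp only: sum_divide_distrib[symmetric] sum.distrib)
  qed
  also have "\<dots> = real (n - 1) * \<alpha> j + A / 2"
    using n_ge_2 by (simp add: of_nat_diff field_simps)
  also have "cis \<dots> = \<zeta> j ^ (n - 1) * kobayashi_\<Lambda> n \<alpha>"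
  proof -
    have "kobayashi_\<Lambda> n \<alpha> = cis (A / 2)"
      by (simp add: kobayashi_\<Lambda>_def A_def cis_conv_exp)
    then show ?thesis
      by (simp only: cis_mult[symmetric] \<zeta>_def Complex.DeMoivre)
  qed
  finally have w: "\<zeta>_prod j = (2 * \<i>) ^ (2 * n - 1) * of_real (sin_prod j) * (\<zeta> j ^ (n - 1) * kobayashi_\<Lambda> n \<alpha>)" .
  have L0: "kobayashi_\<Lambda> n \<alpha> \<noteq> 0" by (simp add: kobayashi_\<Lambda>_def)
  obtain m where m: "n = Suc m" using n_ge_2 by (cases n) auto
  \<comment> \<open>The odd power of i supplies both the sign in \<open>c\<close> and the factor i
    that cancels the one in \<open>K\<close>.\<close>
  have pw: "(2 * \<i>) ^ (2 * n - 1) = 2 ^ (2 * n - 1) * (\<i> * (-1) ^ (n - 1))"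
  proof -
    have "\<i> ^ (2 * n - 1) = \<i> * (-1) ^ (n - 1)"
      by (simp add: m power_mult)
    then show ?thesis
      by (simp only: power_mult_distrib)
  qed
  have gen: "\<i> * L * z / (A * (\<i> * B) * s * (z * L)) = 1 / (A * B * s)" if "z \<noteq> 0" "L \<noteq> 0" for A B L s z :: complex
    using that by (simp add: divide_simps)
  have "K * \<zeta> j ^ (n - 1) / \<zeta>_prod j = 1 / (2 ^ (2 * n - 1) * (-1) ^ (n - 1) * of_real (sin_prod j))"
    unfolding w K_def pw by (rule gen) (use L0 in simp_all)
  also have "\<dots> = of_real (c j)"
  proof -
    have "(-1 :: complex) ^ (n - 1) = 1 \<and> (-1 :: real) ^ (n - 1) = 1 \<or> (-1 :: complex) ^ (n - 1) = -1 \<and> (-1 :: real) ^ (n - 1) = -1"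
      by (cases "even (n - 1)") (simp_all only: neg_one_even_power neg_one_odd_power simp_thms)
    then show ?thesis
      unfolding c_def by (elim disjE conjE) (simp_all del: One_nat_def)
  qed
  finally show ?thesis ..
qed

text \<open>The negative factors are those with k > j, and there are 2 n - 1 - j of them.\<close>

lemma sin_prod_sign:
  assumes "j < 2 * n"
  shows "(-1) ^ (2 * n - 1 - j) * sin_prod j > 0"
proof -
  have un: "{..<2 * n} - {j} = {..<j} \<union> {j<..<2 * n}"
    using assms by auto
  have "sin_prod j = (\<Prod>k<j. sin ((\<alpha> j - \<alpha> k) / 2)) * (\<Prod>k\<in>{j<..<2 * n}. sin ((\<alpha> j - \<alpha> k) / 2))"
    unfolding sin_prod_def un by (rule prod.union_disjoint) auto
  also have "(\<Prod>k\<in>{j<..<2 * n}. sin ((\<alpha> j - \<alpha> k) / 2)) = (\<Prod>k\<in>{j<..<2 * n}. (-1) * sin ((\<alpha> k - \<alpha> j) / 2))"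
  proof (intro prod.cong refl)
    fix k
    show "sin ((\<alpha> j - \<alpha> k) / 2) = (-1) * sin ((\<alpha> k - \<alpha> j) / 2)"
      using sin_minus[of "(\<alpha> k - \<alpha> j) / 2"] by (simp add: minus_divide_left)
  qed
  also have "\<dots> = (-1) ^ (2 * n - 1 - j) * (\<Prod>k\<in>{j<..<2 * n}. sin ((\<alpha> k - \<alpha> j) / 2))"
    by (simp only: prod.distrib prod_constant) simp
  finally have "(-1) ^ (2 * n - 1 - j) * sin_prod j =
      (\<Prod>k<j. sin ((\<alpha> j - \<alpha> k) / 2)) * (\<Prod>k\<in>{j<..<2 * n}. sin ((\<alpha> k - \<alpha> j) / 2))"
    by (simp add: left_right_inverse_power)
  also have "\<dots> > 0"
    using sin_half_diff assms by (intro mult_pos_pos prod_pos) auto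
  finally show ?thesis .
qed

text \<open>The residues alternate in sign around the circle; needed for neighbouring nodes in the
  properness estimate.\<close>

lemma c_mult_neg:
  assumes "j < 2 * n" "k < 2 * n" "odd (j + k)"
  shows "c j * c k < 0"
proof -
  have "(-1) ^ (2 * n - 1 - j) * (-1) ^ (2 * n - 1 - k) = (- 1 :: real)"
  proof -
    have "odd ((2 * n - 1 - j) + (2 * n - 1 - k))"
    proof -
      have "((2 * n - 1 - j) + (2 * n - 1 - k)) + (j + k) = 2 * (2 * n - 1)"
        using assms(1,2) by linarith
      then have "even (((2 * n - 1 - j) + (2 * n - 1 - k)) + (j + k))"
        by (metis dvd_triv_left)
      then show ?thesis
        using assms(3) unfolding even_add by blast
    qed
    then show ?thesis
      unfolding power_add[symmetric] by (rule neg_one_odd_power)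
  qed
  then have "((-1) ^ (2 * n - 1 - j) * sin_prod j) * ((-1) ^ (2 * n - 1 - k) * sin_prod k) = - (sin_prod j * sin_prod k)"
    by (metis (no_types, opaque_lifting) mult.assoc mult.commute mult_minus1)
  then have "sin_prod j * sin_prod k < 0"
    using mult_pos_pos[OF sin_prod_sign[OF assms(1)] sin_prod_sign[OF assms(2)]] by linarith
  moreover have "c j * c k = 1 / (2 ^ (2 * n - 1) * 2 ^ (2 * n - 1) * (sin_prod j * sin_prod k))"
    by (simp add: c_def left_right_inverse_power)
  ultimately show ?thesis
    by (simp add: divide_less_0_iff mult_pos_neg)
qed

lemma zero_notin_\<zeta>: "0 \<notin> \<zeta> ` {..<2 * n}"
  by auto

text \<open>The bound on \<open>k\<close> says that z^k dz over the node polynomial has no residue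
  at infinity.\<close>

lemma \<zeta>_power_sum:
  assumes "k \<le> 2 * n - 2"
  shows "(\<Sum>j<2 * n. \<zeta> j ^ k / \<zeta>_prod j) = 0"
  unfolding \<zeta>_prod_def using assms n_ge_2
  by (intro lagrange_power_sum[OF _ inj_on_\<zeta> _ zero_notin_\<zeta>]) auto

definition \<beta> :: "nat \<Rightarrow> real" where "\<beta> j = real (n - 1) * \<alpha> j"

lemma \<zeta>_power: "\<zeta> j ^ (n - 1) = cis (\<beta> j)"
  by (simp add: \<zeta>_def \<beta>_def Complex.DeMoivre)

text \<open>The residues of h and g^2 h are conjugate to each other, because that of g h is real.
  Hence the sum and difference forms also have real residues.\<close>

lemma K_\<zeta>:
  assumes "j < 2 * n"
  shows "K / \<zeta>_prod j = of_real (c j) * cis (- \<beta> j)"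
    "K * \<zeta> j ^ (2 * n - 2) / \<zeta>_prod j = of_real (c j) * cis (\<beta> j)"
proof -
  have "2 * n - 2 = (n - 1) + (n - 1)" by simp
  then show "K * \<zeta> j ^ (2 * n - 2) / \<zeta>_prod j = of_real (c j) * cis (\<beta> j)"
    unfolding of_real_c[OF assms] by (simp add: power_add \<zeta>_power[simplified])
  show "K / \<zeta>_prod j = of_real (c j) * cis (- \<beta> j)"
    unfolding of_real_c[OF assms] by (simp add: \<zeta>_power[simplified] cis_mult)
qed

text \<open>Power sums with exponents n - 1 and 2 n - 2: none of the three one-forms has a residue
  at infinity.\<close>

lemma sum_c: "(\<Sum>j<2 * n. c j) = 0"
  and sum_c_cos: "(\<Sum>j<2 * n. c j * cos (\<beta> j)) = 0"
  and sum_c_sin: "(\<Sum>j<2 * n. c j * sin (\<beta> j)) = 0"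
proof -
  have "complex_of_real (\<Sum>j<2 * n. c j) = K * (\<Sum>j<2 * n. \<zeta> j ^ (n - 1) / \<zeta>_prod j)"
    by (simp add: of_real_c sum_distrib_left)
  also have "\<dots> = 0" using n_ge_2 by (subst \<zeta>_power_sum) auto
  finally show "(\<Sum>j<2 * n. c j) = 0" by (simp only: of_real_eq_0_iff)
  have "(\<Sum>j<2 * n. of_real (c j) * cis (\<beta> j)) = K * (\<Sum>j<2 * n. \<zeta> j ^ (2 * n - 2) / \<zeta>_prod j)"
    by (simp add: K_\<zeta>(2)[symmetric] sum_distrib_left)
  also have "\<dots> = 0" using n_ge_2 by (subst \<zeta>_power_sum) auto
  finally have *: "(\<Sum>j<2 * n. of_real (c j) * cis (\<beta> j)) = 0" .
  show "(\<Sum>j<2 * n. c j * cos (\<beta> j)) = 0" "(\<Sum>j<2 * n. c j * sin (\<beta> j)) = 0"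
    using arg_cong[OF *, of Re] arg_cong[OF *, of Im] by simp_all
qed

section \<open>The Klein model of the domain\<close>

definition D :: "nat \<Rightarrow> real \<times> real \<Rightarrow> real" where
  "D j w = 1 - fst w * cos (\<alpha> j) - snd w * sin (\<alpha> j)"

definition P :: "(real \<times> real) set" where "P = {w. \<forall>j<2 * n. D j w > 0}"

lemma D_pos: "w \<in> P \<Longrightarrow> j \<le> 2 * n \<Longrightarrow> D j w > 0"
proof (cases "j = 2 * n")
  case True
  then have "D j w = D 0 w" by (simp add: D_def \<alpha>_2n \<alpha>_0)
  moreover assume "w \<in> P"
  ultimately show ?thesis using n_ge_2 by (auto simp: P_def)
qed (auto simp: P_def)

lemma D_polar: "D j (r * cos t, r * sin t) = 1 - r * cos (t - \<alpha> j)"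
  by (simp add: D_def cos_diff algebra_simps)

lemma polar_form:
  obtains r t where "r \<ge> 0" "0 \<le> t" "t < 2 * pi" "w = (r * cos t, r * sin t)" "r = norm w"
proof -
  define z where "z = Complex (fst w) (snd w)"
  have e: "z = of_real (norm z) * cis (Arg2pi z)"
    unfolding cis_conv_exp by (rule Arg2pi_eq)
  have "Re z = norm z * cos (Arg2pi z)" "Im z = norm z * sin (Arg2pi z)"
    using arg_cong[OF e, of Re] arg_cong[OF e, of Im] by simp_all
  moreover have "norm z = norm w"
    by (simp add: z_def cmod_def norm_prod_def)
  ultimately have "w = (norm w * cos (Arg2pi z), norm w * sin (Arg2pi z))"
    by (simp add: z_def prod_eq_iff)
  then show thesis
    using that[of "norm w" "Arg2pi z"] Arg2pi_ge_0[of z] Arg2pi_lt_2pi[of z] by auto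
qed

text \<open>The nearest node is within angle \<open>pi / (2 * (n - 1))\<close> of any direction.\<close>

lemma P_bound:
  assumes "w \<in> P" "w \<noteq> 0"
  shows "1 / norm w > cos (pi / real (2 * (n - 1)))"
proof -
  obtain r t where t: "0 \<le> t" "t < 2 * pi" "w = (r * cos t, r * sin t)" "r = norm w"
    by (rule polar_form)
  obtain j where j: "j < 2 * n" "\<alpha> j \<le> t" "t < \<alpha> (j + 1)"
    using \<alpha>_sector[OF t(1,2)] .
  have r: "r > 0" using t(4) assms(2) by simp
  have gap: "\<alpha> (j + 1) - \<alpha> j \<le> pi / real (n - 1)"
    using \<alpha>_gap[OF j(1)] n_ge_2 by (simp add: of_nat_diff)
  have half: "2 * (pi / real (2 * (n - 1))) = pi / real (n - 1)" by simp
  have pib: "pi / real (2 * (n - 1)) \<le> pi"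
    using n_ge_2 by (simp add: divide_le_eq)
  have "1 / r > cos (t - \<alpha> j)" "1 / r > cos (\<alpha> (j + 1) - t)"
    using D_pos[OF assms(1), of j] D_pos[OF assms(1), of "j + 1"] j(1) r
      cos_minus[of "t - \<alpha> (j + 1)"]
    unfolding t(3) D_polar by (auto simp: field_simps)
  moreover have "cos (pi / real (2 * (n - 1))) \<le> cos (t - \<alpha> j) \<or>
      cos (pi / real (2 * (n - 1))) \<le> cos (\<alpha> (j + 1) - t)"
    using j gap half pib cos_monotone_0_pi_le[of "t - \<alpha> j" "pi / real (2 * (n - 1))"]
      cos_monotone_0_pi_le[of "\<alpha> (j + 1) - t" "pi / real (2 * (n - 1))"]
    by linarith
  ultimately show ?thesis
    unfolding t(4) by linarith
qed


section \<open>The first fundamental form\<close>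

definition cw :: "real \<times> real \<Rightarrow> complex" where "cw w = Complex (fst w) (snd w)"

text \<open>The building blocks of the first derivatives: by \<open>quadratic_at_node\<close> the
  denominator is \<open>- 2 * \<zeta> j * D j w\<close>. Written as a quadratic in
  \<open>\<zeta> j\<close>, it acts on the exponent \<open>k\<close> as a shift operator.\<close>

definition S :: "nat \<Rightarrow> real \<times> real \<Rightarrow> complex" where
  "S k w = (\<Sum>j<2 * n. \<zeta> j ^ k / \<zeta>_prod j / (cnj (cw w) * (\<zeta> j)\<^sup>2 - 2 * \<zeta> j + cw w))"

lemma quadratic_at_node: "cnj (cw w) * (\<zeta> j)\<^sup>2 - 2 * \<zeta> j + cw w = - 2 * \<zeta> j * of_real (D j w)"
proof -
  have sc: "sin (\<alpha> j) * sin (\<alpha> j) = 1 - cos (\<alpha> j) * cos (\<alpha> j)"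
    using sin_squared_eq[of "\<alpha> j"] by (simp add: power2_eq_square)
  show ?thesis
    by (simp add: complex_eq_iff cw_def \<zeta>_def D_def power2_eq_square algebra_simps)
      (simp add: sc algebra_simps)
qed

lemma quadratic_at_node_nonzero:
  "w \<in> P \<Longrightarrow> j < 2 * n \<Longrightarrow> cnj (cw w) * (\<zeta> j)\<^sup>2 - 2 * \<zeta> j + cw w \<noteq> 0"
  using D_pos[of w j] by (simp add: quadratic_at_node)

text \<open>The quadratic cancels the denominator and leaves the vanishing sum
  \<open>\<zeta>_power_sum\<close>.\<close>

lemma S_recurrence:
  assumes "w \<in> P" "k \<le> 2 * n - 2"
  shows "cnj (cw w) * S (k + 2) w - 2 * S (k + 1) w + cw w * S k w = 0"
proof -
  have gen: "W * (z ^ (k + 2) / q / d) - 2 * (z ^ (k + 1) / q / d) + v * (z ^ k / q / d)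
      = z ^ k / q * ((W * z\<^sup>2 - 2 * z + v) / d)" for W z q d v :: complex
    by (simp add: divide_inverse power_add power2_eq_square algebra_simps)
  have "cnj (cw w) * S (k + 2) w - 2 * S (k + 1) w + cw w * S k w
     = (\<Sum>j<2 * n. \<zeta> j ^ k / \<zeta>_prod j * ((cnj (cw w) * (\<zeta> j)\<^sup>2 - 2 * \<zeta> j + cw w) /
            (cnj (cw w) * (\<zeta> j)\<^sup>2 - 2 * \<zeta> j + cw w)))"
    unfolding S_def sum_distrib_left sum.distrib[symmetric] sum_subtractf[symmetric]
    by (simp only: gen)
  also have "\<dots> = (\<Sum>j<2 * n. \<zeta> j ^ k / \<zeta>_prod j)"
    using quadratic_at_node_nonzero[OF assms(1)] by (intro sum.cong refl) simp
  finally show ?thesis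
    using \<zeta>_power_sum[OF assms(2)] by simp
qed

text \<open>Cancelling \<open>z - A\<close> leaves the simple pole at \<open>B\<close>, so \<open>S 1 - A S 0\<close> is a Lagrange sum at \<open>B\<close>.\<close>

lemma S_root_nonzero:
  assumes "w \<in> P" "w \<noteq> 0"
    and AB: "\<And>z. cnj (cw w) * z\<^sup>2 - 2 * z + cw w = cnj (cw w) * (z - A) * (z - B)"
  shows "S 1 w - A * S 0 w \<noteq> 0"
proof -
  have cw0: "cnj (cw w) \<noteq> 0"
    using assms(2) by (simp add: cw_def complex_eq_iff prod_eq_iff)
  have nz: "\<zeta> j - A \<noteq> 0" "\<zeta> j - B \<noteq> 0" if "j < 2 * n" for j
    using quadratic_at_node_nonzero[OF assms(1) that] unfolding AB by auto
  have B: "B \<notin> \<zeta> ` {..<2 * n}"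
    using nz by auto
  have "S 1 w - A * S 0 w = (\<Sum>j<2 * n. \<zeta> j ^ 0 / \<zeta>_prod j / (B - \<zeta> j)) * (- 1 / cnj (cw w))"
    unfolding S_def sum_distrib_left sum_subtractf[symmetric] sum_distrib_right AB
  proof (intro sum.cong refl)
    fix j assume "j \<in> {..<2 * n}"
    then have "\<zeta> j - A \<noteq> 0" "\<zeta> j - B \<noteq> 0" "\<zeta>_prod j \<noteq> 0" "B - \<zeta> j \<noteq> 0"
      using nz[of j] \<zeta>_prod_nonzero by auto
    moreover have "z / q / (W * (z - A) * (z - B)) - A * (1 / q / (W * (z - A) * (z - B))) = 1 / q / (B - z) * (- 1 / W)"
      if "z - A \<noteq> 0" "z - B \<noteq> 0" "B - z \<noteq> 0" "q \<noteq> 0" "W \<noteq> 0" for z q W :: complex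
      using that by (simp add: divide_simps)
    ultimately show "\<zeta> j ^ 1 / \<zeta>_prod j / (cnj (cw w) * (\<zeta> j - A) * (\<zeta> j - B)) -
        A * (\<zeta> j ^ 0 / \<zeta>_prod j / (cnj (cw w) * (\<zeta> j - A) * (\<zeta> j - B))) =
        \<zeta> j ^ 0 / \<zeta>_prod j / (B - \<zeta> j) * (- 1 / cnj (cw w))"
      using cw0 by simp
  qed
  also have "(\<Sum>j<2 * n. \<zeta> j ^ 0 / \<zeta>_prod j / (B - \<zeta> j)) = B ^ 0 / (\<Prod>j<2 * n. B - \<zeta> j)"
    unfolding \<zeta>_prod_def using n_ge_2 by (intro lagrange_power inj_on_\<zeta> B) auto
  also have "\<dots> * (- 1 / cnj (cw w)) \<noteq> 0"
    using B cw0 by auto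
  finally show ?thesis .
qed

text \<open>At the centre the outer coefficients of the recurrence vanish and only its middle term
  survives. The indices 0 and \<open>2 * n\<close> escape.\<close>

lemma S_zero:
  assumes "1 \<le> k" "k \<le> 2 * n - 1"
  shows "S k 0 = 0"
proof -
  have "0 \<in> P" by (simp add: P_def D_def)
  from S_recurrence[OF this, of "k - 1"] assms show ?thesis
    by (simp add: cw_def complex_eq_iff)
qed

text \<open>At w = 0 the denominators become \<open>- 2 * \<zeta> j\<close>, which gives half a
  Lagrange sum evaluated at 0.\<close>

lemma S_0_zero: "S 0 0 \<noteq> 0"
proof -
  have "S 0 0 = (\<Sum>j<2 * n. \<zeta> j ^ 0 / \<zeta>_prod j / (0 - \<zeta> j)) / 2"
    unfolding S_def sum_divide_distrib
  proof (intro sum.cong refl)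
    fix j assume "j \<in> {..<2 * n}"
    have "cw 0 = 0" by (simp add: cw_def complex_eq_iff)
    then have d: "cnj (cw 0) * (\<zeta> j)\<^sup>2 - 2 * \<zeta> j + cw 0 = (0 - \<zeta> j) * 2"
      by simp
    show "\<zeta> j ^ 0 / \<zeta>_prod j / (cnj (cw 0) * (\<zeta> j)\<^sup>2 - 2 * \<zeta> j + cw 0) =
        \<zeta> j ^ 0 / \<zeta>_prod j / (0 - \<zeta> j) / 2"
      unfolding d by (simp only: divide_divide_eq_left mult.assoc)
  qed
  also have "(\<Sum>j<2 * n. \<zeta> j ^ 0 / \<zeta>_prod j / (0 - \<zeta> j)) = 0 ^ 0 / (\<Prod>j<2 * n. 0 - \<zeta> j)"
    unfolding \<zeta>_prod_def using n_ge_2 by (intro lagrange_power inj_on_\<zeta> zero_notin_\<zeta>) auto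
  finally show ?thesis by simp
qed

text \<open>After removal of a phase, \<open>S\<close> is a Chebyshev sequence, so all these
  quadratic expressions are multiples of one Casoratian. The first three become the metric
  coefficients, the last one the Jacobian.\<close>

lemma S_identities:
  assumes "w \<in> P" "w \<noteq> 0"
  obtains k where "k \<noteq> 0"
    "S 0 w * S (2 * n - 2) w - (S (n - 1) w)\<^sup>2 = k * (cnj (cw w))\<^sup>2"
    "S 2 w * S (2 * n) w - (S (n + 1) w)\<^sup>2 = k * (cw w)\<^sup>2"
    "S 2 w * S (2 * n - 2) w + S 0 w * S (2 * n) w - 2 * (S (n - 1) w * S (n + 1) w) = 2 * k * (2 - cw w * cnj (cw w))"
    "S 2 w * S (2 * n - 2) w - S 0 w * S (2 * n) w \<noteq> 0"
proof -
  obtain m where m: "n = Suc m" "m \<ge> 1"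
    using n_ge_2 by (cases n) auto
  have idx: "2 * n - 2 = 2 * m" "n - 1 = m" "n + 1 = m + 2" "2 * n = 2 * m + 2"
    using m by simp_all
  define u where "u = 1 / norm w"
  define e where "e = cw w * of_real u"
  have nw: "norm w > 0" "norm (cw w) = norm w"
    using assms(2) by (simp, simp add: cw_def cmod_def norm_prod_def)
  have u: "u > 0" "u \<noteq> 0" using nw by (auto simp: u_def)
  have "norm e = 1"
    using nw u by (simp add: e_def norm_mult norm_divide u_def)
  then have ee: "e * cnj e = 1"
    using complex_norm_square[of e] by simp
  then have e0: "e \<noteq> 0" by auto
  have cwe: "cw w = e / of_real u"
    using u by (simp add: e_def)
  have cnje: "cnj e = 1 / e" using ee e0 by (simp add: field_simps)
  have cnjw: "cnj (cw w) = 1 / (e * of_real u)"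
    by (simp add: cwe cnje)
  have pw: "e ^ (2 * m + 2) = e ^ m * e ^ m * e * e" "e ^ (2 * m + 4) = e ^ m * e ^ m * e * e * e * e"
    "e ^ (m + 2) = e ^ m * e * e" "e ^ (2 * m) = e ^ m * e ^ m" "e ^ 0 = 1" "e ^ 2 = e * e"
    by (simp_all add: power_add mult_2 eval_nat_numeral)
  \<comment> \<open>Dividing by powers of the unit number \<open>e\<close> turns the complex
    recurrence into the one with the real parameter \<open>u\<close>.\<close>
  define s where "s k = S k w / e ^ k" for k
  have S: "S k w = e ^ k * s k" for k
    using e0 by (simp add: s_def)
  have rec: "s (k + 2) = of_real (2 * u) * s (k + 1) - s k" if "k \<le> 2 * m" for k
  proof -
    have 1: "cnj (cw w) * S (k + 2) w - 2 * S (k + 1) w + cw w * S k w = 0"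
      using that m by (intro S_recurrence assms(1)) auto
    have "0 = e ^ k * (e * (s (k + 2) - of_real (2 * u) * s (k + 1) + s k)) / of_real u"
      unfolding 1[symmetric] unfolding S cnjw unfolding cwe using e0 u
      by (simp add: power_add power2_eq_square divide_simps) (simp add: algebra_simps)
    then have "s (k + 2) - of_real (2 * u) * s (k + 1) + s k = 0"
      using e0 u by (simp del: of_real_mult)
    then show ?thesis
      by (simp add: algebra_simps eq_diff_eq)
  qed
  define C where "C = s 1 * s 1 - s 0 * s 2"
  define V where "V k = complex_of_real (cheb u k)" for k
  have vajda: "s (i + a) * s (i + b) - s i * s (i + a + b) = V a * V b * C" if "i + a + b \<le> 2 * m + 2" for i a b
    using cheb_recurrence_vajda[of "2 * m" s u, OF rec that] by (simp add: C_def V_def)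
  \<comment> \<open>The four instances cover all products in the claims; \<open>i3\<close> enters
    both the third identity and the Jacobian.\<close>
  have i1: "s m * s m - s 0 * s (2 * m) = V m * V m * C"
    using vajda[of 0 m m] by (simp add: mult_2)
  have i2: "s (m + 2) * s (m + 2) - s 2 * s (2 * m + 2) = V m * V m * C"
    using vajda[of 2 m m] by (simp add: mult_2 add.commute)
  have i3: "s 2 * s (2 * m) - s 0 * s (2 * m + 2) = V 2 * V (2 * m) * C"
    using vajda[of 0 2 "2 * m"] by (simp only: add_0 add.commute[of 2 "2 * m"] order_refl simp_thms)
  have i4: "s m * s (m + 2) - s 0 * s (2 * m + 2) = V m * V (m + 2) * C"
    using vajda[of 0 m "m + 2"] by (simp add: mult_2)
  have V2: "V 2 = 2 * of_real u"
    by (simp add: V_def numeral_2_eq_2)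
  have Vd: "V (2 * m) = V m * (2 * V (m + 1) - 2 * of_real u * V m)"
    by (simp add: V_def cheb_double)
  have Vr: "V (m + 2) = 2 * of_real u * V (m + 1) - V m"
    by (simp add: V_def)
  \<comment> \<open>The gap condition enters here, through \<open>P_bound\<close>; with
    \<open>cheb_double\<close> it also gives \<open>V m \<noteq> 0\<close>.\<close>
  have "cheb u (2 * m) > 0"
    using P_bound[OF assms] m by (intro cheb_pos) (auto simp: u_def)
  then have V2m: "V (2 * m) \<noteq> 0" by (simp add: V_def)
  then have Vm: "V m \<noteq> 0" unfolding Vd by auto
  \<comment> \<open>\<open>C\<close> factors as (s 1 - a s 0) (s 1 - b s 0), where a and b are the
    roots of x^2 - 2 u x + 1, and \<open>S_root_nonzero\<close> applies to each factor. The complex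
    square root covers \<open>u < 1\<close>.\<close>
  have C0: "C \<noteq> 0"
  proof -
    define r where "r = csqrt (of_real (u\<^sup>2 - 1))"
    define a b where "a = of_real u + r" and "b = of_real u - r"
    have ab: "a + b = 2 * of_real u" "a * b = 1"
      using power2_csqrt[of "of_real (u\<^sup>2 - 1)"] by (simp_all add: a_def b_def r_def power2_eq_square algebra_simps)
    have roots: "cnj (cw w) * z\<^sup>2 - 2 * z + cw w = cnj (cw w) * (z - e * a) * (z - e * b)"
      "cnj (cw w) * z\<^sup>2 - 2 * z + cw w = cnj (cw w) * (z - e * b) * (z - e * a)" for z
    proof -
      have "cnj (cw w) * (z - e * a) * (z - e * b) = cnj (cw w) * (z\<^sup>2 - e * (a + b) * z + e\<^sup>2 * (a * b))"
        by (simp add: power2_eq_square algebra_simps)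
      also have "\<dots> = cnj (cw w) * z\<^sup>2 - 2 * z + cw w"
        unfolding ab cnjw unfolding cwe using e0 u by (simp add: power2_eq_square field_simps)
      finally show "cnj (cw w) * z\<^sup>2 - 2 * z + cw w = cnj (cw w) * (z - e * a) * (z - e * b)" ..
      then show "cnj (cw w) * z\<^sup>2 - 2 * z + cw w = cnj (cw w) * (z - e * b) * (z - e * a)"
        by (simp add: mult_ac)
    qed
    have "S 1 w - e * a * S 0 w \<noteq> 0" "S 1 w - e * b * S 0 w \<noteq> 0"
      using S_root_nonzero[OF assms] roots by blast+
    then have "s 1 - a * s 0 \<noteq> 0" "s 1 - b * s 0 \<noteq> 0"
      unfolding S by auto
    moreover have "(s 1 - a * s 0) * (s 1 - b * s 0) = s 1 * s 1 - (a + b) * s 0 * s 1 + a * b * (s 0 * s 0)"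
      by (simp add: algebra_simps)
    moreover have s2: "s 2 = of_real (2 * u) * s 1 - s 0"
      using rec[of 0] by (simp add: numeral_2_eq_2)
    have "s 1 * s 1 - (a + b) * s 0 * s 1 + a * b * (s 0 * s 0) = C"
      unfolding C_def ab s2 by (simp add: algebra_simps)
    ultimately show ?thesis
      by (metis no_zero_divisors)
  qed
  define k where "k = - (e ^ (2 * m + 2)) * (V m)\<^sup>2 * C * (of_real u)\<^sup>2"
  have "k \<noteq> 0" using e0 u Vm C0 by (simp add: k_def)
  moreover have "S 0 w * S (2 * n - 2) w - (S (n - 1) w)\<^sup>2 = k * (cnj (cw w))\<^sup>2"
  proof -
    have "S 0 w * S (2 * n - 2) w - (S (n - 1) w)\<^sup>2 = - (e ^ (2 * m) * (s m * s m - s 0 * s (2 * m)))"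
      unfolding idx(1-3) unfolding idx(4) S pw by (simp add: power2_eq_square algebra_simps)
    also have "\<dots> = k * (cnj (cw w))\<^sup>2"
      unfolding i1 k_def cnjw pw using e0 u by (simp add: power2_eq_square divide_simps)
    finally show ?thesis .
  qed
  moreover have "S 2 w * S (2 * n) w - (S (n + 1) w)\<^sup>2 = k * (cw w)\<^sup>2"
  proof -
    have "S 2 w * S (2 * n) w - (S (n + 1) w)\<^sup>2 = - (e ^ (2 * m + 4) * (s (m + 2) * s (m + 2) - s 2 * s (2 * m + 2)))"
      unfolding idx(1-3) unfolding idx(4) S pw by (simp add: power2_eq_square algebra_simps)
    also have "\<dots> = k * (cw w)\<^sup>2"
      unfolding i2 k_def cwe pw using e0 u by (simp add: power2_eq_square divide_simps)
    finally show ?thesis .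
  qed
  moreover have "S 2 w * S (2 * n - 2) w + S 0 w * S (2 * n) w - 2 * (S (n - 1) w * S (n + 1) w)
      = 2 * k * (2 - cw w * cnj (cw w))"
  proof -
    have "S 2 w * S (2 * n - 2) w + S 0 w * S (2 * n) w - 2 * (S (n - 1) w * S (n + 1) w)
       = e ^ (2 * m + 2) * ((s 2 * s (2 * m) - s 0 * s (2 * m + 2)) - 2 * (s m * s (m + 2) - s 0 * s (2 * m + 2)))"
      unfolding idx(1-3) unfolding idx(4) S pw by (simp add: power2_eq_square algebra_simps)
    also have "\<dots> = e ^ (2 * m + 2) * (2 * (V m)\<^sup>2 * C * (1 - 2 * (of_real u)\<^sup>2))"
      unfolding i3 i4 V2 Vd Vr by (simp add: power2_eq_square algebra_simps)
    also have "\<dots> = 2 * k * (2 - cw w * cnj (cw w))"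
      unfolding k_def cnjw unfolding cwe using e0 u by (simp add: power2_eq_square divide_simps) (simp add: algebra_simps)
    finally show ?thesis .
  qed
  moreover have "S 2 w * S (2 * n - 2) w - S 0 w * S (2 * n) w \<noteq> 0"
  proof -
    have "S 2 w * S (2 * n - 2) w - S 0 w * S (2 * n) w = e ^ (2 * m + 2) * (s 2 * s (2 * m) - s 0 * s (2 * m + 2))"
      unfolding idx(1-3) unfolding idx(4) S pw by (simp add: power2_eq_square algebra_simps)
    then show ?thesis
      unfolding i3 V2 using e0 u V2m C0 by simp
  qed
  ultimately show thesis by (rule that)
qed

end

text \<open>
  The chain rule for a graph \<open>X0 = l (X1, X2)\<close>: the linear PDE satisfied by the three coordinates
  has the cofactors of the first fundamental form as coefficients, so its normal component is the
  zero mean curvature equation.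
\<close>

lemma zmc_algebra:
  fixes lx ly lxx lxy lyx lyy :: real
  assumes p: "X0p = lx * X1p + ly * X2p" and q: "X0q = lx * X1q + ly * X2q"
    and pp: "X0pp = (lxx * X1p + lxy * X2p) * X1p + (lyx * X1p + lyy * X2p) * X2p + lx * X1pp + ly * X2pp"
    and pq: "X0pq = (lxx * X1q + lxy * X2q) * X1p + (lyx * X1q + lyy * X2q) * X2p + lx * X1pq + ly * X2pq"
    and qp: "X0pq = (lxx * X1p + lxy * X2p) * X1q + (lyx * X1p + lyy * X2p) * X2q + lx * X1pq + ly * X2pq"
    and qq: "X0qq = (lxx * X1q + lxy * X2q) * X1q + (lyx * X1q + lyy * X2q) * X2q + lx * X1qq + ly * X2qq"
    and J: "X1p * X2q - X1q * X2p \<noteq> 0"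
    and E: "X1p\<^sup>2 + X2p\<^sup>2 - X0p\<^sup>2 = k * (1 - b\<^sup>2)"
    and F: "X1p * X1q + X2p * X2q - X0p * X0q = k * (a * b)"
    and G: "X1q\<^sup>2 + X2q\<^sup>2 - X0q\<^sup>2 = k * (1 - a\<^sup>2)"
    and pde0: "(1 - a\<^sup>2) * X0pp - 2 * a * b * X0pq + (1 - b\<^sup>2) * X0qq = 2 * (a * X0p + b * X0q)"
    and pde1: "(1 - a\<^sup>2) * X1pp - 2 * a * b * X1pq + (1 - b\<^sup>2) * X1qq = 2 * (a * X1p + b * X1q)"
    and pde2: "(1 - a\<^sup>2) * X2pp - 2 * a * b * X2pq + (1 - b\<^sup>2) * X2qq = 2 * (a * X2p + b * X2q)"
  shows "(1 - ly\<^sup>2) * lxx + 2 * lx * ly * lxy + (1 - lx\<^sup>2) * lyy = 0"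
    and "(X1p * X2q - X1q * X2p)\<^sup>2 * (1 - (lx\<^sup>2 + ly\<^sup>2)) = k\<^sup>2 * (1 - (a\<^sup>2 + b\<^sup>2))"
proof -
  define J where "J = X1p * X2q - X1q * X2p"
  \<comment> \<open>The two expressions for \<open>X0pq\<close> differ by this product, so the
    symmetry of the second derivatives of the graph function follows from that of the
    parametrization.\<close>
  have "(lxy - lyx) * J = 0"
    using pq qp by (simp add: J_def algebra_simps)
  then have sym: "lyx = lxy"
    using J by (simp add: J_def)
  \<comment> \<open>The Hessian of the graph function pulled back to the parameters. Contracted with
    the adjugate of the first fundamental form, it is the zero mean curvature operator times the
    squared Jacobian.\<close>
  define L M N where "L = lxx * X1p\<^sup>2 + 2 * lxy * X1p * X2p + lyy * X2p\<^sup>2"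
    and "M = lxx * X1p * X1q + lxy * (X1p * X2q + X1q * X2p) + lyy * X2p * X2q"
    and "N = lxx * X1q\<^sup>2 + 2 * lxy * X1q * X2q + lyy * X2q\<^sup>2"
  have LMN: "L = X0pp - lx * X1pp - ly * X2pp" "M = X0pq - lx * X1pq - ly * X2pq" "N = X0qq - lx * X1qq - ly * X2qq"
    unfolding pp pq qq L_def M_def N_def sym by (simp_all add: power2_eq_square algebra_simps)
  have "(1 - a\<^sup>2) * L - 2 * a * b * M + (1 - b\<^sup>2) * N
      = ((1 - a\<^sup>2) * X0pp - 2 * a * b * X0pq + (1 - b\<^sup>2) * X0qq)
        - lx * ((1 - a\<^sup>2) * X1pp - 2 * a * b * X1pq + (1 - b\<^sup>2) * X1qq)
        - ly * ((1 - a\<^sup>2) * X2pp - 2 * a * b * X2pq + (1 - b\<^sup>2) * X2qq)"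
    unfolding LMN by (simp add: algebra_simps)
  also have "\<dots> = 0"
    unfolding pde0 pde1 pde2 p q by (simp add: algebra_simps)
  finally have 0: "(1 - a\<^sup>2) * L - 2 * a * b * M + (1 - b\<^sup>2) * N = 0" .
  have "J\<^sup>2 * ((1 - ly\<^sup>2) * lxx + 2 * lx * ly * lxy + (1 - lx\<^sup>2) * lyy)
      = (X1q\<^sup>2 + X2q\<^sup>2 - X0q\<^sup>2) * L - 2 * (X1p * X1q + X2p * X2q - X0p * X0q) * M + (X1p\<^sup>2 + X2p\<^sup>2 - X0p\<^sup>2) * N"
    unfolding J_def L_def M_def N_def p q by (simp add: power2_eq_square) algebra
  also have "\<dots> = k * ((1 - a\<^sup>2) * L - 2 * a * b * M + (1 - b\<^sup>2) * N)"
    unfolding E F G by (simp add: algebra_simps)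
  finally show "(1 - ly\<^sup>2) * lxx + 2 * lx * ly * lxy + (1 - lx\<^sup>2) * lyy = 0"
    using 0 J by (simp add: J_def)
  have "J\<^sup>2 * (1 - (lx\<^sup>2 + ly\<^sup>2))
      = (X1p\<^sup>2 + X2p\<^sup>2 - X0p\<^sup>2) * (X1q\<^sup>2 + X2q\<^sup>2 - X0q\<^sup>2) - (X1p * X1q + X2p * X2q - X0p * X0q)\<^sup>2"
    unfolding J_def p q by (simp add: power2_eq_square) algebra
  also have "\<dots> = k\<^sup>2 * (1 - (a\<^sup>2 + b\<^sup>2))"
    unfolding E F G by (simp add: power2_eq_square) algebra
  finally show "(X1p * X2q - X1q * X2p)\<^sup>2 * (1 - (lx\<^sup>2 + ly\<^sup>2)) = k\<^sup>2 * (1 - (a\<^sup>2 + b\<^sup>2))"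
    by (simp add: J_def)
qed

context kobayashi
begin

section \<open>Sums of logarithms on the polygon and their derivatives\<close>

definition L :: "(nat \<Rightarrow> real) \<Rightarrow> real \<times> real \<Rightarrow> real" where
  "L v w = (\<Sum>j<2 * n. v j * ln (D j w))"

definition Lp :: "(nat \<Rightarrow> real) \<Rightarrow> real \<times> real \<Rightarrow> real" where
  "Lp v w = - (\<Sum>j<2 * n. v j * cos (\<alpha> j) / D j w)"

definition Lq :: "(nat \<Rightarrow> real) \<Rightarrow> real \<times> real \<Rightarrow> real" where
  "Lq v w = - (\<Sum>j<2 * n. v j * sin (\<alpha> j) / D j w)"

definition Lpp :: "(nat \<Rightarrow> real) \<Rightarrow> real \<times> real \<Rightarrow> real" where
  "Lpp v w = - (\<Sum>j<2 * n. v j * (cos (\<alpha> j))\<^sup>2 / (D j w)\<^sup>2)"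

definition Lpq :: "(nat \<Rightarrow> real) \<Rightarrow> real \<times> real \<Rightarrow> real" where
  "Lpq v w = - (\<Sum>j<2 * n. v j * (cos (\<alpha> j) * sin (\<alpha> j)) / (D j w)\<^sup>2)"

definition Lqq :: "(nat \<Rightarrow> real) \<Rightarrow> real \<times> real \<Rightarrow> real" where
  "Lqq v w = - (\<Sum>j<2 * n. v j * (sin (\<alpha> j))\<^sup>2 / (D j w)\<^sup>2)"

text \<open>Half the residues of the three Weierstrass one-forms; the missing factor 2 is absorbed
  by passing from ln |.| to ln |.|^2.\<close>

definition v0 :: "nat \<Rightarrow> real" where "v0 j = - c j"
definition v1 :: "nat \<Rightarrow> real" where "v1 j = c j * cos (\<beta> j)"
definition v2 :: "nat \<Rightarrow> real" where "v2 j = c j * sin (\<beta> j)"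

lemma sum_v: "(\<Sum>j<2 * n. v0 j) = 0" "(\<Sum>j<2 * n. v1 j) = 0" "(\<Sum>j<2 * n. v2 j) = 0"
  using sum_c sum_c_cos sum_c_sin by (simp_all add: v0_def v1_def v2_def sum_negf)

lemma D_has_derivative: "(D j has_derivative (\<lambda>h. - (fst h * cos (\<alpha> j) + snd h * sin (\<alpha> j)))) (at w)"
  unfolding D_def[abs_def] by (auto intro!: derivative_eq_intros)

lemma open_P: "open P"
proof -
  have "P = (\<Inter>j\<in>{..<2 * n}. {w. 0 < D j w})" by (auto simp: P_def)
  moreover have "open {w. 0 < D j w}" for j
    unfolding D_def by (intro open_Collect_less continuous_intros)
  ultimately show ?thesis by auto
qed

lemma convex_P: "convex P"
proof -
  have "P = (\<Inter>j\<in>{..<2 * n}. {w. (cos (\<alpha> j), sin (\<alpha> j)) \<bullet> w < 1})"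
    by (auto simp: P_def D_def inner_prod_def algebra_simps)
  then show ?thesis
    by (simp add: convex_INT convex_halfspace_lt)
qed

lemma zero_in_P: "0 \<in> P"
  by (simp add: P_def D_def)

lemma L_has_derivative:
  assumes "w \<in> P"
  shows "(L v has_derivative (\<lambda>h. fst h * Lp v w + snd h * Lq v w)) (at w)"
proof -
  have "(L v has_derivative (\<lambda>h. \<Sum>j<2 * n. v j * (- (fst h * cos (\<alpha> j) + snd h * sin (\<alpha> j)) * inverse (D j w)))) (at w)"
    unfolding L_def[abs_def] using D_pos[OF assms]
    by (intro has_derivative_sum has_derivative_mult_right has_derivative_ln D_has_derivative) auto
  moreover have "(\<Sum>j<2 * n. v j * (- (fst h * cos (\<alpha> j) + snd h * sin (\<alpha> j)) * inverse (D j w))) = fst h * Lp v w + snd h * Lq v w" for h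
    unfolding Lp_def Lq_def mult_minus_right sum_negf[symmetric] sum_distrib_left sum.distrib[symmetric]
    by (intro sum.cong refl) (simp add: divide_inverse algebra_simps)
  ultimately show ?thesis by simp
qed

lemma inverse_D_has_derivative:
  assumes "w \<in> P" "j < 2 * n"
  shows "((\<lambda>w. a / D j w) has_derivative (\<lambda>h. a * (fst h * cos (\<alpha> j) + snd h * sin (\<alpha> j)) / (D j w)\<^sup>2)) (at w)"
proof -
  have "D j w \<noteq> 0" using D_pos[of w j] assms by auto
  then show ?thesis
    by (auto intro!: derivative_eq_intros D_has_derivative simp: field_simps power2_eq_square)
qed

lemma Lp_has_derivative:
  assumes "w \<in> P"
  shows "(Lp v has_derivative (\<lambda>h. fst h * Lpp v w + snd h * Lpq v w)) (at w)"
proof -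
  have "(Lp v has_derivative (\<lambda>h. - (\<Sum>j<2 * n. v j * cos (\<alpha> j) * (fst h * cos (\<alpha> j) + snd h * sin (\<alpha> j)) / (D j w)\<^sup>2))) (at w)"
    unfolding Lp_def[abs_def] using assms
    by (intro has_derivative_minus has_derivative_sum inverse_D_has_derivative) auto
  moreover have "- (\<Sum>j<2 * n. v j * cos (\<alpha> j) * (fst h * cos (\<alpha> j) + snd h * sin (\<alpha> j)) / (D j w)\<^sup>2) = fst h * Lpp v w + snd h * Lpq v w" for h
    unfolding Lpp_def Lpq_def mult_minus_right sum_negf[symmetric] sum_distrib_left sum.distrib[symmetric]
    by (intro sum.cong refl) (simp add: divide_inverse power2_eq_square algebra_simps)
  ultimately show ?thesis by simp
qed

lemma Lq_has_derivative:
  assumes "w \<in> P"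
  shows "(Lq v has_derivative (\<lambda>h. fst h * Lpq v w + snd h * Lqq v w)) (at w)"
proof -
  have "(Lq v has_derivative (\<lambda>h. - (\<Sum>j<2 * n. v j * sin (\<alpha> j) * (fst h * cos (\<alpha> j) + snd h * sin (\<alpha> j)) / (D j w)\<^sup>2))) (at w)"
    unfolding Lq_def[abs_def] using assms
    by (intro has_derivative_minus has_derivative_sum inverse_D_has_derivative) auto
  moreover have "- (\<Sum>j<2 * n. v j * sin (\<alpha> j) * (fst h * cos (\<alpha> j) + snd h * sin (\<alpha> j)) / (D j w)\<^sup>2) = fst h * Lpq v w + snd h * Lqq v w" for h
    unfolding Lpq_def Lqq_def mult_minus_right sum_negf[symmetric] sum_distrib_left sum.distrib[symmetric]
    by (intro sum.cong refl) (simp add: divide_inverse power2_eq_square algebra_simps)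
  ultimately show ?thesis by simp
qed

text \<open>
  The wave equation on the light cone in Klein coordinates: each \<open>ln (u - \<langle>w, a\<rangle>)\<close> with \<open>|a| = 1\<close>
  solves the wave equation, and \<open>\<Sum>v = 0\<close> makes the sum homogeneous of degree 0 in \<open>(u, w)\<close>.
\<close>

lemma L_pde:
  assumes "(a, b) \<in> P" "(\<Sum>j<2 * n. v j) = 0"
  shows "(1 - a\<^sup>2) * Lpp v (a, b) - 2 * a * b * Lpq v (a, b) + (1 - b\<^sup>2) * Lqq v (a, b)
    = 2 * (a * Lp v (a, b) + b * Lq v (a, b))"
proof -
  have "(1 - a\<^sup>2) * Lpp v (a, b) - 2 * a * b * Lpq v (a, b) + (1 - b\<^sup>2) * Lqq v (a, b)
      - 2 * (a * Lp v (a, b) + b * Lq v (a, b)) = (\<Sum>j<2 * n. - v j)"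
    unfolding Lpp_def Lpq_def Lqq_def Lp_def Lq_def sum_negf[symmetric]
    unfolding sum_distrib_left sum.distrib[symmetric] sum_subtractf[symmetric]
  proof (intro sum.cong refl)
    fix j assume "j \<in> {..<2 * n}"
    define x y d where "x = cos (\<alpha> j)" and "y = sin (\<alpha> j)" and "d = D j (a, b)"
    have d: "d \<noteq> 0" using D_pos[OF assms(1), of j] \<open>j \<in> _\<close> by (auto simp: d_def)
    have d_eq: "d = 1 - a * x - b * y" by (simp add: d_def D_def x_def y_def)
    have xy: "x\<^sup>2 + y\<^sup>2 = 1" by (simp add: x_def y_def)
    have "- ((1 - a\<^sup>2) * x\<^sup>2) + 2 * a * b * (x * y) - (1 - b\<^sup>2) * y\<^sup>2 + 2 * (a * x + b * y) * d = - d\<^sup>2"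
      unfolding d_eq using xy by algebra
    then have "(- ((1 - a\<^sup>2) * x\<^sup>2) + 2 * a * b * (x * y) - (1 - b\<^sup>2) * y\<^sup>2 + 2 * (a * x + b * y) * d) / d\<^sup>2 = - 1"
      using d by simp
    then have "v j * ((- ((1 - a\<^sup>2) * x\<^sup>2) + 2 * a * b * (x * y) - (1 - b\<^sup>2) * y\<^sup>2 + 2 * (a * x + b * y) * d) / d\<^sup>2) = - v j"
      by simp
    moreover have "(1 - a\<^sup>2) * - (v j * x\<^sup>2 / d\<^sup>2) - 2 * a * b * - (v j * (x * y) / d\<^sup>2) + (1 - b\<^sup>2) * - (v j * y\<^sup>2 / d\<^sup>2)
        - 2 * (a * - (v j * x / d) + b * - (v j * y / d)) =
        v j * ((- ((1 - a\<^sup>2) * x\<^sup>2) + 2 * a * b * (x * y) - (1 - b\<^sup>2) * y\<^sup>2 + 2 * (a * x + b * y) * d) / d\<^sup>2)"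
      using d by (simp add: divide_simps power2_eq_square) (simp add: algebra_simps)
    ultimately show "(1 - a\<^sup>2) * - (v j * (cos (\<alpha> j))\<^sup>2 / (D j (a, b))\<^sup>2)
        - 2 * a * b * - (v j * (cos (\<alpha> j) * sin (\<alpha> j)) / (D j (a, b))\<^sup>2)
        + (1 - b\<^sup>2) * - (v j * (sin (\<alpha> j))\<^sup>2 / (D j (a, b))\<^sup>2)
        - 2 * (a * - (v j * cos (\<alpha> j) / D j (a, b)) + b * - (v j * sin (\<alpha> j) / D j (a, b))) = - v j"
      unfolding x_def y_def d_def by simp
  qed
  then show ?thesis
    using assms(2) by (simp add: sum_negf)
qed

text \<open>Euler's formulas write cosine and sine through \<open>(\<zeta> j)\<^sup>2 + 1\<close>
  and \<open>(\<zeta> j)\<^sup>2 - 1\<close> over \<open>2 * \<zeta> j\<close>; the factor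
  \<open>2 * \<zeta> j\<close> belongs to the denominator of \<open>S\<close>, so the exponents r
  and r + 2 remain.\<close>

lemma Lp_Lq_S:
  assumes "w \<in> P" "\<And>j. j < 2 * n \<Longrightarrow> b j = K * \<zeta> j ^ r / \<zeta>_prod j"
  shows "- (\<Sum>j<2 * n. b j * of_real (cos (\<alpha> j)) / of_real (D j w)) = K * (S r w + S (r + 2) w)"
    "- (\<Sum>j<2 * n. b j * of_real (sin (\<alpha> j)) / of_real (D j w)) = \<i> * K * (S r w - S (r + 2) w)"
proof -
  have cs: "of_real (cos (\<alpha> j)) * (2 * \<zeta> j) = (\<zeta> j)\<^sup>2 + 1" "\<i> * of_real (sin (\<alpha> j)) * (2 * \<zeta> j) = (\<zeta> j)\<^sup>2 - 1" for j
  proof -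
    have sc: "sin (\<alpha> j) * sin (\<alpha> j) = 1 - cos (\<alpha> j) * cos (\<alpha> j)"
      using sin_squared_eq[of "\<alpha> j"] by (simp add: power2_eq_square)
    show "of_real (cos (\<alpha> j)) * (2 * \<zeta> j) = (\<zeta> j)\<^sup>2 + 1" "\<i> * of_real (sin (\<alpha> j)) * (2 * \<zeta> j) = (\<zeta> j)\<^sup>2 - 1"
      by (simp_all add: complex_eq_iff \<zeta>_def power2_eq_square algebra_simps sc)
  qed
  have gen: "- (k * z / q * x / d) = k * (z / q / (- 2 * e * d) + z * e\<^sup>2 / q / (- 2 * e * d))"
    if "x * (2 * e) = e\<^sup>2 + 1" "d \<noteq> 0" "e \<noteq> 0" "q \<noteq> 0" for k z q x d e :: complex
  proof -
    have "x = (e\<^sup>2 + 1) / (2 * e)" using that by (simp add: field_simps)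
    then show ?thesis using that by (simp add: divide_simps) (simp add: algebra_simps)
  qed
  have gen2: "- (k * z / q * x / d) = \<i> * k * (z / q / (- 2 * e * d) - z * e\<^sup>2 / q / (- 2 * e * d))"
    if "\<i> * x * (2 * e) = e\<^sup>2 - 1" "d \<noteq> 0" "e \<noteq> 0" "q \<noteq> 0" for k z q x d e :: complex
  proof -
    have "\<i> * (\<i> * x * (2 * e)) = \<i> * (e\<^sup>2 - 1)" using that by simp
    then have "x * (2 * e) = - \<i> * (e\<^sup>2 - 1)" by (simp add: algebra_simps)
    then have "x = - \<i> * (e\<^sup>2 - 1) / (2 * e)" using that by (simp add: field_simps)
    then show ?thesis using that by (simp add: divide_simps) (simp add: algebra_simps)
  qed
  have Dn: "complex_of_real (D j w) \<noteq> 0" if "j < 2 * n" for j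
    using D_pos[OF assms(1), of j] that by simp
  show "- (\<Sum>j<2 * n. b j * of_real (cos (\<alpha> j)) / of_real (D j w)) = K * (S r w + S (r + 2) w)"
    unfolding S_def quadratic_at_node sum.distrib[symmetric] sum_distrib_left sum_negf[symmetric]
    by (intro sum.cong refl) (simp only: assms(2) lessThan_iff power_add gen[OF cs(1) Dn \<zeta>_nonzero \<zeta>_prod_nonzero])
  show "- (\<Sum>j<2 * n. b j * of_real (sin (\<alpha> j)) / of_real (D j w)) = \<i> * K * (S r w - S (r + 2) w)"
    unfolding S_def quadratic_at_node sum_subtractf[symmetric] sum_distrib_left sum_negf[symmetric]
    by (intro sum.cong refl) (simp only: assms(2) lessThan_iff power_add gen2[OF cs(2) Dn \<zeta>_nonzero \<zeta>_prod_nonzero])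
qed

text \<open>The residues of g h, g^2 h and h carry the exponents n - 1, 2 n - 2 and 0. The last two
  are those of v1 + i v2 and of its conjugate.\<close>

lemma derivatives_complex:
  assumes "w \<in> P"
  shows "of_real (Lp v0 w) = - K * (S (n - 1) w + S (n + 1) w)"
    "of_real (Lq v0 w) = - \<i> * K * (S (n - 1) w - S (n + 1) w)"
    "Complex (Lp v1 w) (Lp v2 w) = K * (S (2 * n - 2) w + S (2 * n) w)"
    "Complex (Lq v1 w) (Lq v2 w) = \<i> * K * (S (2 * n - 2) w - S (2 * n) w)"
    "Complex (Lp v1 w) (- Lp v2 w) = K * (S 0 w + S 2 w)"
    "Complex (Lq v1 w) (- Lq v2 w) = \<i> * K * (S 0 w - S 2 w)"
proof -
  have n: "n - 1 + 2 = n + 1" "2 * n - 2 + 2 = 2 * n" "0 + 2 = (2 :: nat)" using n_ge_2 by auto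
  have "of_real (Lp v0 w) = (\<Sum>j<2 * n. complex_of_real (c j) * of_real (cos (\<alpha> j)) / of_real (D j w))"
    "of_real (Lq v0 w) = (\<Sum>j<2 * n. complex_of_real (c j) * of_real (sin (\<alpha> j)) / of_real (D j w))"
    by (simp_all add: Lp_def Lq_def v0_def sum_negf[symmetric])
  then show "of_real (Lp v0 w) = - K * (S (n - 1) w + S (n + 1) w)"
    "of_real (Lq v0 w) = - \<i> * K * (S (n - 1) w - S (n + 1) w)"
    using Lp_Lq_S[OF assms of_real_c] unfolding n by (simp_all add: minus_equation_iff)
  have b: "of_real (c j) * cis (\<beta> j) = K * \<zeta> j ^ (2 * n - 2) / \<zeta>_prod j"
    "of_real (c j) * cis (- \<beta> j) = K * \<zeta> j ^ 0 / \<zeta>_prod j" if "j < 2 * n" for j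
    using K_\<zeta>[OF that] by simp_all
  have "Complex (Lp v1 w) (Lp v2 w) = - (\<Sum>j<2 * n. of_real (c j) * cis (\<beta> j) * of_real (cos (\<alpha> j)) / of_real (D j w))"
    "Complex (Lq v1 w) (Lq v2 w) = - (\<Sum>j<2 * n. of_real (c j) * cis (\<beta> j) * of_real (sin (\<alpha> j)) / of_real (D j w))"
    "Complex (Lp v1 w) (- Lp v2 w) = - (\<Sum>j<2 * n. of_real (c j) * cis (- \<beta> j) * of_real (cos (\<alpha> j)) / of_real (D j w))"
    "Complex (Lq v1 w) (- Lq v2 w) = - (\<Sum>j<2 * n. of_real (c j) * cis (- \<beta> j) * of_real (sin (\<alpha> j)) / of_real (D j w))"
    by (simp_all add: complex_eq_iff Lp_def Lq_def v1_def v2_def Re_divide_of_real Im_divide_of_real sum_negf)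
  then show "Complex (Lp v1 w) (Lp v2 w) = K * (S (2 * n - 2) w + S (2 * n) w)"
    "Complex (Lq v1 w) (Lq v2 w) = \<i> * K * (S (2 * n - 2) w - S (2 * n) w)"
    "Complex (Lp v1 w) (- Lp v2 w) = K * (S 0 w + S 2 w)"
    "Complex (Lq v1 w) (- Lq v2 w) = \<i> * K * (S 0 w - S 2 w)"
    using Lp_Lq_S[OF assms b(1)] Lp_Lq_S[OF assms b(2)] unfolding n by simp_all
qed

text \<open>Adds the centre, where \<open>u = 1 / norm w\<close> is meaningless and the identities
  are checked directly.\<close>

lemma S_identities_all:
  assumes "w \<in> P"
  obtains k where "w \<noteq> 0 \<longrightarrow> k \<noteq> 0"
    "S 0 w * S (2 * n - 2) w - (S (n - 1) w)\<^sup>2 = k * (cnj (cw w))\<^sup>2"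
    "S 2 w * S (2 * n) w - (S (n + 1) w)\<^sup>2 = k * (cw w)\<^sup>2"
    "S 2 w * S (2 * n - 2) w + S 0 w * S (2 * n) w - 2 * (S (n - 1) w * S (n + 1) w) = 2 * k * (2 - cw w * cnj (cw w))"
    "S 2 w * S (2 * n - 2) w - S 0 w * S (2 * n) w \<noteq> 0"
proof (cases "w = 0")
  case True
  have z: "S (2 * n - 2) 0 = 0" "S 2 0 = 0" "S (n - 1) 0 = 0" "S (n + 1) 0 = 0"
    using n_ge_2 by (intro S_zero; simp)+
  have K0: "K \<noteq> 0" by (simp add: K_def kobayashi_\<Lambda>_def)
  have "S (2 * n) 0 \<noteq> 0"
  proof
    assume "S (2 * n) 0 = 0"
    then have "Lp v1 0 = 0" "Lp v2 0 = 0"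
      using derivatives_complex(3)[OF zero_in_P] z by (simp_all add: complex_eq_iff)
    then have "K * S 0 0 = 0"
      using derivatives_complex(5)[OF zero_in_P] z by (simp add: Complex_eq)
    then show False
      using S_0_zero K0 by simp
  qed
  \<comment> \<open>Only \<open>S 0\<close> and \<open>S (2 * n)\<close> survive at the centre, so
    the third identity dictates the factor; the first two are trivial.\<close>
  then show thesis
    using that[of "S 0 0 * S (2 * n) 0 / 4"] S_0_zero z unfolding True
    by (simp add: cw_def Complex_eq)
next
  case False
  then show thesis
    using S_identities[OF assms] that by metis
qed

text \<open>Products of v1 + i v2 with its conjugate express the metric through the quantities of
  \<open>S_identities_all\<close>; the Jacobian is an imaginary part of such a product.\<close>

lemma fundamental_form:
  assumes "(a, b) \<in> P"
  obtains k where "(a, b) \<noteq> 0 \<longrightarrow> k \<noteq> 0"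
    "(Lp v1 (a, b))\<^sup>2 + (Lp v2 (a, b))\<^sup>2 - (Lp v0 (a, b))\<^sup>2 = k * (1 - b\<^sup>2)"
    "Lp v1 (a, b) * Lq v1 (a, b) + Lp v2 (a, b) * Lq v2 (a, b) - Lp v0 (a, b) * Lq v0 (a, b) = k * (a * b)"
    "(Lq v1 (a, b))\<^sup>2 + (Lq v2 (a, b))\<^sup>2 - (Lq v0 (a, b))\<^sup>2 = k * (1 - a\<^sup>2)"
    "Lp v1 (a, b) * Lq v2 (a, b) - Lq v1 (a, b) * Lp v2 (a, b) \<noteq> 0"
proof -
  define w where "w = (a, b)"
  have wP: "w \<in> P" using assms by (simp add: w_def)
  have K0: "K \<noteq> 0" by (simp add: K_def kobayashi_\<Lambda>_def)
  obtain k0 where k0: "w \<noteq> 0 \<longrightarrow> k0 \<noteq> 0"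
    "S 0 w * S (2 * n - 2) w - (S (n - 1) w)\<^sup>2 = k0 * (cnj (cw w))\<^sup>2"
    "S 2 w * S (2 * n) w - (S (n + 1) w)\<^sup>2 = k0 * (cw w)\<^sup>2"
    "S 2 w * S (2 * n - 2) w + S 0 w * S (2 * n) w - 2 * (S (n - 1) w * S (n + 1) w) = 2 * k0 * (2 - cw w * cnj (cw w))"
    "S 2 w * S (2 * n - 2) w - S 0 w * S (2 * n) w \<noteq> 0"
    using S_identities_all[OF wP] .
  define t0 t0' t t' r r' where "t0 = complex_of_real (Lp v0 w)" and "t0' = complex_of_real (Lq v0 w)"
    and "t = Complex (Lp v1 w) (Lp v2 w)" and "t' = Complex (Lq v1 w) (Lq v2 w)"
    and "r = Complex (Lp v1 w) (- Lp v2 w)" and "r' = Complex (Lq v1 w) (- Lq v2 w)"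
  note d = derivatives_complex[OF wP, folded t0_def t0'_def t_def t'_def r_def r'_def]
  have cww: "cw w = of_real a + \<i> * of_real b" "cnj (cw w) = of_real a - \<i> * of_real b"
    by (simp_all add: cw_def w_def complex_eq_iff)
  have i2: "\<i> * \<i> = (-1 :: complex)" by simp
  have g: "k * (x - \<i> * y)\<^sup>2 + k * (x + \<i> * y)\<^sup>2 + 2 * k * (2 - (x + \<i> * y) * (x - \<i> * y)) = 4 * k * (1 - y\<^sup>2)"
    "\<i> * (k * (x - \<i> * y)\<^sup>2 - k * (x + \<i> * y)\<^sup>2) = 4 * k * (x * y)"
    "- (k * (x - \<i> * y)\<^sup>2 + k * (x + \<i> * y)\<^sup>2 - 2 * k * (2 - (x + \<i> * y) * (x - \<i> * y))) = 4 * k * (1 - x\<^sup>2)"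
    for k x y :: complex
    by (simp_all add: power2_eq_square algebra_simps)
  define k where "k = 4 * K\<^sup>2 * k0"
  have E: "of_real ((Lp v1 w)\<^sup>2 + (Lp v2 w)\<^sup>2 - (Lp v0 w)\<^sup>2) = k * of_real (1 - b\<^sup>2)"
  proof -
    have "of_real ((Lp v1 w)\<^sup>2 + (Lp v2 w)\<^sup>2 - (Lp v0 w)\<^sup>2) = t * r - t0\<^sup>2"
      by (simp add: complex_eq_iff t_def r_def t0_def power2_eq_square)
    also have "\<dots> = K\<^sup>2 * ((S 0 w * S (2 * n - 2) w - (S (n - 1) w)\<^sup>2) + (S 2 w * S (2 * n) w - (S (n + 1) w)\<^sup>2)
       + (S 2 w * S (2 * n - 2) w + S 0 w * S (2 * n) w - 2 * (S (n - 1) w * S (n + 1) w)))"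
      unfolding d by algebra
    also have "\<dots> = k * of_real (1 - b\<^sup>2)"
      unfolding k0 k_def cww(2) unfolding cww(1) g by simp
    finally show ?thesis .
  qed
  have F: "of_real (Lp v1 w * Lq v1 w + Lp v2 w * Lq v2 w - Lp v0 w * Lq v0 w) = k * of_real (a * b)"
  proof -
    have "of_real (Lp v1 w * Lq v1 w + Lp v2 w * Lq v2 w - Lp v0 w * Lq v0 w) = (t * r' + t' * r) / 2 - t0 * t0'"
      by (simp add: complex_eq_iff t_def r_def t'_def r'_def t0_def t0'_def)
    also have "\<dots> = K\<^sup>2 * (\<i> * ((S 0 w * S (2 * n - 2) w - (S (n - 1) w)\<^sup>2) - (S 2 w * S (2 * n) w - (S (n + 1) w)\<^sup>2)))"
      unfolding d by (simp add: field_simps power2_eq_square)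
    also have "\<dots> = k * of_real (a * b)"
      unfolding k0 k_def cww(2) unfolding cww(1) g by simp
    finally show ?thesis .
  qed
  have G: "of_real ((Lq v1 w)\<^sup>2 + (Lq v2 w)\<^sup>2 - (Lq v0 w)\<^sup>2) = k * of_real (1 - a\<^sup>2)"
  proof -
    have "of_real ((Lq v1 w)\<^sup>2 + (Lq v2 w)\<^sup>2 - (Lq v0 w)\<^sup>2) = t' * r' - t0'\<^sup>2"
      by (simp add: complex_eq_iff t'_def r'_def t0'_def power2_eq_square)
    also have "\<dots> = K\<^sup>2 * - ((S 0 w * S (2 * n - 2) w - (S (n - 1) w)\<^sup>2) + (S 2 w * S (2 * n) w - (S (n + 1) w)\<^sup>2)
       - (S 2 w * S (2 * n - 2) w + S 0 w * S (2 * n) w - 2 * (S (n - 1) w * S (n + 1) w)))"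
      unfolding d using i2 by algebra
    also have "\<dots> = k * of_real (1 - a\<^sup>2)"
      unfolding k0 k_def cww(2) unfolding cww(1) g by simp
    finally show ?thesis .
  qed
  have J: "Lp v1 w * Lq v2 w - Lq v1 w * Lp v2 w \<noteq> 0"
  proof
    assume 0: "Lp v1 w * Lq v2 w - Lq v1 w * Lp v2 w = 0"
    have "r * t' - t * r' = 2 * \<i> * of_real (Lp v1 w * Lq v2 w - Lq v1 w * Lp v2 w)"
      by (simp add: complex_eq_iff t_def r_def t'_def r'_def)
    then have "r * t' - t * r' = 0" unfolding 0 by simp
    moreover have "r * t' - t * r' = 2 * \<i> * K\<^sup>2 * (S 2 w * S (2 * n - 2) w - S 0 w * S (2 * n) w)"
      unfolding d by (simp add: algebra_simps power2_eq_square)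
    ultimately show False using k0(5) K0 by simp
  qed
  \<comment> \<open>The left sides are real, so the complex factor may be replaced by its real
    part.\<close>
  have Re_k: "x = Re k * y" if "complex_of_real x = k * of_real y" for x y
    using arg_cong[OF that, of Re] by simp
  \<comment> \<open>If the real part vanished, all left sides would be 0, and the nonzero
    \<open>k\<close> would force a^2 = b^2 = 1 together with a b = 0.\<close>
  have "Re k \<noteq> 0" if "w \<noteq> 0"
  proof
    assume "Re k = 0"
    have k: "k \<noteq> 0" using k0(1) that K0 by (simp add: k_def)
    have "complex_of_real (1 - b\<^sup>2) = 0" "complex_of_real (a * b) = 0" "complex_of_real (1 - a\<^sup>2) = 0"
      using Re_k[OF E] Re_k[OF F] Re_k[OF G] E F G k \<open>Re k = 0\<close> by (metis mult_eq_0_iff mult_zero_left of_real_0)+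
    then have "1 - b\<^sup>2 = 0" "a * b = 0" "1 - a\<^sup>2 = 0"
      by (simp_all only: of_real_eq_0_iff)
    then show False by auto
  qed
  then show thesis
    using that[of "Re k"] Re_k[OF E] Re_k[OF F] Re_k[OF G] J unfolding w_def by blast
qed

end

lemma has_derivative_eq_on_open:
  assumes "open S" "x \<in> S" "\<And>y. y \<in> S \<Longrightarrow> f y = g y"
    and "(f has_derivative f') (at x)" "(g has_derivative g') (at x)"
  shows "f' = g'"
  using has_derivative_transform_within_open[OF assms(4) assms(1,2), of g] assms(3,5) has_derivative_unique by blast

text \<open>One of \<open>d\<close> and \<open>2 * pi - d\<close> lies where the cosine decreases,
  and both have the same cosine. In use, \<open>d\<close> is the angle to a far node,
  \<open>x\<close> and \<open>y\<close> those to the ends of a sector.\<close>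

lemma cos_less_max:
  assumes "0 \<le> x" "x < d" "0 \<le> y" "y < 2 * pi - d"
  shows "cos d < max (cos x) (cos y)"
proof (cases "d \<le> pi")
  case True
  then show ?thesis
    using cos_monotone_0_pi[of x d] assms by auto
next
  case False
  then have "cos (2 * pi - d) < cos y"
    using assms by (intro cos_monotone_0_pi) auto
  then show ?thesis by (simp add: cos_diff)
qed

context kobayashi
begin

section \<open>The projected surface in the Klein model\<close>

definition W :: "real \<times> real \<Rightarrow> real \<times> real \<Rightarrow> real \<times> real" where
  "W t w = (fst t + L v1 w, snd t + L v2 w)"

lemma W_has_derivative:
  assumes "w \<in> P"
  shows "(W t has_derivative (\<lambda>h. (fst h * Lp v1 w + snd h * Lq v1 w, fst h * Lp v2 w + snd h * Lq v2 w))) (at w)"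
  unfolding W_def[abs_def]
  by (rule derivative_eq_intros L_has_derivative[OF assms] refl)+ simp

lemma jacobian_W: "w \<in> P \<Longrightarrow> planar_jacobian (W t) w = Lp v1 w * Lq v2 w - Lq v1 w * Lp v2 w"
  using jacobianI[OF W_has_derivative] by simp

lemma jacobian_W_nonzero:
  assumes "w \<in> P"
  shows "planar_jacobian (W t) w \<noteq> 0"
proof -
  obtain a b where w: "w = (a, b)" by force
  show ?thesis
    using fundamental_form[of a b] assms unfolding jacobian_W[OF assms] unfolding w by blast
qed

lemma smooth_on_D: "smooth_on (D j) UNIV"
  unfolding D_def[abs_def]
  by (intro smooth_on_diff smooth_on_mult smooth_on_const smooth_on_fst smooth_on_snd open_UNIV)

lemma smooth_on_L: "smooth_on (L v) P"
  unfolding L_def[abs_def]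
proof (intro smooth_on_sum smooth_on_mult smooth_on_const open_P)
  fix j assume "j \<in> {..<2 * n}"
  then show "smooth_on (\<lambda>w. ln (D j w)) P"
    using D_pos by (intro smooth_on_compose[OF open_P smooth_on_ln] smooth_on_subset[OF smooth_on_D]) auto
qed

lemma smooth_on_W: "smooth_on (W t) P"
  unfolding W_def[abs_def] by (intro smooth_on_Pair smooth_on_add smooth_on_const smooth_on_L open_P)

text \<open>Differentiating the graph relation twice gives the premises of
  \<open>zmc_algebra\<close>. The mixed derivative is computed in both orders, as that lemma
  requires. In the second claim \<open>k\<close> is a squared quotient, hence positive, so the type
  changes across the unit circle.\<close>

lemma W_zmc:
  assumes l: "smooth_on l UNIV" and eq: "\<And>w. w \<in> P \<Longrightarrow> l (W t w) = t0 + L v0 w" and wP: "(a, b) \<in> P"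
  shows "(1 - (dy l (W t (a, b)))\<^sup>2) * dx (dx l) (W t (a, b)) + 2 * dx l (W t (a, b)) * dy l (W t (a, b)) * dy (dx l) (W t (a, b))
      + (1 - (dx l (W t (a, b)))\<^sup>2) * dy (dy l) (W t (a, b)) = 0" (is ?zmc)
    and "(a, b) \<noteq> 0 \<Longrightarrow> \<exists>k>0. 1 - ((dx l (W t (a, b)))\<^sup>2 + (dy l (W t (a, b)))\<^sup>2) = k * (1 - (a\<^sup>2 + b\<^sup>2))" (is "_ \<Longrightarrow> ?mixed")
proof -
  have chain: "((\<lambda>w. f (W t w)) has_derivative (\<lambda>h. (fst h * Lp v1 w + snd h * Lq v1 w) * dx f (W t w)
      + (fst h * Lp v2 w + snd h * Lq v2 w) * dy f (W t w))) (at w)"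
    if "smooth_on f UNIV" "w \<in> P" for f w
    using has_derivative_compose[OF W_has_derivative[OF that(2)] smooth_on_has_derivative_dx_dy[OF that(1) UNIV_I]]
    by simp
  have sl: "smooth_on (dx l) UNIV" "smooth_on (dy l) UNIV"
    using smooth_on_dx_dy[OF open_UNIV l] by auto
  have first: "Lp v0 w = Lp v1 w * dx l (W t w) + Lp v2 w * dy l (W t w)"
    "Lq v0 w = Lq v1 w * dx l (W t w) + Lq v2 w * dy l (W t w)" if "w \<in> P" for w
  proof -
    have d: "((\<lambda>w. t0 + L v0 w) has_derivative (\<lambda>h. fst h * Lp v0 w + snd h * Lq v0 w)) (at w)"
      using has_derivative_add[OF has_derivative_const L_has_derivative[OF that]] by simp
    have e: "(\<lambda>h. (fst h * Lp v1 w + snd h * Lq v1 w) * dx l (W t w) + (fst h * Lp v2 w + snd h * Lq v2 w) * dy l (W t w))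
       = (\<lambda>h. fst h * Lp v0 w + snd h * Lq v0 w)"
      by (rule has_derivative_eq_on_open[OF open_P that eq chain[OF l that] d])
    show "Lp v0 w = Lp v1 w * dx l (W t w) + Lp v2 w * dy l (W t w)"
      "Lq v0 w = Lq v1 w * dx l (W t w) + Lq v2 w * dy l (W t w)"
      using fun_cong[OF e, of "(1, 0)"] fun_cong[OF e, of "(0, 1)"] by simp_all
  qed
  define w where "w = (a, b)"
  have w: "w \<in> P" using wP by (simp add: w_def)
  define lx ly lxx lxy lyx lyy where "lx = dx l (W t w)" and "ly = dy l (W t w)" and "lxx = dx (dx l) (W t w)"
    and "lxy = dy (dx l) (W t w)" and "lyx = dx (dy l) (W t w)" and "lyy = dy (dy l) (W t w)"
  note ls = this
  have ep: "(\<lambda>h. fst h * Lpp v0 w + snd h * Lpq v0 w) =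
     (\<lambda>h. (Lp v1 w * ((fst h * Lp v1 w + snd h * Lq v1 w) * lxx + (fst h * Lp v2 w + snd h * Lq v2 w) * lxy)
        + (fst h * Lpp v1 w + snd h * Lpq v1 w) * lx) +
      (Lp v2 w * ((fst h * Lp v1 w + snd h * Lq v1 w) * lyx + (fst h * Lp v2 w + snd h * Lq v2 w) * lyy)
        + (fst h * Lpp v2 w + snd h * Lpq v2 w) * ly))"
    unfolding ls
    by (rule has_derivative_eq_on_open[OF open_P w first(1) Lp_has_derivative[OF w]
          has_derivative_add[OF has_derivative_mult[OF Lp_has_derivative[OF w] chain[OF sl(1) w]]
            has_derivative_mult[OF Lp_has_derivative[OF w] chain[OF sl(2) w]]]])
  have eq': "(\<lambda>h. fst h * Lpq v0 w + snd h * Lqq v0 w) =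
     (\<lambda>h. (Lq v1 w * ((fst h * Lp v1 w + snd h * Lq v1 w) * lxx + (fst h * Lp v2 w + snd h * Lq v2 w) * lxy)
        + (fst h * Lpq v1 w + snd h * Lqq v1 w) * lx) +
      (Lq v2 w * ((fst h * Lp v1 w + snd h * Lq v1 w) * lyx + (fst h * Lp v2 w + snd h * Lq v2 w) * lyy)
        + (fst h * Lpq v2 w + snd h * Lqq v2 w) * ly))"
    unfolding ls
    by (rule has_derivative_eq_on_open[OF open_P w first(2) Lq_has_derivative[OF w]
          has_derivative_add[OF has_derivative_mult[OF Lq_has_derivative[OF w] chain[OF sl(1) w]]
            has_derivative_mult[OF Lq_has_derivative[OF w] chain[OF sl(2) w]]]])
  obtain k where k: "w \<noteq> 0 \<longrightarrow> k \<noteq> 0"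
    "(Lp v1 w)\<^sup>2 + (Lp v2 w)\<^sup>2 - (Lp v0 w)\<^sup>2 = k * (1 - b\<^sup>2)"
    "Lp v1 w * Lq v1 w + Lp v2 w * Lq v2 w - Lp v0 w * Lq v0 w = k * (a * b)"
    "(Lq v1 w)\<^sup>2 + (Lq v2 w)\<^sup>2 - (Lq v0 w)\<^sup>2 = k * (1 - a\<^sup>2)"
    "Lp v1 w * Lq v2 w - Lq v1 w * Lp v2 w \<noteq> 0"
    using fundamental_form[OF wP] unfolding w_def by metis
  have "Lp v0 w = lx * Lp v1 w + ly * Lp v2 w" "Lq v0 w = lx * Lq v1 w + ly * Lq v2 w"
    using first[OF w] by (simp_all add: ls mult.commute)
  moreover have "Lpp v0 w = (lxx * Lp v1 w + lxy * Lp v2 w) * Lp v1 w + (lyx * Lp v1 w + lyy * Lp v2 w) * Lp v2 w + lx * Lpp v1 w + ly * Lpp v2 w"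
    "Lpq v0 w = (lxx * Lq v1 w + lxy * Lq v2 w) * Lp v1 w + (lyx * Lq v1 w + lyy * Lq v2 w) * Lp v2 w + lx * Lpq v1 w + ly * Lpq v2 w"
    using fun_cong[OF ep, of "(1, 0)"] fun_cong[OF ep, of "(0, 1)"] by (simp_all add: algebra_simps)
  moreover have "Lpq v0 w = (lxx * Lp v1 w + lxy * Lp v2 w) * Lq v1 w + (lyx * Lp v1 w + lyy * Lp v2 w) * Lq v2 w + lx * Lpq v1 w + ly * Lpq v2 w"
    "Lqq v0 w = (lxx * Lq v1 w + lxy * Lq v2 w) * Lq v1 w + (lyx * Lq v1 w + lyy * Lq v2 w) * Lq v2 w + lx * Lqq v1 w + ly * Lqq v2 w"
    using fun_cong[OF eq', of "(1, 0)"] fun_cong[OF eq', of "(0, 1)"] by (simp_all add: algebra_simps)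
  moreover note k(5,2,3,4)
  moreover note sum_v[THEN L_pde[OF wP], folded w_def]
  ultimately have zmc: "(1 - ly\<^sup>2) * lxx + 2 * lx * ly * lxy + (1 - lx\<^sup>2) * lyy = 0"
    and mix: "(Lp v1 w * Lq v2 w - Lq v1 w * Lp v2 w)\<^sup>2 * (1 - (lx\<^sup>2 + ly\<^sup>2)) = k\<^sup>2 * (1 - (a\<^sup>2 + b\<^sup>2))"
    by (rule zmc_algebra)+
  from zmc show ?zmc
    unfolding ls w_def .
  show ?mixed if "(a, b) \<noteq> 0"
  proof (intro exI conjI)
    show "k\<^sup>2 / (Lp v1 w * Lq v2 w - Lq v1 w * Lp v2 w)\<^sup>2 > 0"
      using k(1,5) that by (simp add: w_def)
    show "1 - ((dx l (W t (a, b)))\<^sup>2 + (dy l (W t (a, b)))\<^sup>2)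
        = k\<^sup>2 / (Lp v1 w * Lq v2 w - Lq v1 w * Lp v2 w)\<^sup>2 * (1 - (a\<^sup>2 + b\<^sup>2))"
      using mix k(5) unfolding w_def[symmetric] ls[symmetric] by (simp add: field_simps)
  qed
qed

section \<open>Properness\<close>

text \<open>Cyclic successor, for coefficients indexed below \<open>2 * n\<close>; angles continue
  to use \<open>\<alpha> (j + 1)\<close>, which does not wrap around.\<close>

definition nxt :: "nat \<Rightarrow> nat" where "nxt j = (if j + 1 = 2 * n then 0 else j + 1)"

lemma nxt_less: "j < 2 * n \<Longrightarrow> nxt j < 2 * n"
  by (auto simp: nxt_def)

text \<open>The number of nodes is even, so the signs alternate across the wrap-around as
  well.\<close>

lemma nxt_odd: "odd (j + nxt j)"
  by (simp add: nxt_def) presburger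

lemma cos_nxt: "cos (t - \<alpha> (nxt j)) = cos (t - \<alpha> (j + 1))"
  by (simp add: nxt_def \<alpha>_0 \<alpha>_2n cos_diff)

lemma \<beta>_nxt: "cos (\<beta> (nxt j)) = cos (\<beta> (j + 1))" "sin (\<beta> (nxt j)) = sin (\<beta> (j + 1))"
proof -
  have 1: "cos (real (n - 1) * (2 * pi)) = 1" "sin (real (n - 1) * (2 * pi)) = 0"
    using cos_int_2pin[of "int (n - 1)"] sin_int_2pin[of "int (n - 1)"] by (simp_all add: mult_ac)
  show "cos (\<beta> (nxt j)) = cos (\<beta> (j + 1))" "sin (\<beta> (nxt j)) = sin (\<beta> (j + 1))"
    by (cases "j + 1 = 2 * n"; simp only: nxt_def \<beta>_def \<alpha>_0 \<alpha>_2n if_True if_False mult_zero_right cos_zero sin_zero 1 simp_thms)+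
qed

text \<open>A further node lies beyond one end of the sector in each direction around the circle, so
  \<open>cos_less_max\<close> applies.\<close>

lemma sector_gap_pointwise:
  assumes "j < 2 * n" "k < 2 * n" "k \<noteq> j" "k \<noteq> nxt j" "\<alpha> j \<le> t" "t \<le> \<alpha> (j + 1)"
  shows "cos (t - \<alpha> k) < max (cos (t - \<alpha> j)) (cos (t - \<alpha> (j + 1)))"
proof (cases "k < j")
  case True
  have "\<alpha> (j + 1) < \<alpha> k + 2 * pi"
  proof (cases "j + 1 = 2 * n")
    case True
    \<comment> \<open>In the last sector node 0 is the successor, hence excluded, and its copy at 2
      pi does not interfere.\<close>
    then have "k > 0" using assms(4) by (auto simp: nxt_def)
    then show ?thesis using True \<alpha>_2n \<alpha>_less[of 0 k] \<alpha>_0 assms(2) by auto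
  next
    case False
    then show ?thesis using assms(1,2) \<alpha>_less_2pi[of "j + 1"] \<alpha>_nonneg[of k] by auto
  qed
  then have "cos (t - \<alpha> k) < max (cos (t - \<alpha> j)) (cos (\<alpha> (j + 1) - t))"
    using \<alpha>_less[OF True] assms(1,5,6) by (intro cos_less_max) auto
  then show ?thesis
    using cos_minus[of "t - \<alpha> (j + 1)"] by simp
next
  case False
  then have "j + 1 < k" using assms(3,4,2) by (auto simp: nxt_def split: if_splits)
  then have "\<alpha> (j + 1) < \<alpha> k" using assms(2) by (intro \<alpha>_less) auto
  then have "cos (\<alpha> k - t) < max (cos (\<alpha> (j + 1) - t)) (cos (t - \<alpha> j))"
    using assms(1,2,5,6) \<alpha>_less_2pi[of k] \<alpha>_nonneg[of j] by (intro cos_less_max) auto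
  then show ?thesis
    using cos_minus[of "t - \<alpha> (j + 1)"] cos_minus[of "t - \<alpha> k"] by (simp add: max.commute)
qed

text \<open>Compactness of the sector and finiteness of the node set make the strict inequality
  uniform.\<close>

lemma sector_gap:
  assumes "j < 2 * n"
  obtains \<delta> where "\<delta> > 0" "\<And>t k. \<alpha> j \<le> t \<Longrightarrow> t \<le> \<alpha> (j + 1) \<Longrightarrow> k < 2 * n \<Longrightarrow> k \<noteq> j \<Longrightarrow> k \<noteq> nxt j \<Longrightarrow>
    cos (t - \<alpha> k) + \<delta> \<le> max (cos (t - \<alpha> j)) (cos (t - \<alpha> (j + 1)))"
proof -
  have "\<exists>\<delta>>0. \<forall>t\<in>{\<alpha> j..\<alpha> (j + 1)}. k < 2 * n \<longrightarrow> k \<noteq> j \<longrightarrow> k \<noteq> nxt j \<longrightarrow>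
      cos (t - \<alpha> k) + \<delta> \<le> max (cos (t - \<alpha> j)) (cos (t - \<alpha> (j + 1)))" for k
  proof (cases "k < 2 * n \<and> k \<noteq> j \<and> k \<noteq> nxt j")
    case True
    define \<phi> where "\<phi> t = max (cos (t - \<alpha> j)) (cos (t - \<alpha> (j + 1))) - cos (t - \<alpha> k)" for t
    have "continuous_on {\<alpha> j..\<alpha> (j + 1)} \<phi>"
      unfolding \<phi>_def by (intro continuous_intros)
    moreover have "{\<alpha> j..\<alpha> (j + 1)} \<noteq> {}"
      using \<alpha>_less_Suc[OF assms] by auto
    ultimately obtain t0 where t0: "t0 \<in> {\<alpha> j..\<alpha> (j + 1)}" "\<And>t. t \<in> {\<alpha> j..\<alpha> (j + 1)} \<Longrightarrow> \<phi> t0 \<le> \<phi> t"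
      using continuous_attains_inf[of "{\<alpha> j..\<alpha> (j + 1)}" \<phi>] by auto
    have "\<phi> t0 > 0"
      using sector_gap_pointwise[OF assms, of k t0] True t0(1) by (auto simp: \<phi>_def)
    moreover have "cos (t - \<alpha> k) + \<phi> t0 \<le> max (cos (t - \<alpha> j)) (cos (t - \<alpha> (j + 1)))" if "t \<in> {\<alpha> j..\<alpha> (j + 1)}" for t
      using t0(2)[OF that] unfolding \<phi>_def[of t] by linarith
    ultimately show ?thesis by blast
  qed (auto intro: exI[of _ 1])
  then obtain \<delta> where \<delta>: "\<And>k. \<delta> k > 0" "\<And>k t. t \<in> {\<alpha> j..\<alpha> (j + 1)} \<Longrightarrow> k < 2 * n \<Longrightarrow> k \<noteq> j \<Longrightarrow> k \<noteq> nxt j \<Longrightarrow>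
      cos (t - \<alpha> k) + \<delta> k \<le> max (cos (t - \<alpha> j)) (cos (t - \<alpha> (j + 1)))"
    by metis
  define \<delta>' where "\<delta>' = Min (\<delta> ` {..<2 * n})"
  have ne: "{..<2 * n} \<noteq> {}" using n_ge_2 by (auto simp: lessThan_empty_iff)
  show thesis
  proof (rule that)
    show "\<delta>' > 0" unfolding \<delta>'_def using \<delta>(1) ne by (subst Min_gr_iff) auto
    fix t k assume "\<alpha> j \<le> t" "t \<le> \<alpha> (j + 1)" "k < 2 * n" "k \<noteq> j" "k \<noteq> nxt j"
    moreover have "\<delta>' \<le> \<delta> k" unfolding \<delta>'_def using \<open>k < 2 * n\<close> by (intro Min_le) auto
    ultimately show "cos (t - \<alpha> k) + \<delta>' \<le> max (cos (t - \<alpha> j)) (cos (t - \<alpha> (j + 1)))"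
      using \<delta>(2)[of t k] by auto
  qed
qed

text \<open>A common factor of all arguments contributes its logarithm times the sum of the
  coefficients, which is 0.\<close>

lemma L_homogeneous:
  assumes "(\<Sum>j<2 * n. v j) = 0" "(a, b) \<in> P" "u > 0"
  shows "L v (a, b) = (\<Sum>j<2 * n. v j * ln (u * D j (a, b)))"
proof -
  have "(\<Sum>j<2 * n. v j * ln (u * D j (a, b))) = (\<Sum>j<2 * n. v j * ln u + v j * ln (D j (a, b)))"
  proof (intro sum.cong refl)
    fix j assume "j \<in> {..<2 * n}"
    then have "D j (a, b) > 0" using D_pos[OF assms(2), of j] by simp
    then show "v j * ln (u * D j (a, b)) = v j * ln u + v j * ln (D j (a, b))"
      using assms(3) by (simp add: ln_mult algebra_simps)
  qed
  also have "\<dots> = (\<Sum>j<2 * n. v j) * ln u + L v (a, b)"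
    by (simp add: sum.distrib L_def sum_distrib_right)
  finally show ?thesis using assms(1) by simp
qed

text \<open>
  Near the side of \<open>P\<close> facing the sector between \<open>\<alpha> j\<close> and \<open>\<alpha> (j + 1)\<close> only two logarithms can blow
  up. Their coefficient vectors make an angle less than \<open>pi\<close>, so a linear functional is positive on both.
\<close>

lemma W_sector_bound:
  assumes "j < 2 * n" "M \<ge> 0"
  obtains \<epsilon> where "\<epsilon> > 0" "\<And>r t k. 0 \<le> r \<Longrightarrow> \<alpha> j \<le> t \<Longrightarrow> t \<le> \<alpha> (j + 1) \<Longrightarrow> (r * cos t, r * sin t) \<in> P \<Longrightarrow>
    \<bar>L v1 (r * cos t, r * sin t)\<bar> \<le> M \<Longrightarrow> \<bar>L v2 (r * cos t, r * sin t)\<bar> \<le> M \<Longrightarrow> k < 2 * n \<Longrightarrow>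
    \<epsilon> \<le> D k (r * cos t, r * sin t) \<and> r \<le> 1 / \<epsilon>"
proof -
  define j' where "j' = nxt j"
  have j': "j' < 2 * n" "j' \<noteq> j"
    using nxt_less[OF assms(1)] nxt_odd[of j] by (auto simp: j'_def)
  obtain \<delta> where \<delta>: "\<delta> > 0" "\<And>t k. \<alpha> j \<le> t \<Longrightarrow> t \<le> \<alpha> (j + 1) \<Longrightarrow> k < 2 * n \<Longrightarrow> k \<noteq> j \<Longrightarrow> k \<noteq> j' \<Longrightarrow>
      cos (t - \<alpha> k) + \<delta> \<le> max (cos (t - \<alpha> j)) (cos (t - \<alpha> (j + 1)))"
    using sector_gap[OF assms(1)] unfolding j'_def by metis
  \<comment> \<open>The phase difference of the two neighbouring coefficients; the gap condition
    puts it in (0, pi].\<close>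
  define \<gamma> where "\<gamma> = \<beta> (j + 1) - \<beta> j"
  have \<gamma>: "0 < \<gamma>" "\<gamma> \<le> pi"
  proof -
    have "\<gamma> = real (n - 1) * (\<alpha> (j + 1) - \<alpha> j)" by (simp add: \<gamma>_def \<beta>_def algebra_simps)
    moreover have "\<alpha> (j + 1) - \<alpha> j \<le> pi / real (n - 1)" "0 < \<alpha> (j + 1) - \<alpha> j"
      using \<alpha>_gap[OF assms(1)] \<alpha>_less_Suc[OF assms(1)] n_ge_2 by (auto simp: of_nat_diff)
    moreover have "real (n - 1) > 0" using n_ge_2 by simp
    ultimately show "0 < \<gamma>" "\<gamma> \<le> pi"
      by (simp_all add: pos_le_divide_eq mult.commute)
  qed
  have cos\<gamma>: "cos \<gamma> < 1"
    using cos_monotone_0_pi[of 0 \<gamma>] \<gamma> by simp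
  define \<sigma> where "\<sigma> = sgn (c j)"
  \<comment> \<open>Up to sign, the difference of the unit vectors at the angles
    \<open>\<beta> j\<close> and \<open>\<beta> (j + 1)\<close>. As the residues have opposite
    signs, its inner product with either coefficient vector is the absolute residue times 1 - cos
    \<gamma>.\<close>
  define \<nu>1 \<nu>2 where "\<nu>1 = \<sigma> * (cos (\<beta> j) - cos (\<beta> (j + 1)))" and "\<nu>2 = \<sigma> * (sin (\<beta> j) - sin (\<beta> (j + 1)))"
  define s where "s k = \<nu>1 * v1 k + \<nu>2 * v2 k" for k
  have cc: "c j * c j' < 0"
    unfolding j'_def by (rule c_mult_neg[OF assms(1) nxt_less[OF assms(1)] nxt_odd])
  have "s j = \<sigma> * c j * (1 - cos \<gamma>)"
  proof -
    have "(sin (\<beta> j))\<^sup>2 = 1 - (cos (\<beta> j))\<^sup>2" by (simp add: sin_squared_eq)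
    then show ?thesis
      by (simp add: s_def \<nu>1_def \<nu>2_def v1_def v2_def \<gamma>_def cos_diff power2_eq_square algebra_simps)
        (simp add: algebra_simps flip: distrib_left)
  qed
  moreover have "\<sigma> * c j > 0"
    using cc by (auto simp: \<sigma>_def sgn_if)
  ultimately have sj: "s j > 0" using cos\<gamma> by simp
  have "s j' = \<sigma> * c j' * (cos \<gamma> - 1)"
  proof -
    have "(sin (\<beta> (j + 1)))\<^sup>2 = 1 - (cos (\<beta> (j + 1)))\<^sup>2" by (simp add: sin_squared_eq)
    then show ?thesis
      unfolding j'_def
      by (simp add: s_def \<nu>1_def \<nu>2_def v1_def v2_def \<gamma>_def cos_diff \<beta>_nxt[simplified] power2_eq_square algebra_simps)
        (simp add: algebra_simps flip: distrib_left)
  qed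
  moreover have "\<sigma> * c j' < 0"
    using cc by (auto simp: \<sigma>_def sgn_if mult_less_0_iff)
  ultimately have sj': "s j' > 0" using cos\<gamma> by (simp add: mult_neg_neg)
  define T where "T = (\<Sum>k<2 * n. \<bar>s k\<bar>)"
  \<comment> \<open>ln 3 is an upper bound for all logarithms, since \<open>e i\<close> will be at
    most 2 + 1; ln \<delta> is a lower bound for the nonadjacent ones.\<close>
  define B where "B = max (ln 3) (- ln \<delta>)"
  define Q where "Q = (\<bar>\<nu>1\<bar> + \<bar>\<nu>2\<bar>) * M + B * T"
  define R where "R = Q / s j + Q / s j' + B"
  have B0: "B \<ge> 0" by (simp add: B_def le_max_iff_disj)
  have T0: "T \<ge> 0" by (simp add: T_def sum_nonneg)
  have Q0: "Q \<ge> 0" using B0 T0 assms(2) by (simp add: Q_def)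
  have R: "R \<ge> B" "R \<ge> Q / s j" "R \<ge> Q / s j'" "R \<ge> 0"
    using B0 Q0 sj sj' by (auto simp: R_def)
  define \<eta> where "\<eta> = exp (- R)"
  have \<eta>: "\<eta> > 0" "\<eta> \<le> 1" using R(4) by (auto simp: \<eta>_def)
  show thesis
  proof (rule that[of "\<eta> / 2"])
    show "\<eta> / 2 > 0" using \<eta> by simp
    fix r t k
    assume r0: "0 \<le> r" and t: "\<alpha> j \<le> t" "t \<le> \<alpha> (j + 1)" and P: "(r * cos t, r * sin t) \<in> P"
      and M: "\<bar>L v1 (r * cos t, r * sin t)\<bar> \<le> M" "\<bar>L v2 (r * cos t, r * sin t)\<bar> \<le> M" and k: "k < 2 * n"
    show "\<eta> / 2 \<le> D k (r * cos t, r * sin t) \<and> r \<le> 1 / (\<eta> / 2)"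
    \<comment> \<open>Near the centre the bounds are immediate. Elsewhere u = 1 / r < 2, and
      multiplying back by r > 1 / 2 costs the factor 2 in \<open>\<eta> / 2\<close>.\<close>
    proof (cases "r \<le> 1 / 2")
      case True
      have "r * cos (t - \<alpha> k) \<le> r * 1"
        using r0 by (intro mult_left_mono) auto
      then have "D k (r * cos t, r * sin t) \<ge> 1 / 2"
        using True by (simp add: D_polar)
      moreover have "1 / (\<eta> / 2) \<ge> 1" using \<eta> by (simp add: field_simps)
      ultimately show ?thesis using True \<eta> by linarith
    next
      case False
      define u where "u = 1 / r"
      have u: "0 < u" "u < 2" using False by (auto simp: u_def field_simps)
      have ur: "u * r = 1" using False by (simp add: u_def)
      define e where "e i = u - cos (t - \<alpha> i)" for i
      have eD: "e i = u * D i (r * cos t, r * sin t)" for i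
        using ur by (simp add: e_def D_polar algebra_simps)
      have e_pos: "e i > 0" if "i \<le> 2 * n" for i
        unfolding eD using u(1) D_pos[OF P that] by simp
      have e_le: "ln (e i) \<le> B" if "i < 2 * n" for i
      proof -
        have "e i \<le> 3" using u cos_ge_minus_one[of "t - \<alpha> i"] unfolding e_def by linarith
        then have "ln (e i) \<le> ln 3" using e_pos[of i] that by (intro ln_mono) auto
        then show ?thesis by (simp add: B_def)
      qed
      have e_ge: "ln (e i) \<ge> - B" if "i < 2 * n" "i \<noteq> j" "i \<noteq> j'" for i
      proof -
        have "max (cos (t - \<alpha> j)) (cos (t - \<alpha> (j + 1))) < u"
          using e_pos[of j] e_pos[of "j + 1"] assms(1) by (simp add: e_def)
        then have "\<delta> \<le> e i"
          using \<delta>(2)[OF t that] unfolding e_def by linarith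
        then have "ln \<delta> \<le> ln (e i)" using \<delta>(1) by (intro ln_mono) auto
        then show ?thesis by (simp add: B_def)
      qed
      have sum: "(\<Sum>i<2 * n. s i * ln (e i)) = \<nu>1 * L v1 (r * cos t, r * sin t) + \<nu>2 * L v2 (r * cos t, r * sin t)"
        unfolding L_homogeneous[OF sum_v(2) P u(1)] L_homogeneous[OF sum_v(3) P u(1)] eD s_def
        by (simp add: sum_distrib_left sum.distrib[symmetric] algebra_simps)
      have "\<bar>\<nu>1 * L v1 (r * cos t, r * sin t)\<bar> \<le> \<bar>\<nu>1\<bar> * M" "\<bar>\<nu>2 * L v2 (r * cos t, r * sin t)\<bar> \<le> \<bar>\<nu>2\<bar> * M"
        using M by (auto simp: abs_mult intro: mult_left_mono)
      then have sum_ge: "(\<Sum>i<2 * n. s i * ln (e i)) \<ge> - ((\<bar>\<nu>1\<bar> + \<bar>\<nu>2\<bar>) * M)"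
        unfolding sum by (simp add: distrib_right)
      \<comment> \<open>The whole sum is bounded below and its other terms are bounded above, so
        this logarithm cannot tend to minus infinity.\<close>
      have main: "ln (e i) \<ge> - (Q / s i)" if i: "i = j \<or> i = j'" for i
      proof -
        have i2n: "i < 2 * n" and si: "s i > 0"
          using i j' assms(1) sj sj' by auto
        have "(\<Sum>l\<in>{..<2 * n} - {i}. s l * ln (e l)) \<le> (\<Sum>l\<in>{..<2 * n} - {i}. \<bar>s l\<bar> * B)"
        proof (rule sum_mono)
          fix l assume l: "l \<in> {..<2 * n} - {i}"
          show "s l * ln (e l) \<le> \<bar>s l\<bar> * B"
          proof (cases "l = j \<or> l = j'")
            case True
            then have "s l > 0" using sj sj' by auto
            then show ?thesis using e_le[of l] l by (simp add: mult_left_mono)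
          next
            case False
            then have "\<bar>ln (e l)\<bar> \<le> B" using e_le[of l] e_ge[of l] l by auto
            then have "\<bar>s l\<bar> * \<bar>ln (e l)\<bar> \<le> \<bar>s l\<bar> * B" by (intro mult_left_mono) auto
            then show ?thesis using abs_ge_self[of "s l * ln (e l)"] by (simp add: abs_mult)
          qed
        qed
        also have "\<dots> \<le> (\<Sum>l<2 * n. \<bar>s l\<bar> * B)"
          using B0 by (intro sum_mono2) auto
        also have "\<dots> = B * T" by (simp add: T_def sum_distrib_left mult.commute)
        finally have "(\<Sum>l\<in>{..<2 * n} - {i}. s l * ln (e l)) \<le> B * T" .
        moreover have "(\<Sum>l<2 * n. s l * ln (e l)) = s i * ln (e i) + (\<Sum>l\<in>{..<2 * n} - {i}. s l * ln (e l))"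
          using i2n by (intro sum.remove) auto
        ultimately have "s i * ln (e i) \<ge> - Q"
          using sum_ge unfolding Q_def by linarith
        then show ?thesis using si by (simp add: field_simps)
      qed
      have all: "e i \<ge> \<eta>" if "i < 2 * n" for i
      proof -
        have "ln (e i) \<ge> - R"
          using main[of i] e_ge[OF that] R by (cases "i = j \<or> i = j'") force+
        then have "exp (ln (e i)) \<ge> \<eta>" unfolding \<eta>_def by (simp only: exp_le_cancel_iff)
        then show ?thesis using e_pos[of i] that by simp
      qed
      \<comment> \<open>One end of the sector is within pi / 2 of \<open>t\<close>, where the cosine
        is nonnegative, so \<open>u\<close> is at least the corresponding \<open>e\<close>. This
        bounds r.\<close>
      have "u \<ge> \<eta>"
      proof -
        have "\<alpha> (j + 1) - \<alpha> j \<le> pi"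
        proof -
          have "pi / real (n - 1) \<le> pi" using n_ge_2 by (simp add: divide_le_eq)
          then show ?thesis using \<alpha>_gap[OF assms(1)] n_ge_2 by (simp add: of_nat_diff)
        qed
        then consider "t - \<alpha> j \<le> pi / 2" | "\<alpha> (j + 1) - t \<le> pi / 2" by linarith
        then show ?thesis
        proof cases
          case 1
          then have "cos (t - \<alpha> j) \<ge> 0" using t by (intro cos_ge_zero) auto
          then show ?thesis using all[OF assms(1)] by (simp add: e_def)
        next
          case 2
          then have "cos (\<alpha> (j + 1) - t) \<ge> 0" using t by (intro cos_ge_zero) auto
          then have "cos (t - \<alpha> j') \<ge> 0"
            unfolding j'_def cos_nxt using cos_minus[of "t - \<alpha> (j + 1)"] by simp
          then show ?thesis using all[OF j'(1)] by (simp add: e_def)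
        qed
      qed
      then have "r \<le> 1 / \<eta>"
        using False \<eta> by (simp add: u_def field_simps)
      moreover have "D k (r * cos t, r * sin t) = e k * r"
        unfolding eD using ur by simp
      moreover have "e k * r \<ge> \<eta> * (1 / 2)"
        using all[OF k] \<eta> False by (intro mult_mono) auto
      moreover have "1 / \<eta> \<le> 1 / (\<eta> / 2)" using \<eta> by (simp add: field_simps)
      ultimately show ?thesis by linarith
    qed
  qed
qed

text \<open>Taking the smallest of the sector bounds confines the preimage to a compact subset of
  the open polygon, in which it is closed.\<close>

lemma W_proper:
  assumes "compact A"
  shows "compact (P \<inter> W t -` A)"
proof -
  obtain M0 where M0: "\<And>q. q \<in> A \<Longrightarrow> norm q \<le> M0"
    using compact_imp_bounded[OF assms] by (auto simp: bounded_iff)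
  define M where "M = \<bar>M0\<bar> + norm t"
  have M: "M \<ge> 0" by (simp add: M_def)
  have LM: "\<bar>L v1 w\<bar> \<le> M" "\<bar>L v2 w\<bar> \<le> M" if "W t w \<in> A" for w
  proof -
    have "norm (W t w - t) \<le> M"
      using norm_triangle_ineq4[of "W t w" t] M0[OF that] unfolding M_def by linarith
    moreover have "W t w - t = (L v1 w, L v2 w)" by (simp add: W_def prod_eq_iff)
    ultimately show "\<bar>L v1 w\<bar> \<le> M" "\<bar>L v2 w\<bar> \<le> M"
      using norm_fst_le[of "L v1 w" "L v2 w"] norm_snd_le[of "L v2 w" "L v1 w"] by auto
  qed
  have "\<forall>j. \<exists>\<epsilon>>0. j < 2 * n \<longrightarrow> (\<forall>r s k. 0 \<le> r \<longrightarrow> \<alpha> j \<le> s \<longrightarrow> s \<le> \<alpha> (j + 1) \<longrightarrow> (r * cos s, r * sin s) \<in> P \<longrightarrow>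
    \<bar>L v1 (r * cos s, r * sin s)\<bar> \<le> M \<longrightarrow> \<bar>L v2 (r * cos s, r * sin s)\<bar> \<le> M \<longrightarrow> k < 2 * n \<longrightarrow>
    \<epsilon> \<le> D k (r * cos s, r * sin s) \<and> r \<le> 1 / \<epsilon>)"
  proof
    fix j
    show "\<exists>\<epsilon>>0. j < 2 * n \<longrightarrow> (\<forall>r s k. 0 \<le> r \<longrightarrow> \<alpha> j \<le> s \<longrightarrow> s \<le> \<alpha> (j + 1) \<longrightarrow> (r * cos s, r * sin s) \<in> P \<longrightarrow>
      \<bar>L v1 (r * cos s, r * sin s)\<bar> \<le> M \<longrightarrow> \<bar>L v2 (r * cos s, r * sin s)\<bar> \<le> M \<longrightarrow> k < 2 * n \<longrightarrow>
      \<epsilon> \<le> D k (r * cos s, r * sin s) \<and> r \<le> 1 / \<epsilon>)"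
    proof (cases "j < 2 * n")
      case True
      from W_sector_bound[OF True M] show ?thesis by metis
    qed (auto intro: exI[of _ 1])
  qed
  then obtain \<epsilon> where \<epsilon>: "\<And>j. \<epsilon> j > 0" "\<And>j r s k. j < 2 * n \<Longrightarrow> 0 \<le> r \<Longrightarrow> \<alpha> j \<le> s \<Longrightarrow> s \<le> \<alpha> (j + 1) \<Longrightarrow> (r * cos s, r * sin s) \<in> P \<Longrightarrow>
    \<bar>L v1 (r * cos s, r * sin s)\<bar> \<le> M \<Longrightarrow> \<bar>L v2 (r * cos s, r * sin s)\<bar> \<le> M \<Longrightarrow> k < 2 * n \<Longrightarrow>
    \<epsilon> j \<le> D k (r * cos s, r * sin s) \<and> r \<le> 1 / \<epsilon> j"
    by metis
  define e where "e = Min (\<epsilon> ` {..<2 * n})"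
  have ne: "{..<2 * n} \<noteq> {}" using n_ge_2 by (auto simp: lessThan_empty_iff)
  have e0: "e > 0" unfolding e_def using \<epsilon>(1) ne by (subst Min_gr_iff) auto
  define C where "C = cball 0 (1 / e) \<inter> (\<Inter>k\<in>{..<2 * n}. {w. e \<le> D k w})"
  have "closed {w. e \<le> D k w}" for k
    unfolding D_def by (intro closed_Collect_le continuous_intros)
  then have "compact C"
    unfolding C_def by (intro compact_Int_closed closed_INT) auto
  have "C \<subseteq> P"
    using e0 by (auto simp: C_def P_def intro: less_le_trans)
  have "P \<inter> W t -` A \<subseteq> C"
  proof
    fix w assume w: "w \<in> P \<inter> W t -` A"
    obtain r s where rs: "r \<ge> 0" "0 \<le> s" "s < 2 * pi" "w = (r * cos s, r * sin s)" "r = norm w"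
      by (rule polar_form)
    obtain j where j: "j < 2 * n" "\<alpha> j \<le> s" "s < \<alpha> (j + 1)"
      using \<alpha>_sector[OF rs(2,3)] .
    have "e \<le> \<epsilon> j" unfolding e_def using j by (intro Min_le) auto
    have *: "\<epsilon> j \<le> D k w \<and> r \<le> 1 / \<epsilon> j" if "k < 2 * n" for k
      using \<epsilon>(2)[OF j(1) rs(1) j(2) _ _ _ _ that] LM[of w] w j(3) unfolding rs(4)[symmetric] by auto
    have "1 / \<epsilon> j \<le> 1 / e" using \<open>e \<le> \<epsilon> j\<close> e0 by (intro divide_left_mono mult_pos_pos \<epsilon>(1)) auto
    moreover have "r \<le> 1 / \<epsilon> j" using *[of 0] n_ge_2 by auto
    ultimately show "w \<in> C"
      using * \<open>e \<le> \<epsilon> j\<close> unfolding C_def rs(5) by (auto intro: order_trans)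
  qed
  then have "P \<inter> W t -` A = C \<inter> W t -` A"
    using \<open>C \<subseteq> P\<close> by auto
  moreover have "closed (C \<inter> W t -` A)"
    using continuous_on_subset[OF smooth_on_imp_continuous_on[OF smooth_on_W] \<open>C \<subseteq> P\<close>]
      compact_imp_closed[OF \<open>compact C\<close>] compact_imp_closed[OF assms]
    by (rule continuous_closed_preimage)
  ultimately show ?thesis
    using \<open>compact C\<close> by (metis compact_Int_closed inf.left_idem)
qed

lemma W_bij: "bij_betw (W t) P UNIV"
proof (rule proper_local_homeomorphism_bij[OF open_P convex_connected[OF convex_P] _
      smooth_on_imp_continuous_on[OF smooth_on_W] _ W_proper])
  show "P \<noteq> {}" using zero_in_P by auto
  fix w assume w: "w \<in> P"
  obtain U V g where "open U" "U \<subseteq> P" "w \<in> U" "open V" "homeomorphism U V (W t) g"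
    using local_homeomorphism_smooth_inverse[OF open_P smooth_on_W jacobian_W_nonzero w] by metis
  then show "\<exists>U V g. open U \<and> U \<subseteq> P \<and> w \<in> U \<and> open V \<and> homeomorphism U V (W t) g"
    by blast
qed

end

section \<open>Real analytic continuation along a half-line\<close>

definition real_analytic_at :: "(real \<Rightarrow> real) \<Rightarrow> real \<Rightarrow> bool" where
  "real_analytic_at f a \<longleftrightarrow> (\<exists>e>0. \<exists>c. \<forall>x. \<bar>x - a\<bar> < e \<longrightarrow> (\<lambda>i. c i * (x - a) ^ i) sums f x)"

lemma real_analytic_at_diff:
  assumes "real_analytic_at f a" "real_analytic_at g a"
  shows "real_analytic_at (\<lambda>x. f x - g x) a"
proof -
  obtain e c where e: "e > 0" "\<And>x. \<bar>x - a\<bar> < e \<Longrightarrow> (\<lambda>i. c i * (x - a) ^ i) sums f x"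
    using assms(1) by (auto simp: real_analytic_at_def)
  obtain e' c' where e': "e' > 0" "\<And>x. \<bar>x - a\<bar> < e' \<Longrightarrow> (\<lambda>i. c' i * (x - a) ^ i) sums g x"
    using assms(2) by (auto simp: real_analytic_at_def)
  have "(\<lambda>i. (c i - c' i) * (x - a) ^ i) sums (f x - g x)" if "\<bar>x - a\<bar> < min e e'" for x
    using sums_diff[OF e(2) e'(2), of x] that by (simp add: left_diff_distrib)
  then show ?thesis
    unfolding real_analytic_at_def using e(1) e'(1)
    by (intro exI[of _ "min e e'"] conjI exI[of _ "\<lambda>i. c i - c' i"]) auto
qed

text \<open>Multiplying by \<open>x - s\<close> makes the function vanish at \<open>s\<close>, as \<open>powser_0_nonzero\<close> requires.\<close>

lemma real_analytic_eq_0_left: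
  assumes "real_analytic_at f s" "\<And>x. x > s \<Longrightarrow> f x = 0"
  obtains e where "e > 0" "\<And>x. \<bar>x - s\<bar> < e \<Longrightarrow> f x = 0"
proof -
  obtain e c where e: "e > 0" "\<And>x. \<bar>x - s\<bar> < e \<Longrightarrow> (\<lambda>i. c i * (x - s) ^ i) sums f x"
    using assms(1) by (auto simp: real_analytic_at_def)
  define b where "b i = (case i of 0 \<Rightarrow> 0 | Suc j \<Rightarrow> c j)" for i
  have sb: "(\<lambda>i. b i * (x - s) ^ i) sums ((x - s) * f x)" if "norm (x - s) < e" for x
  proof -
    have "(\<lambda>i. (x - s) * (c i * (x - s) ^ i)) sums ((x - s) * f x)"
      using that by (intro sums_mult e(2)) simp
    then have "(\<lambda>i. b (Suc i) * (x - s) ^ Suc i) sums ((x - s) * f x)"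
      by (simp add: b_def mult_ac)
    then show ?thesis
      by (subst (asm) sums_Suc_iff) (simp add: b_def)
  qed
  have c0: "c m = 0" for m
  proof (rule ccontr)
    assume "c m \<noteq> 0"
    then have "b (Suc m) \<noteq> 0" by (simp add: b_def)
    then obtain d where d: "0 < d" "\<And>z. z \<in> cball s d - {s} \<Longrightarrow> (z - s) * f z \<noteq> 0"
      using powser_0_nonzero[OF e(1) sb, of "Suc m"] by auto
    have "s + d \<in> cball s d - {s}" using d(1) by (auto simp: dist_real_def)
    then show False using d(2)[of "s + d"] assms(2)[of "s + d"] d(1) by simp
  qed
  have "f x = 0" if "\<bar>x - s\<bar> < e" for x
    using e(2)[OF that] c0 by (simp add: sums_unique2[OF _ sums_zero])
  then show thesis using that e(1) by blast
qed

text \<open>Let s be the infimum of the points beyond which f vanishes. If s exceeded m, the power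
  series at s would vanish too and push the zero set further left.\<close>

lemma real_analytic_eq_0:
  assumes "\<And>a. a > m \<Longrightarrow> real_analytic_at f a" "\<And>x. x > u0 \<Longrightarrow> f x = 0" "x1 > m"
  shows "f x1 = 0"
proof (rule ccontr)
  assume "f x1 \<noteq> 0"
  define A where "A = {a. a > m \<and> (\<forall>x>a. f x = 0)}"
  have low: "x1 \<le> a" if "a \<in> A" for a
    using that \<open>f x1 \<noteq> 0\<close> by (force simp: A_def)
  have "max u0 x1 \<in> A" using assms by (auto simp: A_def)
  then have ne: "A \<noteq> {}" by auto
  have bdd: "bdd_below A" using low by (auto simp: bdd_below_def)
  define s where "s = Inf A"
  have s: "x1 \<le> s" unfolding s_def using ne low by (intro cInf_greatest) auto
  have zero: "f x = 0" if "x > s" for x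
  proof -
    have "\<exists>a\<in>A. a < x"
      using that cInf_less_iff[OF ne bdd] unfolding s_def by blast
    then show ?thesis by (auto simp: A_def)
  qed
  obtain e where e: "e > 0" "\<And>x. \<bar>x - s\<bar> < e \<Longrightarrow> f x = 0"
    using real_analytic_eq_0_left[OF assms(1) zero, of s] s assms(3) by auto
  \<comment> \<open>The first entry stays within the radius of the power series at \<open>s\<close>,
    the second keeps \<open>a\<close> above \<open>m\<close>.\<close>
  define a where "a = max (s - e / 2) ((s + m) / 2)"
  have "(s + m) / 2 > m" "(s + m) / 2 < s" using s assms(3) by simp_all
  then have "a > m" "a < s" using e(1) by (auto simp: a_def less_max_iff_disj)
  moreover have "f x = 0" if "x > a" for x
  proof (cases "x > s")
    case False
    then have "\<bar>x - s\<bar> < e" using that e(1) by (auto simp: a_def)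
    then show ?thesis by (rule e(2))
  qed (rule zero)
  ultimately have "a \<in> A" by (auto simp: A_def)
  then have "s \<le> a" unfolding s_def using bdd by (intro cInf_lower)
  with \<open>a < s\<close> show False by simp
qed

text \<open>The real part of the Taylor series of the complex logarithms, on a ball reaching to the
  nearest singularity.\<close>

lemma real_analytic_at_ln_sum:
  assumes "finite I" "\<And>j. j \<in> I \<Longrightarrow> b j < u"
  shows "real_analytic_at (\<lambda>x. k + (\<Sum>j\<in>I. v j * ln (x - b j))) u"
proof -
  define e where "e = (if I = {} then 1 else u - Max (b ` I))"
  have e: "e > 0"
    using assms by (auto simp: e_def)
  have eb: "e \<le> u - b j" if "j \<in> I" for j
    using assms(1) that by (auto simp: e_def)
  define H where "H z = of_real k + (\<Sum>j\<in>I. of_real (v j) * Ln (z - of_real (b j)))" for z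
  have pos: "Re (z - of_real (b j)) > 0" if "j \<in> I" "z \<in> ball (of_real u) e" for z j
  proof -
    have "\<bar>Re (of_real u - z)\<bar> \<le> norm (of_real u - z)" by (rule abs_Re_le_cmod)
    then show ?thesis using that eb[of j] by (auto simp: dist_norm)
  qed
  have "H holomorphic_on ball (of_real u) e"
    unfolding H_def
  proof (intro holomorphic_intros)
    fix z j assume "z \<in> ball (complex_of_real u) e" "j \<in> I"
    with pos[of j z] show "z - complex_of_real (b j) \<notin> \<real>\<^sub>\<le>\<^sub>0"
      by (auto simp: complex_nonpos_Reals_iff)
  qed
  note ser = holomorphic_power_series[OF this]
  define c where "c i = Re ((deriv ^^ i) H (of_real u) / fact i)" for i
  have "(\<lambda>i. c i * (x - u) ^ i) sums (k + (\<Sum>j\<in>I. v j * ln (x - b j)))" if "\<bar>x - u\<bar> < e" for x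
  proof -
    have x: "complex_of_real x \<in> ball (of_real u) e"
    proof -
      have "dist (complex_of_real u) (of_real x) = \<bar>u - x\<bar>"
        by (metis dist_norm norm_of_real of_real_diff)
      then show ?thesis using that by simp
    qed
    have "(\<lambda>i. Re ((deriv ^^ i) H (of_real u) / fact i * (of_real x - of_real u) ^ i)) sums Re (H (of_real x))"
      by (intro sums_Re ser x)
    moreover have "Re ((deriv ^^ i) H (of_real u) / fact i * (of_real x - of_real u) ^ i) = c i * (x - u) ^ i" for i
    proof -
      have "(complex_of_real x - of_real u) ^ i = of_real ((x - u) ^ i)" by simp
      then show ?thesis
        unfolding c_def by (simp only: times_complex.sel Re_complex_of_real Im_complex_of_real)
    qed
    moreover have "Re (H (of_real x)) = k + (\<Sum>j\<in>I. v j * ln (x - b j))"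
    proof -
      have "Re (Ln (of_real x - of_real (b j))) = ln (x - b j)" if "j \<in> I" for j
      proof -
        have "x - b j > 0" using pos[OF that x] by simp
        then show ?thesis by (simp flip: of_real_diff add: Ln_of_real)
      qed
      then show ?thesis by (simp add: H_def)
    qed
    ultimately show ?thesis by simp
  qed
  then show ?thesis unfolding real_analytic_at_def using e by blast
qed

text \<open>On the line y = b only the terms with second exponent 0 survive. The linear map selects
  a real component.\<close>

lemma real_analytic_on_imp_real_analytic_at:
  assumes "real_analytic_on F S" "(a, b) \<in> S" "bounded_linear l"
  shows "real_analytic_at (\<lambda>x. l (F (x, b))) a"
proof -
  interpret l: bounded_linear l by fact
  obtain e and c :: "nat \<Rightarrow> nat \<Rightarrow> 'a" where e: "e > 0" "\<And>x y. (x, y) \<in> ball (a, b) e \<Longrightarrow>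
      ((\<lambda>(i, j). ((x - a) ^ i * (y - b) ^ j) *\<^sub>R c i j) has_sum F (x, y)) UNIV"
    using assms(1,2) unfolding real_analytic_on_def by fast
  have "(\<lambda>i. l (c i 0) * (x - a) ^ i) sums l (F (x, b))" if "\<bar>x - a\<bar> < e" for x
  proof -
    have "(x, b) \<in> ball (a, b) e"
      using that by (simp add: dist_Pair_Pair dist_real_def abs_minus_commute)
    then have "((\<lambda>(i, j). ((x - a) ^ i * (b - b) ^ j) *\<^sub>R c i j) has_sum F (x, b)) UNIV"
      by (rule e(2))
    then have "((\<lambda>(i, j). ((x - a) ^ i * (b - b) ^ j) *\<^sub>R c i j) has_sum F (x, b)) (range (\<lambda>i. (i, 0)))"
      by (subst has_sum_cong_neutral[where T = UNIV]) (auto simp: power_0_left image_iff)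
    then have "((\<lambda>i. (x - a) ^ i *\<^sub>R c i 0) has_sum F (x, b)) UNIV"
      by (subst (asm) has_sum_reindex) (auto simp: inj_on_def o_def)
    then have "(\<lambda>i. (x - a) ^ i *\<^sub>R c i 0) sums F (x, b)"
      by (rule has_sum_imp_sums)
    from l.sums[OF this] show ?thesis
      by (simp add: l.scaleR mult.commute)
  qed
  then show ?thesis
    unfolding real_analytic_at_def using e(1)
    by (intro exI[of _ e] conjI exI[of _ "\<lambda>i. l (c i 0)"]) auto
qed

context kobayashi
begin

section \<open>The surface over the unit disk\<close>

definition X :: "real \<times> real \<Rightarrow> real \<times> real \<times> real" where
  "X w = (L v0 w, L v1 w, L v2 w)"

definition disk_to_klein :: "real \<times> real \<Rightarrow> real \<times> real" where
  "disk_to_klein z = (2 * fst z / (1 + (fst z)\<^sup>2 + (snd z)\<^sup>2), 2 * snd z / (1 + (fst z)\<^sup>2 + (snd z)\<^sup>2))"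

text \<open>Passes from the disk to the Klein model: the factor 1 + |z|^2 is common to all nodes, so
  \<open>L_homogeneous\<close> removes it.\<close>

lemma norm_one_minus_node:
  "(norm (1 - z * cnj (\<zeta> j)))\<^sup>2 = (1 + (norm z)\<^sup>2) * D j (disk_to_klein (Re z, Im z))"
proof -
  define x y s where "x = Re z" and "y = Im z" and "s = 1 + x\<^sup>2 + y\<^sup>2"
  have s: "s > 0" by (simp add: s_def add_pos_nonneg)
  have sc: "(cos (\<alpha> j))\<^sup>2 = 1 - (sin (\<alpha> j))\<^sup>2" by (simp add: cos_squared_eq)
  have "(norm (1 - z * cnj (\<zeta> j)))\<^sup>2 = (1 - (x * cos (\<alpha> j) + y * sin (\<alpha> j)))\<^sup>2 + (y * cos (\<alpha> j) - x * sin (\<alpha> j))\<^sup>2"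
    unfolding cmod_power2 by (simp add: \<zeta>_def x_def y_def power2_eq_square algebra_simps)
  also have "\<dots> = s - 2 * (x * cos (\<alpha> j) + y * sin (\<alpha> j))"
    using sc unfolding s_def by algebra
  also have "\<dots> = s * D j (disk_to_klein (Re z, Im z))"
    using s by (simp add: D_def disk_to_klein_def flip: x_def y_def s_def) (simp add: field_simps)
  also have "s = 1 + (norm z)\<^sup>2"
    by (simp add: s_def cmod_power2 x_def y_def)
  finally show ?thesis .
qed

text \<open>The same polygon as \<open>P\<close>, now in the coordinate z. It is convex and keeps
  every \<open>1 - z * cnj (\<zeta> j)\<close> in the right half-plane, where the principal
  logarithm is holomorphic.\<close>

definition T :: "complex set" where "T = {z. \<forall>j<2 * n. Re (z * cnj (\<zeta> j)) < 1}"

lemma nodes_eq: "nodes n \<alpha> = \<zeta> ` {..<2 * n}"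
  by (auto simp: nodes_def \<zeta>_def)

lemma disk_subset_T: "cball 0 1 - nodes n \<alpha> \<subseteq> T"
proof
  fix z assume z: "z \<in> cball 0 1 - nodes n \<alpha>"
  show "z \<in> T" unfolding T_def
  proof (intro CollectI allI impI)
    fix j assume j: "j < 2 * n"
    define y where "y = z * cnj (\<zeta> j)"
    have ny: "norm y \<le> 1" using z by (simp add: y_def norm_mult)
    have "z = y * \<zeta> j"
      using complex_norm_square[of "\<zeta> j"] by (simp add: y_def mult.assoc mult.commute[of "cnj _"])
    then have "y \<noteq> 1" using z j by (auto simp: nodes_eq)
    have "Re y \<noteq> 1"
    proof
      assume "Re y = 1"
      moreover have "(norm y)\<^sup>2 \<le> 1" using ny by (simp add: power_le_one)
      ultimately have "Im y = 0" by (simp add: cmod_power2)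
      with \<open>Re y = 1\<close> \<open>y \<noteq> 1\<close> show False by (simp add: complex_eq_iff)
    qed
    then show "Re (z * cnj (\<zeta> j)) < 1"
      using complex_Re_le_cmod[of y] ny unfolding y_def by linarith
  qed
qed

lemma T_disjoint_nodes: "T \<subseteq> - nodes n \<alpha>"
proof
  fix z assume z: "z \<in> T"
  have "\<zeta> j * cnj (\<zeta> j) = 1" for j using complex_norm_square[of "\<zeta> j"] by simp
  then have "Re (\<zeta> j * cnj (\<zeta> j)) = 1" for j by simp
  then have "\<zeta> j \<notin> T" if "j < 2 * n" for j
    using that unfolding T_def by (metis (mono_tags, lifting) less_irrefl mem_Collect_eq)
  with z show "z \<in> - nodes n \<alpha>" by (auto simp: nodes_eq)
qed

lemma convex_T: "convex T"
proof -
  have "T = (\<Inter>j\<in>{..<2 * n}. {z. \<zeta> j \<bullet> z < 1})"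
    by (auto simp: T_def inner_complex_def algebra_simps)
  then show ?thesis by (simp add: convex_INT convex_halfspace_lt)
qed

text \<open>The primitive vanishing at 0 is a sum of logarithms of
  \<open>1 - z * cnj (\<zeta> j)\<close>; with real coefficients its real part is a sum of ln
  |.|^2.\<close>

lemma integral_forms:
  assumes z: "z \<in> T"
    and form: "\<And>z. z \<notin> nodes n \<alpha> \<Longrightarrow> \<phi> z = (\<Sum>j<2 * n. 2 * of_real (v j) / (z - \<zeta> j))"
    and v: "(\<Sum>j<2 * n. v j) = 0"
  shows "Re (contour_integral (linepath 0 z) \<phi>) = L v (disk_to_klein (Re z, Im z))"
    and "disk_to_klein (Re z, Im z) \<in> P"
proof -
  define H where "H z = (\<Sum>j<2 * n. 2 * of_real (v j) * Ln (1 - z * cnj (\<zeta> j)))" for z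
  have nz: "\<zeta> j * cnj (\<zeta> j) = 1" for j using complex_norm_square[of "\<zeta> j"] by simp
  have pos: "Re (1 - z * cnj (\<zeta> j)) > 0" if "z \<in> T" "j < 2 * n" for z j
    using that by (auto simp: T_def)
  have nz1: "1 - z * cnj (\<zeta> j) \<noteq> 0" if "z \<in> T" "j < 2 * n" for z j
  proof
    assume "1 - z * cnj (\<zeta> j) = 0"
    then show False using pos[OF that] by (simp only: zero_complex.sel)
  qed
  have deriv: "(H has_field_derivative \<phi> x) (at x within T)" if x: "x \<in> T" for x
  proof -
    have "(H has_field_derivative (\<Sum>j<2 * n. 2 * of_real (v j) * (- cnj (\<zeta> j) / (1 - x * cnj (\<zeta> j))))) (at x within T)"
      unfolding H_def
    proof (intro DERIV_sum DERIV_cmult)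
      fix j assume "j \<in> {..<2 * n}"
      then have "1 - x * cnj (\<zeta> j) \<notin> \<real>\<^sub>\<le>\<^sub>0"
        using pos[OF x, of j] by (auto simp: complex_nonpos_Reals_iff)
      moreover have "((\<lambda>x. 1 - x * cnj (\<zeta> j)) has_field_derivative - cnj (\<zeta> j)) (at x within T)"
        by (auto intro!: derivative_eq_intros)
      ultimately show "((\<lambda>x. Ln (1 - x * cnj (\<zeta> j))) has_field_derivative - cnj (\<zeta> j) / (1 - x * cnj (\<zeta> j))) (at x within T)"
        using has_field_derivative_Ln[THEN DERIV_chain2] by (fastforce simp: divide_inverse mult.commute)
    qed
    moreover have "(\<Sum>j<2 * n. 2 * of_real (v j) * (- cnj (\<zeta> j) / (1 - x * cnj (\<zeta> j)))) = \<phi> x"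
    proof -
      have "x \<notin> nodes n \<alpha>" using x T_disjoint_nodes by auto
      moreover have "- cnj (\<zeta> j) / (1 - x * cnj (\<zeta> j)) = 1 / (x - \<zeta> j)" if "j < 2 * n" for j
      proof -
        have "x - \<zeta> j \<noteq> 0" using \<open>x \<notin> nodes n \<alpha>\<close> that by (auto simp: nodes_eq)
        moreover have "1 - x * cnj (\<zeta> j) \<noteq> 0" using nz1[OF x that] .
        moreover have "- cnj (\<zeta> j) * (x - \<zeta> j) = 1 - x * cnj (\<zeta> j)"
          using nz[of j] by (simp add: algebra_simps)
        ultimately show ?thesis by (simp only: frac_eq_eq mult_1_left not_False_eq_True)
      qed
      ultimately show ?thesis by (simp add: form)
    qed
    ultimately show ?thesis by simp
  qed
  have "0 \<in> T" by (simp add: T_def)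
  then have "path_image (linepath 0 z) \<subseteq> T"
    using z convex_T by (simp add: closed_segment_subset)
  then have "(\<phi> has_contour_integral H z - H 0) (linepath 0 z)"
    using contour_integral_primitive[OF deriv, where g = "linepath 0 z"] by simp
  then have ci: "contour_integral (linepath 0 z) \<phi> = H z"
    by (simp add: contour_integral_unique H_def)
  have n0: "1 + (norm z)\<^sup>2 > 0" by (simp add: add_pos_nonneg)
  have sq: "(norm (1 - z * cnj (\<zeta> j)))\<^sup>2 > 0" if "j < 2 * n" for j
    using nz1[OF z that] by simp
  show P: "disk_to_klein (Re z, Im z) \<in> P"
    unfolding P_def using sq n0 unfolding norm_one_minus_node by (auto simp: zero_less_mult_iff)
  have "Re (H z) = (\<Sum>j<2 * n. v j * ln ((norm (1 - z * cnj (\<zeta> j)))\<^sup>2))"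
    unfolding H_def Re_sum
  proof (intro sum.cong refl)
    fix j assume "j \<in> {..<2 * n}"
    then have "1 - z * cnj (\<zeta> j) \<noteq> 0" using nz1[OF z, of j] by auto
    then show "Re (2 * of_real (v j) * Ln (1 - z * cnj (\<zeta> j))) = v j * ln ((norm (1 - z * cnj (\<zeta> j)))\<^sup>2)"
      by (simp add: ln_realpow)
  qed
  also have "\<dots> = L v (disk_to_klein (Re z, Im z))"
    unfolding norm_one_minus_node
    using L_homogeneous[OF v, of "fst (disk_to_klein (Re z, Im z))" "snd (disk_to_klein (Re z, Im z))", OF _ n0] P
    by simp
  finally show "Re (contour_integral (linepath 0 z) \<phi>) = L v (disk_to_klein (Re z, Im z))"
    by (simp add: ci)
qed

lemma forms_partial_fractions:
  assumes "z \<notin> nodes n \<alpha>"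
  shows "- 2 * kobayashi_g n z * kobayashi_h n \<alpha> z = (\<Sum>j<2 * n. 2 * of_real (v0 j) / (z - \<zeta> j))"
    "(1 + (kobayashi_g n z)\<^sup>2) * kobayashi_h n \<alpha> z = (\<Sum>j<2 * n. 2 * of_real (v1 j) / (z - \<zeta> j))"
    "\<i> * (1 - (kobayashi_g n z)\<^sup>2) * kobayashi_h n \<alpha> z = (\<Sum>j<2 * n. 2 * of_real (v2 j) / (z - \<zeta> j))"
proof -
  have h: "kobayashi_h n \<alpha> z = K * (1 / (\<Prod>j<2 * n. z - \<zeta> j))"
    by (simp add: kobayashi_h_def K_def \<zeta>_def)
  have lag: "z ^ k / (\<Prod>j<2 * n. z - \<zeta> j) = (\<Sum>j<2 * n. \<zeta> j ^ k / \<zeta>_prod j / (z - \<zeta> j))" if "k < 2 * n" for k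
    unfolding \<zeta>_prod_def using assms that by (subst lagrange_power[OF _ inj_on_\<zeta>]) (auto simp: nodes_eq)
  have g1: "kobayashi_g n z * kobayashi_h n \<alpha> z = (\<Sum>j<2 * n. of_real (c j) / (z - \<zeta> j))"
  proof -
    have "kobayashi_g n z * kobayashi_h n \<alpha> z = K * (z ^ (n - 1) / (\<Prod>j<2 * n. z - \<zeta> j))"
      by (simp add: h kobayashi_g_def)
    also have "\<dots> = (\<Sum>j<2 * n. of_real (c j) / (z - \<zeta> j))"
      using n_ge_2 by (subst lag) (auto simp: sum_distrib_left of_real_c)
    finally show ?thesis .
  qed
  have h1: "kobayashi_h n \<alpha> z = (\<Sum>j<2 * n. of_real (c j) * cis (- \<beta> j) / (z - \<zeta> j))"
    unfolding h using lag[of 0] n_ge_2 by (simp add: sum_distrib_left K_\<zeta>(1)[symmetric])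
  have g2: "(kobayashi_g n z)\<^sup>2 * kobayashi_h n \<alpha> z = (\<Sum>j<2 * n. of_real (c j) * cis (\<beta> j) / (z - \<zeta> j))"
  proof -
    have "2 * n - 2 = (n - 1) * 2" by simp
    then have "(kobayashi_g n z)\<^sup>2 = z ^ (2 * n - 2)"
      by (simp only: kobayashi_g_def power_mult)
    then have "(kobayashi_g n z)\<^sup>2 * kobayashi_h n \<alpha> z = K * (z ^ (2 * n - 2) / (\<Prod>j<2 * n. z - \<zeta> j))"
      by (simp add: h)
    also have "\<dots> = (\<Sum>j<2 * n. of_real (c j) * cis (\<beta> j) / (z - \<zeta> j))"
      using n_ge_2 by (subst lag) (auto simp: sum_distrib_left K_\<zeta>(2)[symmetric])
    finally show ?thesis .
  qed
  have "- 2 * kobayashi_g n z * kobayashi_h n \<alpha> z = - 2 * (kobayashi_g n z * kobayashi_h n \<alpha> z)" by simp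
  also have "\<dots> = (\<Sum>j<2 * n. 2 * of_real (v0 j) / (z - \<zeta> j))"
    unfolding g1 sum_distrib_left by (intro sum.cong refl) (simp add: v0_def)
  finally show "- 2 * kobayashi_g n z * kobayashi_h n \<alpha> z = (\<Sum>j<2 * n. 2 * of_real (v0 j) / (z - \<zeta> j))" .
  have cc: "cis (- b) + cis b = 2 * of_real (cos b)" "\<i> * (cis (- b) - cis b) = 2 * of_real (sin b)" for b
    by (simp_all add: complex_eq_iff)
  have "(1 + (kobayashi_g n z)\<^sup>2) * kobayashi_h n \<alpha> z = kobayashi_h n \<alpha> z + (kobayashi_g n z)\<^sup>2 * kobayashi_h n \<alpha> z"
    by (simp add: algebra_simps)
  also have "\<dots> = (\<Sum>j<2 * n. of_real (c j) * (cis (- \<beta> j) + cis (\<beta> j)) / (z - \<zeta> j))"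
    unfolding g2 unfolding h1 sum.distrib[symmetric] by (simp add: distrib_left add_divide_distrib)
  also have "\<dots> = (\<Sum>j<2 * n. 2 * of_real (v1 j) / (z - \<zeta> j))"
    unfolding cc by (simp add: v1_def mult_ac)
  finally show "(1 + (kobayashi_g n z)\<^sup>2) * kobayashi_h n \<alpha> z = (\<Sum>j<2 * n. 2 * of_real (v1 j) / (z - \<zeta> j))" .
  have "\<i> * (1 - (kobayashi_g n z)\<^sup>2) * kobayashi_h n \<alpha> z = \<i> * (kobayashi_h n \<alpha> z - (kobayashi_g n z)\<^sup>2 * kobayashi_h n \<alpha> z)"
    by (simp add: algebra_simps)
  also have "\<dots> = (\<Sum>j<2 * n. of_real (c j) * (\<i> * (cis (- \<beta> j) - cis (\<beta> j))) / (z - \<zeta> j))"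
    unfolding g2 unfolding h1 sum_subtractf[symmetric] sum_distrib_left
    by (intro sum.cong refl) (simp add: right_diff_distrib diff_divide_distrib mult_ac)
  also have "\<dots> = (\<Sum>j<2 * n. 2 * of_real (v2 j) / (z - \<zeta> j))"
    unfolding cc by (simp add: v2_def mult_ac)
  finally show "\<i> * (1 - (kobayashi_g n z)\<^sup>2) * kobayashi_h n \<alpha> z = (\<Sum>j<2 * n. 2 * of_real (v2 j) / (z - \<zeta> j))" .
qed

lemma surface_on_disk:
  assumes "kobayashi_surface n \<alpha> f" "z \<in> cball 0 1 - nodes n \<alpha>"
  shows "f (Some z) = f (Some 0) + X (disk_to_klein (Re z, Im z))"
proof -
  have z: "z \<in> T" using disk_subset_T assms(2) by auto
  have "0 \<in> T" by (simp add: T_def)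
  then have "path_image (linepath 0 z) \<subseteq> T"
    using z convex_T by (simp add: closed_segment_subset)
  then have "path_image (linepath 0 z) \<subseteq> - nodes n \<alpha>"
    using T_disjoint_nodes by auto
  then have "f (Some z) - f (Some 0) =
      (Re (contour_integral (linepath 0 z) (\<lambda>z. - 2 * kobayashi_g n z * kobayashi_h n \<alpha> z)),
       Re (contour_integral (linepath 0 z) (\<lambda>z. (1 + (kobayashi_g n z)\<^sup>2) * kobayashi_h n \<alpha> z)),
       Re (contour_integral (linepath 0 z) (\<lambda>z. \<i> * (1 - (kobayashi_g n z)\<^sup>2) * kobayashi_h n \<alpha> z)))"
    using assms(1)[unfolded kobayashi_surface_def maxface_on_def, THEN conjunct1, rule_format, of "linepath 0 z"] by simp
  also have "\<dots> = X (disk_to_klein (Re z, Im z))"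
    using integral_forms(1)[OF z forms_partial_fractions(1) sum_v(1)]
      integral_forms(1)[OF z forms_partial_fractions(2) sum_v(2)]
      integral_forms(1)[OF z forms_partial_fractions(3) sum_v(3)]
    by (simp add: X_def)
  finally show ?thesis by (simp add: algebra_simps)
qed

section \<open>The analytic extension in the Klein model\<close>

definition polar_to_klein :: "real \<times> real \<Rightarrow> real \<times> real" where
  "polar_to_klein x = (cos (snd x) / fst x, sin (snd x) / fst x)"

lemma mem_polar_dom: "(u, \<theta>) \<in> polar_dom n \<alpha> \<longleftrightarrow> (\<forall>j<2 * n. cos (\<theta> - \<alpha> j) < u)"
proof -
  have "{..<2 * n} \<noteq> {}" using n_ge_2 by (auto simp: lessThan_empty_iff)
  then show ?thesis by (auto simp: polar_dom_def)
qed

text \<open>Gaps of at most pi leave a node within pi / 2 of every direction, so the largest cosine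
  is nonnegative and division by \<open>u\<close> is legitimate.\<close>

lemma polar_dom_pos:
  assumes "(u, \<theta>) \<in> polar_dom n \<alpha>"
  shows "u > 0"
proof -
  obtain r t where t: "0 \<le> t" "t < 2 * pi" "(cos \<theta>, sin \<theta>) = (r * cos t, r * sin t)" "r = norm (cos \<theta>, sin \<theta>)"
    by (rule polar_form[of "(cos \<theta>, sin \<theta>)"])
  have "r = 1" using t(4) by (simp add: norm_prod_def)
  with t(3) have ct: "cos (\<theta> - a) = cos (t - a)" for a by (simp add: cos_diff)
  obtain j where j: "j < 2 * n" "\<alpha> j \<le> t" "t < \<alpha> (j + 1)"
    using \<alpha>_sector[OF t(1,2)] .
  have "pi / real (n - 1) \<le> pi" using n_ge_2 by (simp add: divide_le_eq)
  then have "\<alpha> (j + 1) - \<alpha> j \<le> pi" using \<alpha>_gap[OF j(1)] n_ge_2 by (simp add: of_nat_diff)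
  then consider "t - \<alpha> j \<le> pi / 2" | "\<alpha> (j + 1) - t \<le> pi / 2" by linarith
  then show ?thesis
  proof cases
    case 1
    then have "cos (t - \<alpha> j) \<ge> 0" using j by (intro cos_ge_zero) auto
    then show ?thesis using assms j(1) ct unfolding mem_polar_dom by force
  next
    case 2
    then have "cos (\<alpha> (j + 1) - t) \<ge> 0" using j by (intro cos_ge_zero) auto
    then have "cos (t - \<alpha> (nxt j)) \<ge> 0"
      unfolding cos_nxt using cos_minus[of "t - \<alpha> (j + 1)"] by simp
    then show ?thesis using assms nxt_less[OF j(1)] ct unfolding mem_polar_dom by force
  qed
qed

lemma D_polar_to_klein: "u \<noteq> 0 \<Longrightarrow> u * D j (polar_to_klein (u, \<theta>)) = u - cos (\<theta> - \<alpha> j)"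
  by (simp add: D_def polar_to_klein_def cos_diff field_simps)

lemma polar_to_klein_in_P:
  assumes "(u, \<theta>) \<in> polar_dom n \<alpha>"
  shows "polar_to_klein (u, \<theta>) \<in> P"
proof -
  have u: "u > 0" by (rule polar_dom_pos[OF assms])
  have "u * D j (polar_to_klein (u, \<theta>)) > 0" if "j < 2 * n" for j
    using assms that u unfolding mem_polar_dom by (simp add: D_polar_to_klein)
  then show ?thesis using u by (simp add: P_def zero_less_mult_iff)
qed

text \<open>r is the smaller root of r^2 - 2 u r + 1; the other root is its inverse.\<close>

lemma iota_polar:
  assumes "u > 1"
  obtains r where "0 < r" "r < 1" "iota (of_real r * cis \<theta>) = Pt u (cis \<theta>)" "1 + r\<^sup>2 = 2 * r * u"
proof
  define s where "s = sqrt (u\<^sup>2 - 1)"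
  have "u\<^sup>2 > 1" using assms by (simp add: one_less_power)
  then have s: "s > 0" "s\<^sup>2 = u\<^sup>2 - 1" by (simp_all add: s_def)
  have "s < u" using assms s by (intro power2_less_imp_less[of s u]) auto
  define r where "r = u - s"
  have ri: "r * (u + s) = 1" using s(2) by (simp add: r_def power2_eq_square algebra_simps)
  show r: "0 < r" using \<open>s < u\<close> by (simp add: r_def)
  have inv: "inverse r = u + s" using ri r by (simp add: field_simps)
  show "r < 1"
  proof (rule ccontr)
    assume "\<not> r < 1"
    then have "1 * 1 < r * (u + s)" using assms s by (intro mult_le_less_imp_less) auto
    with ri show False by simp
  qed
  have "norm (of_real r * cis \<theta>) = r" using r by (simp add: norm_mult)
  moreover have "sgn (of_real r * cis \<theta>) = cis \<theta>" using r by (simp add: sgn_eq norm_mult)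
  ultimately show "iota (of_real r * cis \<theta>) = Pt u (cis \<theta>)"
    using r by (simp add: iota_def inv) (simp add: r_def)
  show "1 + r\<^sup>2 = 2 * r * u"
    using ri by (simp add: power2_eq_square algebra_simps r_def)
qed

text \<open>For u > 1 the point comes from the open disk, and 1 + r^2 = 2 r u identifies the two
  expressions for w.\<close>

lemma extension_polar_1:
  assumes "kobayashi_surface n \<alpha> f" "analytic_extension n \<alpha> f F" "u > 1"
  shows "F (Pt u (cis \<theta>)) = f (Some 0) + X (polar_to_klein (u, \<theta>))"
proof -
  obtain r where r: "0 < r" "r < 1" "iota (of_real r * cis \<theta>) = Pt u (cis \<theta>)" "1 + r\<^sup>2 = 2 * r * u"
    by (rule iota_polar[OF assms(3)])
  define z where "z = of_real r * cis \<theta>"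
  have "norm z = r" using r by (simp add: z_def norm_mult)
  then have z: "z \<in> cball 0 1 - nodes n \<alpha>" using r by (auto simp: nodes_eq)
  have "F (Pt u (cis \<theta>)) = f (Some z)"
    using assms(2) z r(3) unfolding analytic_extension_def z_def by metis
  also have "\<dots> = f (Some 0) + X (disk_to_klein (Re z, Im z))"
    by (rule surface_on_disk[OF assms(1) z])
  also have "disk_to_klein (Re z, Im z) = polar_to_klein (u, \<theta>)"
  proof -
    have "1 + (Re z)\<^sup>2 + (Im z)\<^sup>2 = 2 * r * u"
      using r(4) \<open>norm z = r\<close> cmod_power2[of z] by simp
    then show ?thesis
      using r(1) assms(3) by (simp add: disk_to_klein_def polar_to_klein_def) (simp add: z_def)
  qed
  finally show ?thesis .
qed

text \<open>For fixed \<theta> both sides are real analytic in u on the whole half-line and agree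
  far out, so they agree everywhere.\<close>

lemma extension_component:
  assumes "kobayashi_surface n \<alpha> f" "analytic_extension n \<alpha> f F" "(u, \<theta>) \<in> polar_dom n \<alpha>"
    and l: "bounded_linear l" and lX: "\<And>w. l (X w) = L v w" and v: "(\<Sum>j<2 * n. v j) = 0"
  shows "l (F (Pt u (cis \<theta>))) = l (f (Some 0)) + L v (polar_to_klein (u, \<theta>))"
proof -
  interpret l: bounded_linear l by fact
  define m where "m = Max ((\<lambda>j. cos (\<theta> - \<alpha> j)) ` {..<2 * n})"
  have dom: "(x, \<theta>) \<in> polar_dom n \<alpha> \<longleftrightarrow> x > m" for x
    by (simp add: polar_dom_def m_def)
  define h where "h x = l (f (Some 0)) + (\<Sum>j<2 * n. v j * ln (x - cos (\<theta> - \<alpha> j)))" for x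
  have h: "h x = l (f (Some 0)) + L v (polar_to_klein (x, \<theta>))" if "x > m" for x
  proof -
    have x: "(x, \<theta>) \<in> polar_dom n \<alpha>" using that dom by simp
    have x0: "x > 0" using polar_dom_pos[OF x] .
    have "L v (polar_to_klein (x, \<theta>)) = (\<Sum>j<2 * n. v j * ln (x * D j (polar_to_klein (x, \<theta>))))"
      using L_homogeneous[OF v, of "fst (polar_to_klein (x, \<theta>))" "snd (polar_to_klein (x, \<theta>))", OF _ x0]
        polar_to_klein_in_P[OF x] by simp
    then show ?thesis using x0 by (simp add: h_def D_polar_to_klein)
  qed
  have "l (F (Pt u (cis \<theta>))) - h u = 0"
  \<comment> \<open>Beyond \<open>max 1 m\<close> both the comparison with the disk and the formula
    for \<open>h\<close> apply.\<close>
  proof (rule real_analytic_eq_0[where f = "\<lambda>x. l (F (Pt x (cis \<theta>))) - h x" and m = m and ?u0.0 = "max 1 m"])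
    fix a assume "a > m"
    then have a: "(a, \<theta>) \<in> polar_dom n \<alpha>" by (simp add: dom)
    have "real_analytic_on (F \<circ> polar_pt) (polar_dom n \<alpha>)"
      using assms(2) by (auto simp: analytic_extension_def Omega_analytic_def Omega_atlas_def)
    from real_analytic_on_imp_real_analytic_at[OF this a l]
    have "real_analytic_at (\<lambda>x. l (F (Pt x (cis \<theta>)))) a" by (simp add: polar_pt_def)
    moreover have "real_analytic_at h a"
      unfolding h_def using a unfolding mem_polar_dom by (intro real_analytic_at_ln_sum) auto
    ultimately show "real_analytic_at (\<lambda>x. l (F (Pt x (cis \<theta>))) - h x) a"
      by (rule real_analytic_at_diff)
  next
    fix x assume x: "x > max 1 m"
    then show "l (F (Pt x (cis \<theta>))) - h x = 0"
      using extension_polar_1[OF assms(1,2), of x \<theta>] h[of x] by (simp add: l.add lX)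
  next
    show "u > m" using assms(3) dom by simp
  qed
  then show ?thesis using h[of u] assms(3) dom by simp
qed

lemma extension_polar:
  assumes "kobayashi_surface n \<alpha> f" "analytic_extension n \<alpha> f F" "(u, \<theta>) \<in> polar_dom n \<alpha>"
  shows "F (Pt u (cis \<theta>)) = f (Some 0) + X (polar_to_klein (u, \<theta>))"
proof -
  note e = extension_component[OF assms]
  have "fst (F (Pt u (cis \<theta>))) = fst (f (Some 0)) + L v0 (polar_to_klein (u, \<theta>))"
    by (rule e[OF bounded_linear_fst _ sum_v(1)]) (simp add: X_def)
  moreover have "fst (snd (F (Pt u (cis \<theta>)))) = fst (snd (f (Some 0))) + L v1 (polar_to_klein (u, \<theta>))"
    by (rule e[OF bounded_linear_compose[OF bounded_linear_fst bounded_linear_snd] _ sum_v(2)]) (simp add: X_def)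
  moreover have "snd (snd (F (Pt u (cis \<theta>)))) = snd (snd (f (Some 0))) + L v2 (polar_to_klein (u, \<theta>))"
    by (rule e[OF bounded_linear_compose[OF bounded_linear_snd bounded_linear_snd] _ sum_v(3)]) (simp add: X_def)
  ultimately show ?thesis by (simp add: prod_eq_iff X_def)
qed

end

lemma jacobian_compose:
  assumes f: "(f has_derivative f') (at (g x))" and g: "(g has_derivative g') (at x)"
  shows "planar_jacobian (\<lambda>x. f (g x)) x = planar_jacobian f (g x) * planar_jacobian g x"
proof -
  interpret f: bounded_linear f' using f by (rule has_derivative_bounded_linear)
  have "f' v = fst v *\<^sub>R f' (1, 0) + snd v *\<^sub>R f' (0, 1)" for v
  proof -
    have "v = fst v *\<^sub>R (1, 0) + snd v *\<^sub>R (0, 1)" by (simp add: prod_eq_iff)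
    then show ?thesis by (metis f.add f.scaleR)
  qed
  note f1 = this[of "g' (1, 0)"] this[of "g' (0, 1)"]
  have c: "((\<lambda>x. f (g x)) has_derivative (\<lambda>h. f' (g' h))) (at x)"
    by (rule has_derivative_compose[OF g f])
  show ?thesis
    unfolding jacobianI[OF c] jacobianI[OF f] jacobianI[OF g] f1 by (simp add: algebra_simps)
qed

lemma jacobian_cong_open:
  assumes "open S" "x \<in> S" "\<And>y. y \<in> S \<Longrightarrow> f y = g y"
  shows "planar_jacobian f x = planar_jacobian g x"
  using frechet_derivative_cong_open[OF assms] by (simp add: planar_jacobian_def)

context kobayashi
begin

section \<open>Coordinates\<close>

lemma open_polar_dom: "open (polar_dom n \<alpha>)"
proof -
  have "polar_dom n \<alpha> = (\<Inter>j\<in>{..<2 * n}. {x. cos (snd x - \<alpha> j) < fst x})"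
    by (auto simp: mem_polar_dom)
  moreover have "open {x :: real \<times> real. cos (snd x - \<alpha> j) < fst x}" for j
    by (intro open_Collect_less continuous_intros)
  ultimately show ?thesis by auto
qed

lemma polar_dom_fst_pos: "x \<in> polar_dom n \<alpha> \<Longrightarrow> fst x > 0"
  using polar_dom_pos[of "fst x" "snd x"] by simp

lemma smooth_on_polar_to_klein: "smooth_on polar_to_klein (polar_dom n \<alpha>)"
  unfolding polar_to_klein_def[abs_def]
  by (intro smooth_on_Pair smooth_on_divide open_polar_dom smooth_on_fst
      smooth_on_compose[OF open_polar_dom smooth_on_sin_cos(1)] smooth_on_compose[OF open_polar_dom smooth_on_sin_cos(2)]
      smooth_on_snd) (auto dest: polar_dom_fst_pos)

lemma jacobian_polar_to_klein:
  assumes "x \<in> polar_dom n \<alpha>"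
  shows "planar_jacobian polar_to_klein x \<noteq> 0"
proof -
  have u: "fst x > 0" by (rule polar_dom_fst_pos[OF assms])
  have "(polar_to_klein has_derivative (\<lambda>h. (- sin (snd x) * snd h / fst x - cos (snd x) * fst h / (fst x)\<^sup>2,
      cos (snd x) * snd h / fst x - sin (snd x) * fst h / (fst x)\<^sup>2))) (at x)"
    unfolding polar_to_klein_def[abs_def] using u
    by (auto intro!: derivative_eq_intros simp: fun_eq_iff field_simps power2_eq_square)
  from jacobianI[OF this] have "planar_jacobian polar_to_klein x =
      - (cos (snd x) / (fst x)\<^sup>2) * (cos (snd x) / fst x) - (- (sin (snd x) / fst x)) * - (sin (snd x) / (fst x)\<^sup>2)"
    by simp
  also have "\<dots> = - ((cos (snd x))\<^sup>2 + (sin (snd x))\<^sup>2) / ((fst x)\<^sup>2 * fst x)"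
  proof -
    have "- (a / r\<^sup>2) * (a / r) - (- (b / r)) * - (b / r\<^sup>2) = - (a\<^sup>2 + b\<^sup>2) / (r\<^sup>2 * r)" if "r \<noteq> 0" for a b r :: real
      using that by (simp add: power2_eq_square divide_simps)
    from this[of "fst x" "cos (snd x)" "sin (snd x)"] less_imp_neq[OF u] show ?thesis by metis
  qed
  finally show ?thesis using u by simp
qed

lemma mem_ball_0: "(x, y) \<in> ball (0, 0) 1 \<longleftrightarrow> x\<^sup>2 + y\<^sup>2 < (1 :: real)"
  by (simp add: dist_norm norm_prod_def)

lemma smooth_on_disk_to_klein: "smooth_on disk_to_klein (ball (0, 0) 1)"
proof -
  have "1 + (fst z)\<^sup>2 + (snd z)\<^sup>2 \<noteq> 0" for z :: "real \<times> real"
    using add_pos_nonneg[of 1 "(fst z)\<^sup>2 + (snd z)\<^sup>2"] by simp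
  then show ?thesis
    unfolding disk_to_klein_def[abs_def] power2_eq_square
    by (intro smooth_on_Pair smooth_on_divide smooth_on_add smooth_on_mult smooth_on_const smooth_on_fst smooth_on_snd
        open_ball) auto
qed

text \<open>The determinant is 4 (1 - |z|^2) / (1 + |z|^2)^3: it vanishes on the unit circle, so
  this chart serves only the open disk.\<close>

lemma jacobian_disk_to_klein:
  assumes "z \<in> ball (0, 0) 1"
  shows "planar_jacobian disk_to_klein z \<noteq> 0"
proof -
  obtain x y where z: "z = (x, y)" by force
  define s where "s = 1 + x\<^sup>2 + y\<^sup>2"
  have s: "s > 0" "s < 2" using assms by (simp_all add: z s_def mem_ball_0 add_pos_nonneg del: mem_ball)
  have "(disk_to_klein has_derivative (\<lambda>h. (2 * fst h / s - 2 * x * (2 * x * fst h + 2 * y * snd h) / s\<^sup>2,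
      2 * snd h / s - 2 * y * (2 * x * fst h + 2 * y * snd h) / s\<^sup>2))) (at z)"
    unfolding disk_to_klein_def[abs_def] z using s(1) unfolding s_def
    by (auto intro!: derivative_eq_intros simp: fun_eq_iff diff_divide_distrib power2_eq_square)
  from jacobianI[OF this] have "planar_jacobian disk_to_klein z =
      (2 / s - 2 * x * (2 * x) / s\<^sup>2) * (2 / s - 2 * y * (2 * y) / s\<^sup>2) - (2 * x * (2 * y) / s\<^sup>2) * (2 * y * (2 * x) / s\<^sup>2)"
    by simp
  also have "\<dots> = 4 * (2 - s) / (s\<^sup>2 * s)"
  proof -
    have "(2 / s - 2 * x * (2 * x) / s\<^sup>2) * (2 / s - 2 * y * (2 * y) / s\<^sup>2) - (2 * x * (2 * y) / s\<^sup>2) * (2 * y * (2 * x) / s\<^sup>2)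
        = (4 * s - 8 * (x\<^sup>2 + y\<^sup>2)) / (s\<^sup>2 * s)"
      using s(1) by (simp add: power2_eq_square divide_simps) (simp add: algebra_simps)
    also have "4 * s - 8 * (x\<^sup>2 + y\<^sup>2) = 4 * (2 - s)" by (simp add: s_def)
    finally show ?thesis .
  qed
  finally show ?thesis using s by simp
qed

lemma disk_to_klein_in_P:
  assumes "z \<in> ball (0, 0) 1"
  shows "disk_to_klein z \<in> P"
proof -
  define w where "w = Complex (fst z) (snd z)"
  have "norm w < 1"
    using assms mem_ball_0[of "fst z" "snd z"] by (simp add: w_def cmod_def del: mem_ball)
  then have "w \<in> cball 0 1 - nodes n \<alpha>" by (auto simp: nodes_eq)
  then have "w \<in> T" using disk_subset_T by blast
  have "1 - w * cnj (\<zeta> j) \<noteq> 0" if "j < 2 * n" for j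
  proof
    assume "1 - w * cnj (\<zeta> j) = 0"
    then have "Re (w * cnj (\<zeta> j)) = 1" by simp
    with \<open>w \<in> T\<close> that show False unfolding T_def by force
  qed
  then have "(1 + (norm w)\<^sup>2) * D j (disk_to_klein (Re w, Im w)) > 0" if "j < 2 * n" for j
    using that unfolding norm_one_minus_node[symmetric] by simp
  moreover have "1 + (norm w)\<^sup>2 > 0" by (simp add: add_pos_nonneg)
  ultimately show ?thesis by (simp add: P_def w_def zero_less_mult_iff)
qed

lemma iota_ball_in_Omega:
  assumes "norm z < 1"
  shows "iota z \<in> Omega n \<alpha>"
proof (cases "z = 0")
  case False
  define u where "u = (norm z + inverse (norm z)) / 2"
  have "(1 - norm z)\<^sup>2 > 0" using assms by simp
  then have "u > 1"
    using False by (simp add: u_def field_simps power2_eq_square)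
  then have "(u, Arg z) \<in> polar_dom n \<alpha>"
    unfolding mem_polar_dom using cos_le_one le_less_trans by blast
  moreover have "iota z = polar_pt (u, Arg z)"
    using False by (simp add: iota_def u_def polar_pt_def cis_Arg)
  ultimately show ?thesis by (auto simp: Omega_def)
qed (simp add: iota_def Omega_def)

text \<open>The coordinate w on abstract points; the value at \<open>P_inf\<close> is the limit for
  infinite u.\<close>

definition klein :: "ext_point \<Rightarrow> real \<times> real" where
  "klein p = (case p of Pt u z \<Rightarrow> (Re z / u, Im z / u) | P_inf \<Rightarrow> 0)"

lemma klein_polar: "klein (polar_pt x) = polar_to_klein x"
  by (simp add: klein_def polar_pt_def polar_to_klein_def case_prod_beta)

lemma klein_iota: "klein (iota (Complex x y)) = disk_to_klein (x, y)"
proof (cases "Complex x y = 0")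
  case True
  then show ?thesis by (simp add: klein_def iota_def disk_to_klein_def complex_eq_iff zero_prod_def)
next
  case False
  define r where "r = norm (Complex x y)"
  have r: "r > 0" using False by (simp add: r_def)
  have rs: "r\<^sup>2 = x\<^sup>2 + y\<^sup>2" by (simp add: r_def cmod_def)
  have *: "t / r / ((r + inverse r) / 2) = 2 * t / (1 + x\<^sup>2 + y\<^sup>2)" for t
  proof -
    have "t / r / ((r + inverse r) / 2) = 2 * t / (1 + r\<^sup>2)"
      using r by (simp add: field_simps power2_eq_square)
    then show ?thesis by (simp add: rs)
  qed
  have "klein (iota (Complex x y)) = (x / r / ((r + inverse r) / 2), y / r / ((r + inverse r) / 2))"
    using False by (simp add: klein_def iota_def sgn_eq flip: r_def)
  also have "\<dots> = disk_to_klein (x, y)"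
    unfolding * by (simp add: disk_to_klein_def)
  finally show ?thesis .
qed

text \<open>The norm of w recovers u, and then the direction recovers \<open>cis \<theta>\<close>,
  which is all that a point stores.\<close>

lemma klein_bij: "bij_betw klein (Omega n \<alpha>) P"
proof (rule bij_betwI')
  fix p q assume p: "p \<in> Omega n \<alpha>" and q: "q \<in> Omega n \<alpha>"
  have norm_klein: "u > 0 \<and> norm (klein (polar_pt (u, t))) = 1 / u" if "(u, t) \<in> polar_dom n \<alpha>" for u t
  proof -
    have "u > 0" by (rule polar_dom_pos[OF that])
    moreover have "(cos t / u)\<^sup>2 + (sin t / u)\<^sup>2 = (1 / u)\<^sup>2"
      by (simp add: power_divide flip: add_divide_distrib)
    moreover have "norm (klein (polar_pt (u, t))) = sqrt ((cos t / u)\<^sup>2 + (sin t / u)\<^sup>2)"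
      by (simp only: klein_polar polar_to_klein_def fst_conv snd_conv norm_Pair real_norm_def power2_abs)
    ultimately show ?thesis by simp
  qed
  show "(klein p = klein q) = (p = q)"
  proof
    assume e: "klein p = klein q"
    consider "p = P_inf" "q = P_inf" | u t where "p = polar_pt (u, t)" "(u, t) \<in> polar_dom n \<alpha>" "q = P_inf"
      | u t where "q = polar_pt (u, t)" "(u, t) \<in> polar_dom n \<alpha>" "p = P_inf"
      | u t u' t' where "p = polar_pt (u, t)" "(u, t) \<in> polar_dom n \<alpha>" "q = polar_pt (u', t')" "(u', t') \<in> polar_dom n \<alpha>"
      using p q by (auto simp: Omega_def)
    then show "p = q"
    proof cases
      case 2
      have "norm (klein (polar_pt (u, t))) = 0" using e 2(1,3) by (simp add: klein_def[of P_inf])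
      then show ?thesis using norm_klein[OF 2(2)] by simp
    next
      case 3
      have "norm (klein (polar_pt (u, t))) = 0" using e[symmetric] 3(1,3) by (simp add: klein_def[of P_inf])
      then show ?thesis using norm_klein[OF 3(2)] by simp
    next
      case 4
      have "u > 0" "u' > 0" "1 / u = 1 / u'"
        using norm_klein[OF 4(2)] norm_klein[OF 4(4)] e unfolding 4 by simp_all
      then have "u = u'" by simp
      with e \<open>u > 0\<close> have "cos t = cos t'" "sin t = sin t'"
        unfolding 4 klein_polar polar_to_klein_def by simp_all
      then show ?thesis unfolding 4 by (simp add: polar_pt_def \<open>u = u'\<close> complex_eq_iff)
    qed simp
  qed simp
next
  fix p assume "p \<in> Omega n \<alpha>"
  then show "klein p \<in> P"
    using polar_to_klein_in_P zero_in_P klein_polar by (auto simp: Omega_def klein_def polar_pt_def polar_to_klein_def)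
next
  fix w assume w: "w \<in> P"
  show "\<exists>p\<in>Omega n \<alpha>. w = klein p"
  proof (cases "w = 0")
    case True
    then show ?thesis by (intro bexI[of _ P_inf]) (auto simp: klein_def Omega_def)
  next
    case False
    obtain r t where t: "w = (r * cos t, r * sin t)" "r = norm w"
      by (rule polar_form)
    have r: "r > 0" using False t(2) by simp
    have "cos (t - \<alpha> j) < 1 / r" if "j < 2 * n" for j
      using D_pos[OF w, of j] that r unfolding t(1) D_polar by (simp add: field_simps)
    then have "(1 / r, t) \<in> polar_dom n \<alpha>" by (simp add: mem_polar_dom)
    moreover have "w = klein (polar_pt (1 / r, t))"
      by (simp add: klein_polar polar_to_klein_def t(1) mult.commute)
    ultimately show ?thesis by (auto simp: Omega_def)
  qed
qed

section \<open>The extension as an entire graph\<close>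

context
  fixes f :: "complex option \<Rightarrow> real \<times> real \<times> real" and F :: "ext_point \<Rightarrow> real \<times> real \<times> real"
  assumes surface: "kobayashi_surface n \<alpha> f" and extension: "analytic_extension n \<alpha> f F"
begin

lemma F_klein:
  assumes "p \<in> Omega n \<alpha>"
  shows "F p = f (Some 0) + X (klein p)"
proof (cases p)
  case P_inf
  have "F (iota 0) = f (Some 0)"
    using extension by (auto simp: analytic_extension_def nodes_eq)
  then show ?thesis
    by (simp add: P_inf iota_def klein_def X_def L_def D_def zero_prod_def)
next
  case (Pt u z)
  then obtain t where "p = polar_pt (u, t)" "(u, t) \<in> polar_dom n \<alpha>"
    using assms by (auto simp: Omega_def polar_pt_def)
  then show ?thesis
    using extension_polar[OF surface extension, of u t] klein_polar[of "(u, t)"] by (simp add: polar_pt_def)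
qed

definition G :: "ext_point \<Rightarrow> real \<times> real" where "G p = snd (F p)"

definition t0 :: "real \<times> real" where "t0 = snd (f (Some 0))"

lemma G_klein: "p \<in> Omega n \<alpha> \<Longrightarrow> G p = W t0 (klein p)"
  by (simp add: G_def F_klein W_def X_def t0_def prod_eq_iff)

lemma G_bij: "bij_betw G (Omega n \<alpha>) UNIV"
  using bij_betw_trans[OF klein_bij W_bij[of t0]] by (rule bij_betw_cong[THEN iffD1, rotated]) (simp add: G_klein)

text \<open>In either chart the projection is \<open>W t0\<close> after the Klein coordinate \<psi>
  of that chart, so smoothness and a nonzero Jacobian follow from the chain rule.\<close>

lemma chart_facts:
  assumes "(V, \<phi>) \<in> Omega_atlas n \<alpha>"
  shows "open V" "\<phi> ` V \<subseteq> Omega n \<alpha>" "smooth_on (G \<circ> \<phi>) V" "\<And>x. x \<in> V \<Longrightarrow> planar_jacobian (G \<circ> \<phi>) x \<noteq> 0"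
proof -
  have main: "open V \<and> \<phi> ` V \<subseteq> Omega n \<alpha> \<and> smooth_on (G \<circ> \<phi>) V \<and> (\<forall>x\<in>V. planar_jacobian (G \<circ> \<phi>) x \<noteq> 0)"
    if V: "open V" "\<phi> ` V \<subseteq> Omega n \<alpha>" and \<psi>: "\<And>x. x \<in> V \<Longrightarrow> klein (\<phi> x) = \<psi> x" "smooth_on \<psi> V"
      "\<And>x. x \<in> V \<Longrightarrow> planar_jacobian \<psi> x \<noteq> 0" "\<And>x. x \<in> V \<Longrightarrow> \<psi> x \<in> P" for V \<phi> \<psi>
  proof (intro conjI ballI V)
    have eq: "W t0 (\<psi> x) = (G \<circ> \<phi>) x" if "x \<in> V" for x
      using G_klein[of "\<phi> x"] \<psi>(1)[OF that] that V(2) by auto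
    have "smooth_on (\<lambda>x. W t0 (\<psi> x)) V"
      using \<psi>(4) by (intro smooth_on_compose[OF V(1) smooth_on_W \<psi>(2)]) auto
    then show "smooth_on (G \<circ> \<phi>) V"
      by (rule smooth_on_cong[OF V(1) eq, rotated])
    fix x assume x: "x \<in> V"
    have "planar_jacobian (\<lambda>x. W t0 (\<psi> x)) x = planar_jacobian (W t0) (\<psi> x) * planar_jacobian \<psi> x"
      by (rule jacobian_compose[OF W_has_derivative[OF \<psi>(4)[OF x]] smooth_on_has_derivative[OF \<psi>(2) x]])
    moreover have "planar_jacobian (\<lambda>x. W t0 (\<psi> x)) x = planar_jacobian (G \<circ> \<phi>) x"
      by (rule jacobian_cong_open[OF V(1) x eq])
    ultimately show "planar_jacobian (G \<circ> \<phi>) x \<noteq> 0"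
      using jacobian_W_nonzero[OF \<psi>(4)[OF x], of t0] \<psi>(3)[OF x] by simp
  qed
  consider "V = polar_dom n \<alpha>" "\<phi> = polar_pt" | "V = ball (0, 0) 1" "\<phi> = (\<lambda>(x, y). iota (Complex x y))"
    using assms by (auto simp: Omega_atlas_def)
  then have "open V \<and> \<phi> ` V \<subseteq> Omega n \<alpha> \<and> smooth_on (G \<circ> \<phi>) V \<and> (\<forall>x\<in>V. planar_jacobian (G \<circ> \<phi>) x \<noteq> 0)"
  proof cases
    case 1
    show ?thesis unfolding 1
    proof (rule main[OF open_polar_dom _ klein_polar smooth_on_polar_to_klein jacobian_polar_to_klein])
      fix x assume "x \<in> polar_dom n \<alpha>"
      then show "polar_to_klein x \<in> P"
        using polar_to_klein_in_P[of "fst x" "snd x"] by simp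
    qed (auto simp: Omega_def)
  next
    case 2
    show ?thesis unfolding 2
    proof (rule main[OF open_ball _ _ smooth_on_disk_to_klein jacobian_disk_to_klein disk_to_klein_in_P])
      have "iota (Complex x y) \<in> Omega n \<alpha>" if "(x, y) \<in> ball (0, 0) 1" for x y
        using that by (intro iota_ball_in_Omega) (simp add: mem_ball_0 cmod_def del: mem_ball)
      then show "(\<lambda>(x, y). iota (Complex x y)) ` ball (0, 0) 1 \<subseteq> Omega n \<alpha>"
        by (auto simp del: mem_ball)
    qed (auto simp: klein_iota)
  qed
  then show "open V" "\<phi> ` V \<subseteq> Omega n \<alpha>" "smooth_on (G \<circ> \<phi>) V" "\<And>x. x \<in> V \<Longrightarrow> planar_jacobian (G \<circ> \<phi>) x \<noteq> 0"
    by auto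
qed

lemma Omega_covered:
  assumes "p \<in> Omega n \<alpha>"
  obtains V \<phi> x where "(V, \<phi>) \<in> Omega_atlas n \<alpha>" "x \<in> V" "p = \<phi> x"
proof (cases "p = P_inf")
  case True
  then show ?thesis
    using that[of "ball (0, 0) 1" "\<lambda>(x, y). iota (Complex x y)" "(0, 0)"]
    by (simp add: Omega_atlas_def iota_def Complex_eq)
next
  case False
  then obtain x where "x \<in> polar_dom n \<alpha>" "p = polar_pt x"
    using assms by (auto simp: Omega_def)
  then show ?thesis
    using that[of "polar_dom n \<alpha>" polar_pt x] by (simp add: Omega_atlas_def)
qed

lemma G_diffeomorphism: "Omega_diffeomorphism n \<alpha> G"
  unfolding Omega_diffeomorphism_def
proof (intro conjI G_bij)
  show "Omega_smooth n \<alpha> G"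
    unfolding Omega_smooth_def using chart_facts(3) by auto
  show "smooth_into_Omega n \<alpha> (inv_into (Omega n \<alpha>) G)"
    unfolding smooth_into_Omega_def
  proof
    fix q :: "real \<times> real"
    have "q \<in> G ` Omega n \<alpha>" using G_bij by (simp add: bij_betw_def)
    then obtain p where p: "p \<in> Omega n \<alpha>" "q = G p" by blast
    obtain V \<phi> x where V: "(V, \<phi>) \<in> Omega_atlas n \<alpha>" "x \<in> V" "p = \<phi> x"
      by (rule Omega_covered[OF p(1)])
    note c = chart_facts[OF V(1)]
    obtain U U' h where U: "open U" "U \<subseteq> V" "x \<in> U" "open U'" "homeomorphism U U' (G \<circ> \<phi>) h" "smooth_on h U'"
      by (rule local_homeomorphism_smooth_inverse[OF c(1,3,4) V(2)])
    have "q \<in> U'" using U(3,5) p(2) V(3) by (auto simp: homeomorphism_def)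
    moreover have "h ` U' \<subseteq> V" using U(2,5) by (auto simp: homeomorphism_def)
    \<comment> \<open>Global injectivity identifies the local inverse in the chart with the global
      one.\<close>
    moreover have "inv_into (Omega n \<alpha>) G y = \<phi> (h y)" if y: "y \<in> U'" for y
    proof (rule inv_into_f_eq)
      show "inj_on G (Omega n \<alpha>)" using G_bij by (simp add: bij_betw_def)
      have "h y \<in> V" using \<open>h ` U' \<subseteq> V\<close> y by auto
      then show "\<phi> (h y) \<in> Omega n \<alpha>" using c(2) by auto
      show "G (\<phi> (h y)) = y" using homeomorphism_apply2[OF U(5) y] by simp
    qed
    ultimately show "\<exists>(V, \<phi>)\<in>Omega_atlas n \<alpha>. \<exists>U h. open U \<and> q \<in> U \<and> smooth_on h U \<and> h ` U \<subseteq> V \<and>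
        (\<forall>q\<in>U. inv_into (Omega n \<alpha>) G q = \<phi> (h q))"
      using V(1) U(4,6) by blast
  qed
qed

section \<open>The height function of the graph\<close>

definition height :: "real \<times> real \<Rightarrow> real" where
  "height q = fst (f (Some 0)) + L v0 (inv_into P (W t0) q)"

lemma height_W: "w \<in> P \<Longrightarrow> height (W t0 w) = fst (f (Some 0)) + L v0 w"
  using W_bij[of t0] by (simp add: height_def bij_betw_def)

lemma W_surj:
  obtains w where "w \<in> P" "q = W t0 w"
proof -
  have "q \<in> W t0 ` P" using W_bij[of t0] by (simp add: bij_betw_def)
  then show thesis using that by blast
qed

text \<open>\<open>inv_into\<close> carries no regularity of its own; near each point
  \<open>height_W\<close> allows it to be replaced by a smooth local inverse.\<close>

lemma smooth_on_height: "smooth_on height UNIV"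
proof (rule smooth_on_local)
  fix q :: "real \<times> real"
  obtain w where w: "w \<in> P" "q = W t0 w" by (rule W_surj)
  obtain U U' h where U: "open U" "U \<subseteq> P" "w \<in> U" "open U'" "homeomorphism U U' (W t0) h" "smooth_on h U'"
    by (rule local_homeomorphism_smooth_inverse[OF open_P smooth_on_W jacobian_W_nonzero w(1)])
  have hP: "h ` U' \<subseteq> P" using U(2,5) by (auto simp: homeomorphism_def)
  have sm: "smooth_on (\<lambda>y. fst (f (Some 0)) + L v0 (h y)) U'"
    by (intro smooth_on_add smooth_on_const smooth_on_compose[OF U(4) smooth_on_L U(6) hP] U(4))
  have eq: "fst (f (Some 0)) + L v0 (h y) = height y" if "y \<in> U'" for y
    using height_W[of "h y"] hP homeomorphism_apply2[OF U(5) that] that by auto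
  have "smooth_on height U'"
    by (rule smooth_on_cong[OF U(4) eq sm])
  moreover have "q \<in> U'" using U(3,5) w(2) by (auto simp: homeomorphism_def)
  ultimately show "\<exists>U. open U \<and> q \<in> U \<and> smooth_on height U" using U(4) by blast
qed

lemma image_F: "F ` Omega n \<alpha> = {(height (x, y), x, y) | x y. True}"
proof -
  have F: "F p = (height (G p), G p)" if "p \<in> Omega n \<alpha>" for p
  proof -
    have "klein p \<in> P" using klein_bij that by (auto simp: bij_betw_def)
    then have "height (G p) = fst (F p)"
      using height_W[of "klein p"] G_klein[OF that] F_klein[OF that] by (simp add: X_def)
    then show ?thesis by (simp add: G_def prod_eq_iff)
  qed
  have "F ` Omega n \<alpha> = (\<lambda>q. (height q, q)) ` G ` Omega n \<alpha>"
    unfolding image_image using F by (intro image_cong) auto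
  also have "G ` Omega n \<alpha> = UNIV" using G_bij by (simp add: bij_betw_def)
  finally show ?thesis by auto
qed

text \<open>Halfway between the first two nodes no cosine reaches 1, so the polygon extends beyond
  the unit circle in that direction.\<close>

lemma ex_exterior_point: obtains a b where "(a, b) \<in> P" "a\<^sup>2 + b\<^sup>2 > 1"
proof -
  define t where "t = \<alpha> 1 / 2"
  have t: "0 < t" "t < \<alpha> 1" "\<alpha> 1 < 2 * pi"
    using \<alpha>_less[of 0 1] \<alpha>_0 n_ge_2 \<alpha>_less_2pi[of 1] by (auto simp: t_def)
  have lt1: "cos (t - \<alpha> j) < 1" if "j < 2 * n" for j
  proof (cases "j = 0")
    case True
    have "cos t < cos 0" using t \<alpha>_less[of 0 1] by (intro cos_monotone_0_pi) (auto simp: t_def)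
    then show ?thesis using True \<alpha>_0 by simp
  next
    case False
    then have "\<alpha> 1 \<le> \<alpha> j" using \<alpha>_less[of 1 j] that by (cases "j = 1") auto
    then have d: "0 < \<alpha> j - t" "\<alpha> j - t < 2 * pi" using t \<alpha>_less_2pi[OF that] by auto
    have "cos (\<alpha> j - t) < max (cos 0) (cos 0)"
      using d by (intro cos_less_max) auto
    then show ?thesis using cos_minus[of "t - \<alpha> j"] by simp
  qed
  define m where "m = Max ((\<lambda>j. cos (t - \<alpha> j)) ` {..<2 * n})"
  have "{..<2 * n} \<noteq> {}" using n_ge_2 by (auto simp: lessThan_empty_iff)
  then have m1: "m < 1" unfolding m_def using lt1 by (subst Max_less_iff) auto
  \<comment> \<open>Strictly between the largest cosine and 1: inside the domain, yet with |w| = 1 /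
    u > 1.\<close>
  define u where "u = (m + 1) / 2"
  have "(u, t) \<in> polar_dom n \<alpha>" using m1 by (simp add: polar_dom_def m_def u_def)
  then have "u > 0" "polar_to_klein (u, t) \<in> P" by (rule polar_dom_pos, rule polar_to_klein_in_P)
  moreover have "(cos t / u)\<^sup>2 + (sin t / u)\<^sup>2 > 1"
  proof -
    have "(cos t / u)\<^sup>2 + (sin t / u)\<^sup>2 = 1 / u\<^sup>2"
      by (simp add: power_divide flip: add_divide_distrib)
    moreover have "u\<^sup>2 < 1" using \<open>u > 0\<close> m1 by (simp add: u_def power_less_one_iff)
    ultimately show ?thesis using \<open>u > 0\<close> by simp
  qed
  ultimately show thesis using that by (simp add: polar_to_klein_def)
qed

lemma zmc_graph: "zmc_entire_graph_of_mixed_type (F ` Omega n \<alpha>)"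
  unfolding zmc_entire_graph_of_mixed_type_def
proof (intro exI conjI)
  show "entire_graph_of height (F ` Omega n \<alpha>)"
    by (simp add: entire_graph_of_def smooth_on_height image_F)
  note zmc = W_zmc[OF smooth_on_height height_W]
  show "zero_mean_curvature height"
    unfolding zero_mean_curvature_def
  proof
    fix q :: "real \<times> real"
    obtain w where w: "w \<in> P" "q = W t0 w" by (rule W_surj)
    then show "(1 - (dy height q)\<^sup>2) * dx (dx height) q + 2 * dx height q * dy height q * dy (dx height) q
        + (1 - (dx height q)\<^sup>2) * dy (dy height) q = 0"
      using zmc(1)[of "fst w" "snd w"] by simp
  qed
  show "mixed_type height"
    unfolding mixed_type_def
  proof
    \<comment> \<open>An interior point of the disk, in the polygon for all angles. The origin is
      avoided because \<open>W_zmc\<close> compares the type at nonzero points only.\<close>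
    have "(1 / 2, 0) \<in> P"
    proof -
      have "D j (1 / 2, 0) > 0" for j
      proof -
        have "cos (\<alpha> j) < 2" using cos_le_one[of "\<alpha> j"] by linarith
        then show ?thesis by (simp add: D_def)
      qed
      then show ?thesis by (simp add: P_def)
    qed
    then obtain k where "k > 0" "1 - ((dx height (W t0 (1 / 2, 0)))\<^sup>2 + (dy height (W t0 (1 / 2, 0)))\<^sup>2) = k * (1 - ((1 / 2)\<^sup>2 + 0\<^sup>2))"
      using zmc(2)[of "1 / 2" 0] by (auto simp: zero_prod_def)
    moreover from \<open>k > 0\<close> have "k * (1 - ((1 / 2)\<^sup>2 + 0\<^sup>2)) > 0" by (simp add: power2_eq_square)
    ultimately show "\<exists>p. (dx height p)\<^sup>2 + (dy height p)\<^sup>2 < 1"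
      by (intro exI[of _ "W t0 (1 / 2, 0)"]) linarith
    obtain a b where ab: "(a, b) \<in> P" "a\<^sup>2 + b\<^sup>2 > 1" by (rule ex_exterior_point)
    then have "(a, b) \<noteq> 0" by (auto simp: zero_prod_def)
    then obtain k where "k > 0" "1 - ((dx height (W t0 (a, b)))\<^sup>2 + (dy height (W t0 (a, b)))\<^sup>2) = k * (1 - (a\<^sup>2 + b\<^sup>2))"
      using zmc(2)[OF _ ab(1)] by blast
    moreover from \<open>k > 0\<close> ab(2) have "k * (1 - (a\<^sup>2 + b\<^sup>2)) < 0" by (simp add: mult_pos_neg)
    ultimately show "\<exists>p. (dx height p)\<^sup>2 + (dy height p)\<^sup>2 > 1"
      by (intro exI[of _ "W t0 (a, b)"]) linarith
  qed
qed

end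

end

theorem theorem4p5:
  fixes n :: nat
    and \<alpha> :: "nat \<Rightarrow> real"
    and f :: "complex option \<Rightarrow> real \<times> real \<times> real"
    and F :: "ext_point \<Rightarrow> real \<times> real \<times> real"
  assumes "n \<ge> 2"
    and "\<alpha> 0 = 0"
    and "\<And>j. j < 2 * n \<Longrightarrow> \<alpha> j < \<alpha> (j + 1)"
    and "\<alpha> (2 * n) = 2 * pi"
    and "kobayashi_surface n \<alpha> f"
    and "\<And>j. j < 2 * n \<Longrightarrow> \<bar>\<alpha> j - \<alpha> (j + 1)\<bar> \<le> pi / (real n - 1)"
    and "analytic_extension n \<alpha> f F"
  shows "Omega_diffeomorphism n \<alpha> (\<lambda>p. snd (F p)) \<and>
         zmc_entire_graph_of_mixed_type (F ` Omega n \<alpha>)"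
proof -
  interpret kobayashi n \<alpha>
    by unfold_locales (use assms in auto)
  show ?thesis
    using G_diffeomorphism[OF assms(5,7)] zmc_graph[OF assms(5,7)]
    unfolding G_def[OF assms(5,7), abs_def] by blast
qed

end
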